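(* Let $((\rho,\eta)\mathring H,(\rho,\eta)\mathring V)$ be a distinguished linear $(\rho,\eta)$-connection for the generalized tangent bundle $(\rho,\eta)TE$ and let $G=g_{\alpha\beta}\,d\tilde z^\alpha\otimes d\tilde z^\beta+g_{ab}\,\delta\tilde y^a\otimes\delta\tilde y^b$ be a (pseudo)metrical structure. Then the real local functions $$H^\alpha_{\beta\gamma}=\mathring H^\alpha_{\beta\gamma}+\tfrac12\tilde g^{\alpha\varepsilon}g_{\varepsilon\beta\overset{0}{|}\gamma},\qquad H^a_{b\gamma}=\mathring H^a_{b\gamma}+\tfrac12\tilde g^{ae}g_{eb\overset{0}{|}\gamma},$$ $$V^\alpha_{\beta c}=\mathring V^\alpha_{\beta c}+\tfrac12\tilde g^{\alpha\varepsilon}g_{\varepsilon\beta}\overset{0}{|}_c,\qquad V^a_{bc}=\mathring V^a_{bc}+\tfrac12\tilde g^{ae}g_{eb}\overset{0}{|}_c$$ are the components of a distinguished linear $(\rho,\eta)$-connection $D$ such that $(\rho,\eta)TE$ becomes $(\rho,\eta)$-(pseudo)metrizable, i.e. $D_XG=0$ for every section $X$ of $(\rho,\eta)TE$.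
   Context: Everything is smooth; repeated indices are summed. Setting. $M,N$ are manifolds of dimension $m$, $h:M\to N$ and $\eta:N\to M$ are diffeomorphisms, $\nu:F\to N$ is a vector bundle of rank $p$, $\pi:E\to M$ a vector bundle of rank $r$. A generalized Lie algebroid structure $([\,,]_{F,h},(\rho,\eta))$ on $F$ consists of a vector bundle morphism $\rho:F\to TM$ covering $\eta$ and a Lie bracket $[\,,]_{F,h}$ on $\Gamma(F)$ with $[u,fv]_{F,h}=f[u,v]_{F,h}+(\mathcal A(u)f)\,v$ for $f\in C^\infty(N)$, where the map $\mathcal A=\Gamma(Th\circ\rho,h\circ\eta):\Gamma(F)\to\Gamma(TN)$ is a morphism of Lie algebras. Such a structure is fixed. In local coordinates $x^i$ on $M$ and a local frame $t_\alpha$ of $F$, $\mathcal A$ is described by local functions $\rho^i_\alpha$ on $N$ via $(\mathcal A(z^\alpha t_\alpha)f)\circ h=(\rho^i_\alpha\circ h)(z^\alpha\circ h)\,\partial(f\circ h)/\partial x^i$; thus $\mathcal A$ is $C^\infty(N)$-linear and the functions $\rho^i_\alpha\circ h$ are the components of a bundle map $h^*F\to TM$ over $\mathrm{Id}_M$. Generalized tangent bundle. Let $(x^i,y^a)$ be vector bundle coordinates on $E$ and $T_\alpha$ the frame of $\pi^*(h^*F)$ induced by $t_\alpha$. $(\rho,\eta)TE$ is the vector subbundle of $\pi^*(h^*F)\oplus TE\to E$ with local frame (natural base) $\tilde\partial_\alpha=T_\alpha\oplus(\rho^i_\alpha\circ h\circ\pi)\frac{\partial}{\partial x^i}$, $\dot{\tilde\partial}_a=0\oplus\frac{\partial}{\partial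 y^a}$. The anchor $\tilde\rho:(\rho,\eta)TE\to TE$ is $\tilde\rho(Z^\alpha\tilde\partial_\alpha+Y^a\dot{\tilde\partial}_a)=Z^\alpha(\rho^i_\alpha\circ h\circ\pi)\frac{\partial}{\partial x^i}+Y^a\frac{\partial}{\partial y^a}$; $\tilde\rho(X)f$ is the derivative of $f\in C^\infty(E)$ along the vector field $\tilde\rho(X)$. The vertical subbundle $V(\rho,\eta)TE$ is spanned by the $\dot{\tilde\partial}_a$. A $(\rho,\eta)$-connection $(\rho,\eta)\Gamma$ for $E$, fixed throughout, is a vector bundle map $(\rho,\eta)TE\to V(\rho,\eta)TE$ over $\mathrm{Id}_E$ which is the identity on $V(\rho,\eta)TE$; locally it maps $Z^\gamma\tilde\partial_\gamma+Y^a\dot{\tilde\partial}_a$ to $(Y^a+\Gamma^a_\gamma Z^\gamma)\dot{\tilde\partial}_a$, where $\Gamma^a_\gamma$ abbreviates $(\rho,\eta)\Gamma^a_\gamma$. Its kernel is the horizontal subbundle $H(\rho,\eta)TE$, with frame $\tilde\delta_\alpha=\tilde\partial_\alpha-\Gamma^a_\alpha\dot{\tilde\partial}_a$. The dual frame of $(\tilde\delta_\alpha,\dot{\tilde\partial}_a)$ is $(d\tilde z^\alpha,\delta\tilde y^a)$. Distinguished linear $(\rho,\eta)$-connection: a covariant derivative $D$ on the tensor algebra of $(\rho,\eta)TE$ ($C^\infty(E)$-linear in $X$, $D_Xf=\tilde\rho(X)f$, a derivation of tensor products commuting with contractions) preserving $H(\rho,\eta)TE$ and $V(\rho,\eta)TE$.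 Its components are given by $D_{\tilde\delta_\gamma}\tilde\delta_\beta=H^\alpha_{\beta\gamma}\tilde\delta_\alpha$, $D_{\tilde\delta_\gamma}\dot{\tilde\partial}_b=H^a_{b\gamma}\dot{\tilde\partial}_a$, $D_{\dot{\tilde\partial}_c}\tilde\delta_\beta=V^\alpha_{\beta c}\tilde\delta_\alpha$, $D_{\dot{\tilde\partial}_c}\dot{\tilde\partial}_b=V^a_{bc}\dot{\tilde\partial}_a$ (the prefix $(\rho,\eta)$ on components is dropped). Those of the given connection carry a ring. A (pseudo)metrical structure is a tensor field $G=g_{\alpha\beta}d\tilde z^\alpha\otimes d\tilde z^\beta+g_{ab}\delta\tilde y^a\otimes\delta\tilde y^b$ with symmetric components such that the matrices $(g_{\alpha\beta})$, $(g_{ab})$ are nondegenerate at every point of $E$ (metrical if moreover both have constant signature); $\tilde g^{\alpha\beta}$, $\tilde g^{ab}$ are the inverse matrices. Covariant derivatives with respect to the ringed connection: $g_{\varepsilon\beta\overset{0}{|}\gamma}=\tilde\rho(\tilde\delta_\gamma)g_{\varepsilon\beta}-\mathring H^\theta_{\varepsilon\gamma}g_{\theta\beta}-\mathring H^\theta_{\beta\gamma}g_{\varepsilon\theta}$, $g_{eb\overset{0}{|}\gamma}=\tilde\rho(\tilde\delta_\gamma)g_{eb}-\mathring H^d_{e\gamma}g_{db}-\mathring H^d_{b\gamma}g_{ed}$, $g_{\varepsilon\beta}\overset{0}{|}_c=\tilde\rho(\dot{\tilde\partial}_c)g_{\varepsilon\beta}-\mathring V^\theta_{\varepsilon c}g_{\theta\beta}-\mathring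 V^\theta_{\beta c}g_{\varepsilon\theta}$, $g_{eb}\overset{0}{|}_c=\tilde\rho(\dot{\tilde\partial}_c)g_{eb}-\mathring V^d_{ec}g_{db}-\mathring V^d_{bc}g_{ed}$. *)

theory Defs
  imports "HOL-Analysis.Analysis" "HOL-Library.Function_Algebras"
begin

section \<open>Preliminaries\<close>

text \<open>Tangent vectors, covectors and tensors are functions; they are added and scaled pointwise.\<close>

instantiation "fun" :: (type, real_vector) real_vector
begin

definition scaleR_fun :: "real \<Rightarrow> ('a \<Rightarrow> 'b) \<Rightarrow> 'a \<Rightarrow> 'b" where
  "scaleR_fun c f = (\<lambda>x. c *\<^sub>R f x)"

instance
  by standard (auto simp: scaleR_fun_def fun_eq_iff scaleR_add_right scaleR_add_left)

end

primrec Ck_on :: "nat \<Rightarrow> ('v::euclidean_space \<Rightarrow> 'b::real_normed_vector) \<Rightarrow> 'v set \<Rightarrow> bool" where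
  "Ck_on 0 f S \<longleftrightarrow> continuous_on S f"
| "Ck_on (Suc k) f S \<longleftrightarrow> (\<forall>x\<in>S. f differentiable (at x)) \<and>
     (\<forall>v. Ck_on k (\<lambda>x. frechet_derivative f (at x) v) S)"

definition smooth_on :: "('v::euclidean_space \<Rightarrow> 'b::real_normed_vector) \<Rightarrow> 'v set \<Rightarrow> bool" where
  "smooth_on f S \<longleftrightarrow> (\<forall>k. Ck_on k f S)"

definition linear_over :: "'w::real_vector set \<Rightarrow> ('w \<Rightarrow> 'z::real_vector) \<Rightarrow> bool" where
  "linear_over V f \<longleftrightarrow> (\<forall>a\<in>V. \<forall>b\<in>V. \<forall>c. f (c *\<^sub>R a + b) = c *\<^sub>R f a + f b)"

definition restrict0 :: "'a set \<Rightarrow> ('a \<Rightarrow> 'w::zero) \<Rightarrow> 'a \<Rightarrow> 'w" where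
  "restrict0 W s = (\<lambda>p. if p \<in> W then s p else 0)"


section \<open>Manifolds\<close>

text \<open>A manifold modelled on a Euclidean space is a set of points with a smooth atlas (not
  necessarily maximal); its topology is the one for which the charts are homeomorphisms onto open
  sets. A chart is a domain together with a map whose values off the domain are irrelevant.\<close>

type_synonym ('a, 'v) chart = "'a set \<times> ('a \<Rightarrow> 'v)"

record ('a, 'v) mfd =
  pts :: "'a set"
  atlas :: "('a, 'v) chart set"

definition mopen :: "('a, 'v::euclidean_space) mfd \<Rightarrow> 'a set \<Rightarrow> bool" where
  "mopen X W \<longleftrightarrow> W \<subseteq> pts X \<and> (\<forall>(U, \<phi>)\<in>atlas X. open (\<phi> ` (U \<inter> W)))"

definition smooth_manifold :: "('a, 'v::euclidean_space) mfd \<Rightarrow> bool" where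
  "smooth_manifold X \<longleftrightarrow>
     (\<Union>(U, \<phi>)\<in>atlas X. U) = pts X \<and>
     (\<forall>(U, \<phi>)\<in>atlas X. inj_on \<phi> U) \<and>
     (\<forall>(U, \<phi>)\<in>atlas X. \<forall>(V, \<psi>)\<in>atlas X.
        open (\<phi> ` (U \<inter> V)) \<and> smooth_on (\<psi> \<circ> inv_into U \<phi>) (\<phi> ` (U \<inter> V))) \<and>
     Hausdorff_space (topology (mopen X)) \<and> second_countable (topology (mopen X))"

definition smooth_fun :: "('a, 'v::euclidean_space) mfd \<Rightarrow> 'a set \<Rightarrow> ('a \<Rightarrow> real) \<Rightarrow> bool" where
  "smooth_fun X W f \<longleftrightarrow> (\<forall>(U, \<phi>)\<in>atlas X. smooth_on (f \<circ> inv_into U \<phi>) (\<phi> ` (U \<inter> W)))"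

definition smooth_map ::
  "('a, 'v::euclidean_space) mfd \<Rightarrow> ('b, 'u::euclidean_space) mfd \<Rightarrow> ('a \<Rightarrow> 'b) \<Rightarrow> bool" where
  "smooth_map X Y f \<longleftrightarrow> f ` pts X \<subseteq> pts Y \<and>
     (\<forall>(U, \<phi>)\<in>atlas X. \<forall>(V, \<psi>)\<in>atlas Y.
        open (\<phi> ` (U \<inter> f -` V)) \<and> smooth_on (\<psi> \<circ> f \<circ> inv_into U \<phi>) (\<phi> ` (U \<inter> f -` V)))"

definition diffeomorphism ::
  "('a, 'v::euclidean_space) mfd \<Rightarrow> ('b, 'u::euclidean_space) mfd \<Rightarrow> ('a \<Rightarrow> 'b) \<Rightarrow> bool" where
  "diffeomorphism X Y f \<longleftrightarrow> bij_betw f (pts X) (pts Y) \<and>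
     smooth_map X Y f \<and> smooth_map Y X (inv_into (pts X) f)"

text \<open>A tangent vector at \<open>p\<close> assigns to every chart around \<open>p\<close> its coordinate vector in that chart
  (and \<open>0\<close> to everything else), compatibly with the derivatives of the transition maps.
  \<open>tvec X c p u\<close> is the one with coordinates \<open>u\<close> in the chart \<open>c\<close>.\<close>

type_synonym ('a, 'v) tangent = "('a, 'v) chart \<Rightarrow> 'v"

definition tvec ::
  "('a, 'v::euclidean_space) mfd \<Rightarrow> ('a, 'v) chart \<Rightarrow> 'a \<Rightarrow> 'v \<Rightarrow> ('a, 'v) tangent" where
  "tvec X c p u = (\<lambda>(V, \<psi>). if (V, \<psi>) \<in> atlas X \<and> p \<in> V
     then frechet_derivative (\<psi> \<circ> inv_into (fst c) (snd c)) (at (snd c p)) u else 0)"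

definition tangent_space :: "('a, 'v::euclidean_space) mfd \<Rightarrow> 'a \<Rightarrow> ('a, 'v) tangent set" where
  "tangent_space X p = (\<Union>c\<in>{c\<in>atlas X. p \<in> fst c}. range (tvec X c p))"

text \<open>The derivative of a function along a tangent vector \<open>w\<close> at \<open>p\<close>; it does not depend on the chart.\<close>

definition tderiv ::
  "('a, 'v::euclidean_space) mfd \<Rightarrow> 'a \<Rightarrow> ('a, 'v) tangent \<Rightarrow> ('a \<Rightarrow> 'b::real_normed_vector) \<Rightarrow> 'b" where
  "tderiv X p w f = (let c = (SOME c. c \<in> atlas X \<and> p \<in> fst c)
     in frechet_derivative (f \<circ> inv_into (fst c) (snd c)) (at (snd c p)) (w c))"

definition tangent_map ::
  "('a, 'v::euclidean_space) mfd \<Rightarrow> ('b, 'u::euclidean_space) mfd \<Rightarrow> ('a \<Rightarrow> 'b) \<Rightarrow> 'a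
    \<Rightarrow> ('a, 'v) tangent \<Rightarrow> ('b, 'u) tangent" where
  "tangent_map X Y f p w =
     (\<lambda>(V, \<psi>). if (V, \<psi>) \<in> atlas Y \<and> f p \<in> V then tderiv X p w (\<psi> \<circ> f) else 0)"


section \<open>Vector bundles\<close>

text \<open>The fibres of a vector bundle are subspaces of one real vector space \<open>'w\<close> without topology.
  This is no restriction: every family of vector spaces embeds in its direct sum. The fibres need
  not be disjoint; a point of the total space is a pair of a base point and a fibre vector. The
  bundle structure is given by local frames over a cover, indexed by \<open>'i\<close> (so the rank is
  \<open>CARD('i)\<close>), whose transition coefficients are smooth.\<close>

record ('a, 'v, 'w, 'i) vbundle =
  base :: "('a, 'v) mfd"
  fibre :: "'a \<Rightarrow> 'w set"
  frames :: "('a set \<times> ('i \<Rightarrow> 'a \<Rightarrow> 'w)) set"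

text \<open>\<open>coframe t i p\<close> is the \<open>i\<close>-th element of the dual basis of \<open>t\<close> at \<open>p\<close>, extended by \<open>0\<close> to vectors
  outside the span.\<close>

definition coframe :: "('i \<Rightarrow> 'a \<Rightarrow> 'w::real_vector) \<Rightarrow> 'i \<Rightarrow> 'a \<Rightarrow> 'w \<Rightarrow> real" where
  "coframe t i p = (\<lambda>v. representation (range (\<lambda>j. t j p)) v (t i p))"

definition vector_bundle :: "('a, 'v::euclidean_space, 'w::real_vector, 'i::finite) vbundle \<Rightarrow> bool" where
  "vector_bundle B \<longleftrightarrow> smooth_manifold (base B) \<and>
     (\<Union>(U, t)\<in>frames B. U) = pts (base B) \<and>
     (\<forall>(U, t)\<in>frames B. mopen (base B) U \<and>
        (\<forall>p\<in>U. inj (\<lambda>i. t i p) \<and> independent (range (\<lambda>i. t i p)) \<and>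
                span (range (\<lambda>i. t i p)) = fibre B p)) \<and>
     (\<forall>(U, t)\<in>frames B. \<forall>(V, s)\<in>frames B. \<forall>i j.
        smooth_fun (base B) (U \<inter> V) (\<lambda>p. coframe s j p (t i p)))"

text \<open>Smooth sections over an open set \<open>W\<close>, extended by \<open>0\<close> so that equality of sections is equality
  of functions.\<close>

definition sections ::
  "('a, 'v::euclidean_space, 'w::real_vector, 'i::finite) vbundle \<Rightarrow> 'a set \<Rightarrow> ('a \<Rightarrow> 'w) set" where
  "sections B W = {s. (\<forall>p\<in>W. s p \<in> fibre B p) \<and> (\<forall>p. p \<notin> W \<longrightarrow> s p = 0) \<and>
     (\<forall>(U, t)\<in>frames B. \<forall>i. smooth_fun (base B) (U \<inter> W) (\<lambda>p. coframe t i p (s p)))}"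

definition bundle_morphism ::
  "('a, 'v::euclidean_space, 'w::real_vector, 'i::finite) vbundle \<Rightarrow>
   ('b, 'u::euclidean_space, 'z::real_vector, 'j::finite) vbundle \<Rightarrow>
   ('a \<Rightarrow> 'b) \<Rightarrow> ('a \<Rightarrow> 'w \<Rightarrow> 'z) \<Rightarrow> bool" where
  "bundle_morphism B B' f \<Phi> \<longleftrightarrow>
     (\<forall>p\<in>pts (base B). linear_over (fibre B p) (\<Phi> p) \<and>
        (\<forall>v\<in>fibre B p. \<Phi> p v \<in> fibre B' (f p))) \<and>
     (\<forall>(U, t)\<in>frames B. \<forall>(V, s)\<in>frames B'. \<forall>i j.
        smooth_fun (base B) (U \<inter> f -` V) (\<lambda>p. coframe s j (f p) (\<Phi> p (t i p))))"

definition tangent_bundle ::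
  "('a, real^'d) mfd \<Rightarrow> ('a, real^'d, ('a, real^'d) tangent, 'd) vbundle" where
  "tangent_bundle X = \<lparr> base = X, fibre = tangent_space X,
     frames = (\<lambda>c. (fst c, \<lambda>i p. tvec X c p (axis i 1))) ` atlas X \<rparr>"

definition pullback_bundle ::
  "('a, 'v) mfd \<Rightarrow> ('a \<Rightarrow> 'b) \<Rightarrow> ('b, 'u, 'w, 'i) vbundle \<Rightarrow> ('a, 'v, 'w, 'i) vbundle" where
  "pullback_bundle X h B = \<lparr> base = X, fibre = (\<lambda>x. fibre B (h x)),
     frames = (\<lambda>(U, t). (pts X \<inter> h -` U, \<lambda>i x. t i (h x))) ` frames B \<rparr>"

text \<open>The total space of a bundle, with the vector bundle coordinates \<open>(x\<^sup>i, y\<^sup>a)\<close> given by a chart of the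
  base and a local frame.\<close>

definition vb_chart ::
  "('a, real^'d, 'e::real_vector, 'r::finite) vbundle \<Rightarrow> ('a, real^'d) chart \<Rightarrow>
   'a set \<times> ('r \<Rightarrow> 'a \<Rightarrow> 'e) \<Rightarrow> ('a \<times> 'e, (real^'d) \<times> (real^'r)) chart" where
  "vb_chart E c s = ({(x, v). x \<in> fst c \<inter> fst s \<and> v \<in> fibre E x},
     \<lambda>(x, v). (snd c x, \<chi> a. coframe (snd s) a x v))"

definition total_space ::
  "('a, real^'d, 'e::real_vector, 'r::finite) vbundle \<Rightarrow> ('a \<times> 'e, (real^'d) \<times> (real^'r)) mfd" where
  "total_space E = \<lparr> pts = Sigma (pts (base E)) (fibre E),
     atlas = (\<lambda>(c, s). vb_chart E c s) ` (atlas (base E) \<times> frames E) \<rparr>"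


section \<open>Tensor fields and covariant derivatives\<close>

definition dual_space :: "'w::real_vector set \<Rightarrow> ('w \<Rightarrow> real) set" where
  "dual_space V = {\<omega>. linear_over V \<omega> \<and> (\<forall>v. v \<notin> V \<longrightarrow> \<omega> v = 0)}"

text \<open>Tensors of type \<open>(k, l)\<close> on \<open>V\<close>: multilinear functions of \<open>k\<close> covectors and \<open>l\<close> vectors, extended by
  \<open>0\<close> to all other pairs of lists.\<close>

type_synonym 'w tensor = "('w \<Rightarrow> real) list \<Rightarrow> 'w list \<Rightarrow> real"

definition tensor_args ::
  "'w::real_vector set \<Rightarrow> nat \<Rightarrow> nat \<Rightarrow> (('w \<Rightarrow> real) list \<times> 'w list) set" where
  "tensor_args V k l = {(\<omega>s, vs). length \<omega>s = k \<and> set \<omega>s \<subseteq> dual_space V \<and>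
     length vs = l \<and> set vs \<subseteq> V}"

definition tensors :: "'w::real_vector set \<Rightarrow> nat \<Rightarrow> nat \<Rightarrow> 'w tensor set" where
  "tensors V k l = {T.
     (\<forall>\<omega>s vs. (\<omega>s, vs) \<notin> tensor_args V k l \<longrightarrow> T \<omega>s vs = 0) \<and>
     (\<forall>(\<omega>s, vs)\<in>tensor_args V k l.
        (\<forall>i<k. linear_over (dual_space V) (\<lambda>\<omega>. T (\<omega>s[i := \<omega>]) vs)) \<and>
        (\<forall>j<l. linear_over V (\<lambda>v. T \<omega>s (vs[j := v]))))}"

definition tensor_fields ::
  "('a, 'v::euclidean_space, 'w::real_vector, 'i::finite) vbundle \<Rightarrow> 'a set \<Rightarrow> nat \<Rightarrow> nat
    \<Rightarrow> ('a \<Rightarrow> 'w tensor) set" where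
  "tensor_fields B W k l = {T.
     (\<forall>p\<in>W. T p \<in> tensors (fibre B p) k l) \<and> (\<forall>p. p \<notin> W \<longrightarrow> T p = 0) \<and>
     (\<forall>(U, t)\<in>frames B. \<forall>I J. length I = k \<and> length J = l \<longrightarrow>
        smooth_fun (base B) (U \<inter> W)
          (\<lambda>p. T p (map (\<lambda>i. coframe t i p) I) (map (\<lambda>j. t j p) J)))}"

text \<open>Functions as tensor fields of type \<open>(0, 0)\<close> and sections as tensor fields of type \<open>(1, 0)\<close>.\<close>

definition fun_tensor :: "'a set \<Rightarrow> ('a \<Rightarrow> real) \<Rightarrow> 'a \<Rightarrow> 'w tensor" where
  "fun_tensor W f = (\<lambda>p \<omega>s vs. if p \<in> W \<and> \<omega>s = [] \<and> vs = [] then f p else 0)"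

definition vec_tensor ::
  "('a, 'v, 'w::real_vector, 'i) vbundle \<Rightarrow> ('a \<Rightarrow> 'w) \<Rightarrow> 'a \<Rightarrow> 'w tensor" where
  "vec_tensor B Y = (\<lambda>p \<omega>s vs.
     if (\<omega>s, vs) \<in> tensor_args (fibre B p) 1 0 then hd \<omega>s (Y p) else 0)"

text \<open>The tensor product of fields of which the first has type \<open>(k, l)\<close>.\<close>

definition tensor_prod ::
  "nat \<Rightarrow> nat \<Rightarrow> ('a \<Rightarrow> 'w tensor) \<Rightarrow> ('a \<Rightarrow> 'w tensor) \<Rightarrow> 'a \<Rightarrow> 'w tensor" where
  "tensor_prod k l S T = (\<lambda>p \<omega>s vs.
     S p (take k \<omega>s) (take l vs) * T p (drop k \<omega>s) (drop l vs))"

text \<open>Contraction of the \<open>i\<close>-th covector slot with the \<open>j\<close>-th vector slot (counted from \<open>0\<close>); the choice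
  of a basis of the fibre is immaterial.\<close>

definition contraction ::
  "('a, 'v, 'w::real_vector, 'i) vbundle \<Rightarrow> nat \<Rightarrow> nat \<Rightarrow> ('a \<Rightarrow> 'w tensor) \<Rightarrow> 'a \<Rightarrow> 'w tensor" where
  "contraction B i j T = (\<lambda>p \<omega>s vs.
     let S = (SOME S. independent S \<and> span S = fibre B p)
     in \<Sum>b\<in>S. T p (take i \<omega>s @ (\<lambda>v. representation S v b) # drop i \<omega>s)
                    (take j vs @ b # drop j vs))"

text \<open>\<open>D W X k l T\<close> is the derivative along the section \<open>X\<close> over the open set \<open>W\<close> of the tensor field
  \<open>T\<close> of type \<open>(k, l)\<close> over \<open>W\<close>. A covariant derivative is local, so it acts on sections over open
  sets compatibly with restriction; its components are its values on local frames. \<open>anch\<close> is the anchor.\<close>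

type_synonym ('a, 'w) cov_deriv =
  "'a set \<Rightarrow> ('a \<Rightarrow> 'w) \<Rightarrow> nat \<Rightarrow> nat \<Rightarrow> ('a \<Rightarrow> 'w tensor) \<Rightarrow> 'a \<Rightarrow> 'w tensor"

definition covariant_derivative ::
  "('a, 'v::euclidean_space, 'w::real_vector, 'i::finite) vbundle \<Rightarrow> ('w \<Rightarrow> ('a, 'v) tangent)
    \<Rightarrow> ('a, 'w) cov_deriv \<Rightarrow> bool" where
  "covariant_derivative B anch D \<longleftrightarrow>
     (\<forall>W X k l T. mopen (base B) W \<and> X \<in> sections B W \<and> T \<in> tensor_fields B W k l \<longrightarrow>
        D W X k l T \<in> tensor_fields B W k l \<and>
        (\<forall>W'. mopen (base B) W' \<and> W' \<subseteq> W \<longrightarrow>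
           D W' (restrict0 W' X) k l (restrict0 W' T) = restrict0 W' (D W X k l T)) \<and>
        (\<forall>T' c. T' \<in> tensor_fields B W k l \<longrightarrow>
           D W X k l (c *\<^sub>R T + T') = c *\<^sub>R D W X k l T + D W X k l T') \<and>
        (\<forall>X' f. X' \<in> sections B W \<and> smooth_fun (base B) W f \<longrightarrow>
           D W (\<lambda>p. f p *\<^sub>R X p + X' p) k l T = (\<lambda>p. f p *\<^sub>R D W X k l T p + D W X' k l T p)) \<and>
        (\<forall>k' l' S. S \<in> tensor_fields B W k' l' \<longrightarrow>
           D W X (k + k') (l + l') (tensor_prod k l T S) =
             tensor_prod k l (D W X k l T) S + tensor_prod k l T (D W X k' l' S)) \<and>
        (\<forall>i j. i < k \<and> j < l \<longrightarrow>
           D W X (k - 1) (l - 1) (contraction B i j T) = contraction B i j (D W X k l T))) \<and>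
     (\<forall>W X f. mopen (base B) W \<and> X \<in> sections B W \<and> smooth_fun (base B) W f \<longrightarrow>
        D W X 0 0 (fun_tensor W f) = fun_tensor W (\<lambda>p. tderiv (base B) p (anch (X p)) f))"

definition preserves_subbundle ::
  "('a, 'v::euclidean_space, 'w::real_vector, 'i::finite) vbundle \<Rightarrow> ('a \<Rightarrow> 'w set)
    \<Rightarrow> ('a, 'w) cov_deriv \<Rightarrow> bool" where
  "preserves_subbundle B S D \<longleftrightarrow>
     (\<forall>W X Y. mopen (base B) W \<and> X \<in> sections B W \<and> Y \<in> sections B W \<and> (\<forall>p\<in>W. Y p \<in> S p) \<longrightarrow>
        (\<exists>Z\<in>sections B W. (\<forall>p\<in>W. Z p \<in> S p) \<and> D W X 1 0 (vec_tensor B Y) = vec_tensor B Z))"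


section \<open>Generalized Lie algebroids\<close>

text \<open>\<open>anc\<close> is the morphism \<open>\<rho> : F \<rightarrow> TM\<close> over \<open>\<eta>\<close>, and \<open>hanc\<close> is the bundle map \<open>h\<^sup>*F \<rightarrow> TM\<close> over the
  identity whose components are the functions \<open>\<rho>\<^sup>i\<^sub>\<alpha> \<circ> h\<close>.\<close>

record ('m, 'n, 'f, 'd, 'p) gla =
  src :: "('m, real^'d) mfd"
  hmap :: "'m \<Rightarrow> 'n"
  emap :: "'n \<Rightarrow> 'm"
  bun :: "('n, real^'d, 'f, 'p) vbundle"
  anc :: "'n \<Rightarrow> 'f \<Rightarrow> ('m, real^'d) tangent"
  brk :: "('n \<Rightarrow> 'f) \<Rightarrow> ('n \<Rightarrow> 'f) \<Rightarrow> 'n \<Rightarrow> 'f"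
  hanc :: "'m \<Rightarrow> 'f \<Rightarrow> ('m, real^'d) tangent"

definition lie_bracket_on :: "'s::real_vector set \<Rightarrow> ('s \<Rightarrow> 's \<Rightarrow> 's) \<Rightarrow> bool" where
  "lie_bracket_on \<Gamma> b \<longleftrightarrow>
     (\<forall>u\<in>\<Gamma>. b u u = 0 \<and> linear_over \<Gamma> (b u) \<and> linear_over \<Gamma> (\<lambda>v. b v u)) \<and>
     (\<forall>u\<in>\<Gamma>. \<forall>v\<in>\<Gamma>. b u v \<in> \<Gamma>) \<and>
     (\<forall>u\<in>\<Gamma>. \<forall>v\<in>\<Gamma>. \<forall>w\<in>\<Gamma>. b u (b v w) + b v (b w u) + b w (b u v) = 0)"

text \<open>The map \<open>\<Gamma>(Th \<circ> \<rho>, h \<circ> \<eta>)\<close> from sections of \<open>F\<close> to vector fields on \<open>N\<close>: its value at \<open>h (\<eta> k)\<close>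
  is \<open>Th (\<rho> (u k))\<close>.\<close>

definition anchor_field ::
  "('m, 'n, 'f, 'd::finite, 'p) gla \<Rightarrow> ('n \<Rightarrow> 'f) \<Rightarrow> 'n \<Rightarrow> ('n, real^'d) tangent" where
  "anchor_field L u \<kappa> =
     (let k = inv_into (pts (base (bun L))) (hmap L \<circ> emap L) \<kappa>
      in tangent_map (src L) (base (bun L)) (hmap L) (emap L k) (anc L k (u k)))"

text \<open>The bracket of vector fields is the commutator of derivations. The last two clauses say that
  \<open>hanc\<close> is a smooth bundle map and that it describes the anchor map, i.e.
  \<open>(\<A>(z\<^sup>\<alpha>t\<^sub>\<alpha>)f) \<circ> h = (\<rho>\<^sup>i\<^sub>\<alpha> \<circ> h)(z\<^sup>\<alpha> \<circ> h) \<partial>(f \<circ> h)/\<partial>x\<^sup>i\<close>.\<close>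

definition generalized_lie_algebroid ::
  "('m, 'n, 'f::real_vector, 'd::finite, 'p::finite) gla \<Rightarrow> bool" where
  "generalized_lie_algebroid L \<longleftrightarrow>
     (let M = src L; F = bun L; N = base F; h = hmap L; \<eta> = emap L; b = brk L;
          \<Gamma> = sections F (pts N); \<A> = anchor_field L
      in smooth_manifold M \<and> vector_bundle F \<and>
         diffeomorphism M N h \<and> diffeomorphism N M \<eta> \<and>
         bundle_morphism F (tangent_bundle M) \<eta> (anc L) \<and>
         lie_bracket_on \<Gamma> b \<and>
         (\<forall>u\<in>\<Gamma>. \<forall>v\<in>\<Gamma>. \<forall>f. smooth_fun N (pts N) f \<longrightarrow>
            b u (\<lambda>\<kappa>. f \<kappa> *\<^sub>R v \<kappa>) = (\<lambda>\<kappa>. f \<kappa> *\<^sub>R b u v \<kappa> + tderiv N \<kappa> (\<A> u \<kappa>) f *\<^sub>R v \<kappa>)) \<and>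
         (\<forall>u\<in>\<Gamma>. \<forall>v\<in>\<Gamma>. \<forall>f. smooth_fun N (pts N) f \<longrightarrow> (\<forall>\<kappa>\<in>pts N.
            tderiv N \<kappa> (\<A> (b u v) \<kappa>) f =
              tderiv N \<kappa> (\<A> u \<kappa>) (\<lambda>k. tderiv N k (\<A> v k) f) -
              tderiv N \<kappa> (\<A> v \<kappa>) (\<lambda>k. tderiv N k (\<A> u k) f))) \<and>
         bundle_morphism (pullback_bundle M h F) (tangent_bundle M) id (hanc L) \<and>
         (\<forall>u\<in>\<Gamma>. \<forall>f. smooth_fun N (pts N) f \<longrightarrow> (\<forall>x\<in>pts M.
            tderiv N (h x) (\<A> u (h x)) f = tderiv M x (hanc L x (u (h x))) (f \<circ> h))))"


section \<open>The generalized tangent bundle\<close>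

text \<open>Local data around a point of the total space: a chart of \<open>M\<close>, a local frame of \<open>E\<close> and a local
  frame of \<open>F\<close>, the last one being pulled back along \<open>h\<close>.\<close>

type_synonym ('m, 'n, 'e, 'f, 'd, 'r, 'p) loc =
  "('m, real^'d) chart \<times> ('m set \<times> ('r \<Rightarrow> 'm \<Rightarrow> 'e)) \<times> ('n set \<times> ('p \<Rightarrow> 'n \<Rightarrow> 'f))"

type_synonym ('m, 'e, 'f, 'd, 'r) gvec =
  "'f \<times> ('m \<times> 'e, (real^'d) \<times> (real^'r)) tangent"

definition locs ::
  "('m, 'n, 'f, 'd, 'p) gla \<Rightarrow> ('m, real^'d, 'e, 'r) vbundle \<Rightarrow>
   ('m, 'n, 'e, 'f, 'd::finite, 'r, 'p) loc set" where
  "locs L E = atlas (src L) \<times> frames E \<times> frames (bun L)"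

definition loc_dom ::
  "('m, 'n, 'f, 'd, 'p) gla \<Rightarrow> ('m, real^'d, 'e, 'r) vbundle \<Rightarrow>
   ('m, 'n, 'e, 'f, 'd::finite, 'r, 'p) loc \<Rightarrow> ('m \<times> 'e) set" where
  "loc_dom L E = (\<lambda>(c, s, t).
     {(x, v). x \<in> fst c \<inter> fst s \<and> hmap L x \<in> fst t \<and> v \<in> fibre E x})"

text \<open>The natural base: \<open>Inl \<alpha>\<close> stands for the direction \<open>\<alpha>\<close> of \<open>F\<close> and \<open>Inr a\<close> for the direction \<open>a\<close> of \<open>E\<close>.
  The coefficient \<open>\<rho>\<^sup>i\<^sub>\<alpha> (h x)\<close> is the \<open>i\<close>-th coordinate of \<open>hanc L x (t\<^sub>\<alpha> (h x))\<close> in the chart \<open>c\<close>.\<close>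

definition nat_frame ::
  "('m, 'n, 'f::real_vector, 'd, 'p) gla \<Rightarrow> ('m, real^'d, 'e::real_vector, 'r) vbundle \<Rightarrow>
   ('m, 'n, 'e, 'f, 'd::finite, 'r::finite, 'p) loc \<Rightarrow>
   'p + 'r \<Rightarrow> 'm \<times> 'e \<Rightarrow> ('m, 'e, 'f, 'd, 'r) gvec" where
  "nat_frame L E = (\<lambda>(c, s, t) k (x, v).
     let T = total_space E; cE = vb_chart E c s in
     case k of
       Inl \<alpha> \<Rightarrow> (snd t \<alpha> (hmap L x),
         \<Sum>i\<in>UNIV. (hanc L x (snd t \<alpha> (hmap L x)) c $ i) *\<^sub>R tvec T cE (x, v) (axis i 1, 0))
     | Inr a \<Rightarrow> (0, tvec T cE (x, v) (0, axis a 1)))"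

definition gtb ::
  "('m, 'n, 'f::real_vector, 'd, 'p) gla \<Rightarrow> ('m, real^'d, 'e::real_vector, 'r) vbundle \<Rightarrow>
   ('m \<times> 'e, (real^'d) \<times> (real^'r), ('m, 'e, 'f, 'd::finite, 'r::finite) gvec, 'p + 'r) vbundle" where
  "gtb L E = \<lparr> base = total_space E,
     fibre = (\<lambda>e. \<Union>b\<in>{b\<in>locs L E. e \<in> loc_dom L E b}. span (range (\<lambda>k. nat_frame L E b k e))),
     frames = (\<lambda>b. (loc_dom L E b, nat_frame L E b)) ` locs L E \<rparr>"

definition vertical_bundle ::
  "('m, 'n, 'f::real_vector, 'd, 'p) gla \<Rightarrow> ('m, real^'d, 'e::real_vector, 'r) vbundle \<Rightarrow>
   ('m \<times> 'e, (real^'d) \<times> (real^'r), ('m, 'e, 'f, 'd::finite, 'r::finite) gvec, 'r) vbundle" where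
  "vertical_bundle L E = \<lparr> base = total_space E,
     fibre = (\<lambda>e. \<Union>b\<in>{b\<in>locs L E. e \<in> loc_dom L E b}. span (range (\<lambda>a. nat_frame L E b (Inr a) e))),
     frames = (\<lambda>b. (loc_dom L E b, \<lambda>a. nat_frame L E b (Inr a))) ` locs L E \<rparr>"

text \<open>Writing an element as \<open>Z\<^sup>\<alpha>T\<^sub>\<alpha> \<oplus> w\<close>, the anchor \<open>Z\<^sup>\<alpha>(\<rho>\<^sup>i\<^sub>\<alpha> \<circ> h \<circ> \<pi>)\<partial>\<^sub>i + Y\<^sup>a\<partial>\<^sub>a\<close> is its component \<open>w\<close>.\<close>

definition ganchor ::
  "('m, 'e, 'f, 'd::finite, 'r::finite) gvec \<Rightarrow> ('m \<times> 'e, (real^'d) \<times> (real^'r)) tangent" where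
  "ganchor = snd"

definition rho_eta_connection ::
  "('m, 'n, 'f::real_vector, 'd, 'p::finite) gla \<Rightarrow> ('m, real^'d, 'e::real_vector, 'r) vbundle \<Rightarrow>
   ('m \<times> 'e \<Rightarrow> ('m, 'e, 'f, 'd::finite, 'r::finite) gvec \<Rightarrow> ('m, 'e, 'f, 'd, 'r) gvec) \<Rightarrow> bool" where
  "rho_eta_connection L E C \<longleftrightarrow>
     bundle_morphism (gtb L E) (vertical_bundle L E) id C \<and>
     (\<forall>e\<in>pts (total_space E). \<forall>w\<in>fibre (vertical_bundle L E) e. C e w = w)"

definition horizontal_space ::
  "('m, 'n, 'f::real_vector, 'd, 'p::finite) gla \<Rightarrow> ('m, real^'d, 'e::real_vector, 'r) vbundle \<Rightarrow>
   ('m \<times> 'e \<Rightarrow> ('m, 'e, 'f, 'd::finite, 'r::finite) gvec \<Rightarrow> ('m, 'e, 'f, 'd, 'r) gvec) \<Rightarrow>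
   'm \<times> 'e \<Rightarrow> ('m, 'e, 'f, 'd, 'r) gvec set" where
  "horizontal_space L E C e = {w \<in> fibre (gtb L E) e. C e w = 0}"

definition conn_coeff ::
  "('m, 'n, 'f::real_vector, 'd, 'p::finite) gla \<Rightarrow> ('m, real^'d, 'e::real_vector, 'r) vbundle \<Rightarrow>
   ('m \<times> 'e \<Rightarrow> ('m, 'e, 'f, 'd::finite, 'r::finite) gvec \<Rightarrow> ('m, 'e, 'f, 'd, 'r) gvec) \<Rightarrow>
   ('m, 'n, 'e, 'f, 'd, 'r, 'p) loc \<Rightarrow> 'r \<Rightarrow> 'p \<Rightarrow> 'm \<times> 'e \<Rightarrow> real" where
  "conn_coeff L E C b a \<gamma> e =
     coframe (\<lambda>a. nat_frame L E b (Inr a)) a e (C e (nat_frame L E b (Inl \<gamma>) e))"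

text \<open>The adapted base, consisting of \<open>\<delta>\<^sub>\<alpha> = \<partial>\<^sub>\<alpha> - \<Gamma>\<^sup>a\<^sub>\<alpha> \<partial>\<^sub>a\<close> (at \<open>Inl \<alpha>\<close>) and the vertical \<open>\<partial>\<^sub>a\<close> (at
  \<open>Inr a\<close>).\<close>

definition adapted_frame ::
  "('m, 'n, 'f::real_vector, 'd, 'p::finite) gla \<Rightarrow> ('m, real^'d, 'e::real_vector, 'r) vbundle \<Rightarrow>
   ('m \<times> 'e \<Rightarrow> ('m, 'e, 'f, 'd::finite, 'r::finite) gvec \<Rightarrow> ('m, 'e, 'f, 'd, 'r) gvec) \<Rightarrow>
   ('m, 'n, 'e, 'f, 'd, 'r, 'p) loc \<Rightarrow> 'p + 'r \<Rightarrow> 'm \<times> 'e \<Rightarrow> ('m, 'e, 'f, 'd, 'r) gvec" where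
  "adapted_frame L E C b k e = (case k of
       Inl \<alpha> \<Rightarrow> nat_frame L E b (Inl \<alpha>) e
         - (\<Sum>a\<in>UNIV. conn_coeff L E C b a \<alpha> e *\<^sub>R nat_frame L E b (Inr a) e)
     | Inr a \<Rightarrow> nat_frame L E b (Inr a) e)"


section \<open>Distinguished connections and metrical structures\<close>

definition distinguished_connection ::
  "('m, 'n, 'f::real_vector, 'd, 'p::finite) gla \<Rightarrow> ('m, real^'d, 'e::real_vector, 'r) vbundle \<Rightarrow>
   ('m \<times> 'e \<Rightarrow> ('m, 'e, 'f, 'd::finite, 'r::finite) gvec \<Rightarrow> ('m, 'e, 'f, 'd, 'r) gvec) \<Rightarrow>
   ('m \<times> 'e, ('m, 'e, 'f, 'd, 'r) gvec) cov_deriv \<Rightarrow> bool" where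
  "distinguished_connection L E C D \<longleftrightarrow>
     covariant_derivative (gtb L E) ganchor D \<and>
     preserves_subbundle (gtb L E) (horizontal_space L E C) D \<and>
     preserves_subbundle (gtb L E) (fibre (vertical_bundle L E)) D"

text \<open>The functions \<open>H\<^sup>\<alpha>\<^sub>\<beta>\<^sub>\<gamma>\<close>, \<open>H\<^sup>a\<^sub>b\<^sub>\<gamma>\<close>, \<open>V\<^sup>\<alpha>\<^sub>\<beta>\<^sub>c\<close>, \<open>V\<^sup>a\<^sub>b\<^sub>c\<close> are the components of \<open>D\<close> in the adapted base of
  \<open>b\<close>. The indices are passed in the order upper, lower, direction of differentiation; values
  outside the domain of \<open>b\<close> are irrelevant.\<close>

definition connection_components ::
  "('m, 'n, 'f::real_vector, 'd, 'p::finite) gla \<Rightarrow> ('m, real^'d, 'e::real_vector, 'r) vbundle \<Rightarrow>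
   ('m \<times> 'e \<Rightarrow> ('m, 'e, 'f, 'd::finite, 'r::finite) gvec \<Rightarrow> ('m, 'e, 'f, 'd, 'r) gvec) \<Rightarrow>
   ('m \<times> 'e, ('m, 'e, 'f, 'd, 'r) gvec) cov_deriv \<Rightarrow>
   ('m, 'n, 'e, 'f, 'd, 'r, 'p) loc \<Rightarrow>
   ('p \<Rightarrow> 'p \<Rightarrow> 'p \<Rightarrow> 'm \<times> 'e \<Rightarrow> real) \<Rightarrow> ('r \<Rightarrow> 'r \<Rightarrow> 'p \<Rightarrow> 'm \<times> 'e \<Rightarrow> real) \<Rightarrow>
   ('p \<Rightarrow> 'p \<Rightarrow> 'r \<Rightarrow> 'm \<times> 'e \<Rightarrow> real) \<Rightarrow> ('r \<Rightarrow> 'r \<Rightarrow> 'r \<Rightarrow> 'm \<times> 'e \<Rightarrow> real) \<Rightarrow> bool" where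
  "connection_components L E C D b Hh Hv Vh Vv \<longleftrightarrow>
     (let U = loc_dom L E b; vt = (\<lambda>Y. vec_tensor (gtb L E) (restrict0 U Y));
          \<delta> = (\<lambda>\<alpha>. adapted_frame L E C b (Inl \<alpha>)); vd = (\<lambda>a. adapted_frame L E C b (Inr a));
          DD = (\<lambda>X Y. D U (restrict0 U X) 1 0 (vt Y))
      in (\<forall>\<beta> \<gamma>. DD (\<delta> \<gamma>) (\<delta> \<beta>) = vt (\<lambda>e. \<Sum>\<alpha>\<in>UNIV. Hh \<alpha> \<beta> \<gamma> e *\<^sub>R \<delta> \<alpha> e)) \<and>
         (\<forall>a' \<gamma>. DD (\<delta> \<gamma>) (vd a') = vt (\<lambda>e. \<Sum>a\<in>UNIV. Hv a a' \<gamma> e *\<^sub>R vd a e)) \<and>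
         (\<forall>\<beta> c. DD (vd c) (\<delta> \<beta>) = vt (\<lambda>e. \<Sum>\<alpha>\<in>UNIV. Vh \<alpha> \<beta> c e *\<^sub>R \<delta> \<alpha> e)) \<and>
         (\<forall>a' c. DD (vd c) (vd a') = vt (\<lambda>e. \<Sum>a\<in>UNIV. Vv a a' c e *\<^sub>R vd a e)))"

definition metric_h ::
  "('m, 'n, 'f::real_vector, 'd, 'p::finite) gla \<Rightarrow> ('m, real^'d, 'e::real_vector, 'r) vbundle \<Rightarrow>
   ('m \<times> 'e \<Rightarrow> ('m, 'e, 'f, 'd::finite, 'r::finite) gvec \<Rightarrow> ('m, 'e, 'f, 'd, 'r) gvec) \<Rightarrow>
   ('m \<times> 'e \<Rightarrow> ('m, 'e, 'f, 'd, 'r) gvec tensor) \<Rightarrow>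
   ('m, 'n, 'e, 'f, 'd, 'r, 'p) loc \<Rightarrow> 'p \<Rightarrow> 'p \<Rightarrow> 'm \<times> 'e \<Rightarrow> real" where
  "metric_h L E C G b \<alpha> \<beta> e =
     G e [] [adapted_frame L E C b (Inl \<alpha>) e, adapted_frame L E C b (Inl \<beta>) e]"

definition metric_v ::
  "('m, 'n, 'f::real_vector, 'd, 'p::finite) gla \<Rightarrow> ('m, real^'d, 'e::real_vector, 'r) vbundle \<Rightarrow>
   ('m \<times> 'e \<Rightarrow> ('m, 'e, 'f, 'd::finite, 'r::finite) gvec \<Rightarrow> ('m, 'e, 'f, 'd, 'r) gvec) \<Rightarrow>
   ('m \<times> 'e \<Rightarrow> ('m, 'e, 'f, 'd, 'r) gvec tensor) \<Rightarrow>
   ('m, 'n, 'e, 'f, 'd, 'r, 'p) loc \<Rightarrow> 'r \<Rightarrow> 'r \<Rightarrow> 'm \<times> 'e \<Rightarrow> real" where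
  "metric_v L E C G b a a' e =
     G e [] [adapted_frame L E C b (Inr a) e, adapted_frame L E C b (Inr a') e]"

definition metric_matrix :: "('i::finite \<Rightarrow> 'i \<Rightarrow> 'a \<Rightarrow> real) \<Rightarrow> 'a \<Rightarrow> real^'i^'i" where
  "metric_matrix g e = (\<chi> i j. g i j e)"

definition pseudometrical_structure ::
  "('m, 'n, 'f::real_vector, 'd, 'p::finite) gla \<Rightarrow> ('m, real^'d, 'e::real_vector, 'r) vbundle \<Rightarrow>
   ('m \<times> 'e \<Rightarrow> ('m, 'e, 'f, 'd::finite, 'r::finite) gvec \<Rightarrow> ('m, 'e, 'f, 'd, 'r) gvec) \<Rightarrow>
   ('m \<times> 'e \<Rightarrow> ('m, 'e, 'f, 'd, 'r) gvec tensor) \<Rightarrow> bool" where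
  "pseudometrical_structure L E C G \<longleftrightarrow>
     G \<in> tensor_fields (gtb L E) (pts (total_space E)) 0 2 \<and>
     (\<forall>b\<in>locs L E. \<forall>e\<in>loc_dom L E b.
        let gh = metric_h L E C G b; gv = metric_v L E C G b;
            dz = (\<lambda>\<alpha>. coframe (adapted_frame L E C b) (Inl \<alpha>) e);
            \<delta>y = (\<lambda>a. coframe (adapted_frame L E C b) (Inr a) e)
        in (\<forall>v\<in>fibre (gtb L E) e. \<forall>w\<in>fibre (gtb L E) e. G e [] [v, w] =
              (\<Sum>\<alpha>\<in>UNIV. \<Sum>\<beta>\<in>UNIV. gh \<alpha> \<beta> e * dz \<alpha> v * dz \<beta> w) +
              (\<Sum>a\<in>UNIV. \<Sum>a'\<in>UNIV. gv a a' e * \<delta>y a v * \<delta>y a' w)) \<and>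
           (\<forall>\<alpha> \<beta>. gh \<alpha> \<beta> e = gh \<beta> \<alpha> e) \<and> (\<forall>a a'. gv a a' e = gv a' a e) \<and>
           invertible (metric_matrix gh e) \<and> invertible (metric_matrix gv e))"

text \<open>The covariant derivative of the components of a metric along a vector \<open>w\<close> of the generalized
  tangent bundle at \<open>e\<close>, where \<open>K \<theta> \<epsilon>\<close> is the connection component with upper index \<open>\<theta>\<close>, lower index
  \<open>\<epsilon>\<close> and direction \<open>w\<close>, at \<open>e\<close>.\<close>

definition metric_deriv ::
  "('m, real^'d, 'e::real_vector, 'r) vbundle \<Rightarrow> ('m, 'e, 'f, 'd::finite, 'r::finite) gvec \<Rightarrow>
   ('i::finite \<Rightarrow> 'i \<Rightarrow> 'm \<times> 'e \<Rightarrow> real) \<Rightarrow> ('i \<Rightarrow> 'i \<Rightarrow> real) \<Rightarrow> 'i \<Rightarrow> 'i \<Rightarrow> 'm \<times> 'e \<Rightarrow> real" where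
  "metric_deriv E w g K \<epsilon> \<beta> e = tderiv (total_space E) e (ganchor w) (g \<epsilon> \<beta>)
     - (\<Sum>\<theta>\<in>UNIV. K \<theta> \<epsilon> * g \<theta> \<beta> e) - (\<Sum>\<theta>\<in>UNIV. K \<theta> \<beta> * g \<epsilon> \<theta> e)"

end

theory Submission
  imports Defs
begin

text \<open>Let \<open>D\<^sup>0\<close> be the given connection. Its failure to preserve \<open>G\<close> is the symmetric form
  \<open>D\<^sup>0\<^sub>X G\<close>; raising an index with \<open>G\<close> turns half of it into an endomorphism \<open>A\<^sub>X\<close> of the bundle,
  \<open>G (A\<^sub>X Y, Z) = 1/2 (D\<^sup>0\<^sub>X G) (Y, Z)\<close>. The connection sought is \<open>D\<^sub>X = D\<^sup>0\<^sub>X + A\<^sub>X\<close>, where \<open>A\<^sub>X\<close> acts on tensors as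
  a derivation that kills functions. Then
  \<open>(D\<^sub>X G) (Y, Z) = (D\<^sup>0\<^sub>X G) (Y, Z) - G (A\<^sub>X Y, Z) - G (Y, A\<^sub>X Z) = 0\<close> because \<open>D\<^sup>0\<^sub>X G\<close> is symmetric. Like \<open>G\<close>,
  the form \<open>D\<^sup>0\<^sub>X G\<close> has no mixed horizontal-vertical part, so \<open>A\<^sub>X\<close> preserves both subbundles, and
  in the adapted base the definition of \<open>A\<^sub>X\<close> reads \<open>A\<^sup>\<alpha>\<^sub>\<beta> = 1/2 g\<^sup>\<alpha>\<^sup>\<epsilon> g\<^sub>\<epsilon>\<^sub>\<beta>\<^sub>|\<^sub>\<gamma>\<close>, the asserted components.

  That \<open>D\<close> is again a covariant derivative (\<open>corrected_covariant\<close>) holds for every bundle with local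
  frames and every nondegenerate form. Tensoriality in \<open>X\<close>, the product rule and compatibility
  with contractions are pointwise statements about the action of an endomorphism on tensors
  (\<open>endo_act_combine_endo\<close>, \<open>endo_act_prod\<close>, \<open>endo_act_contraction\<close>); smoothness of \<open>A\<^sub>X\<close> follows from
  Cramer's rule (\<open>correction_smooth\<close>).

  The symmetry and the block form of \<open>D\<^sup>0\<^sub>X G\<close> and its coordinate expression all come from
  \<open>X (G (Y, Z)) = (D\<^sup>0\<^sub>X G) (Y, Z) + G (D\<^sup>0\<^sub>X Y, Z) + G (Y, D\<^sup>0\<^sub>X Z)\<close> (\<open>D_bilinear_form\<close>), which the axioms
  yield because evaluating a form on a section is a contraction of a tensor product. This is
  applied to the adapted frames, and for that they must be smooth sections of the generalized
  tangent bundle, in the natural frame of every other local datum (\<open>af_section\<close>). Two observations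
  replace a computation with second derivatives of chart transitions. All natural
  frames at a point span the same space, because \<open>G\<close> is nondegenerate on each span while its
  coordinate formula in one frame annihilates vectors outside the span of that frame (\<open>fibre_span\<close>).
  And the transition coefficients are smooth: those in the direction of \<open>F\<close> are pulled back from \<open>F\<close>,
  while the vertical ones are read off from the connection \<open>C\<close>, which is a smooth bundle morphism
  and the identity on vertical vectors (\<open>nf_transition_smooth\<close>).\<close>

section \<open>Calculus of finitely differentiable functions\<close>

lemma frechet_derivative_apply:
  "(f has_derivative D) (at x) \<Longrightarrow> frechet_derivative f (at x) v = D v"
  by (metis frechet_derivative_at)

lemma Ck_on_subset: "Ck_on k f S \<Longrightarrow> S' \<subseteq> S \<Longrightarrow> Ck_on k f S'"
  by (induction k arbitrary: f) (auto intro: continuous_on_subset)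

text \<open>Both the derivative and its existence at a point of an open set depend only on the function on
  that set.\<close>

lemma Ck_on_cong_imp:
  assumes "open S" "\<And>x. x \<in> S \<Longrightarrow> f x = g x" "Ck_on k f S"
  shows "Ck_on k g S"
  using assms(2,3)
proof (induction k arbitrary: f g)
  case 0
  then show ?case by (simp cong: continuous_on_cong)
next
  case (Suc k)
  have g: "(g has_derivative frechet_derivative f (at x)) (at x)" if "x \<in> S" for x
  proof -
    have "(f has_derivative frechet_derivative f (at x)) (at x)"
      using Suc.prems(2) that by (simp add: frechet_derivative_works)
    then show ?thesis
      by (rule has_derivative_transform_within_open[OF _ \<open>open S\<close> that]) (use Suc.prems in auto)
  qed
  have "Ck_on k (\<lambda>x. frechet_derivative g (at x) v) S" for v
    by (rule Suc.IH[of "\<lambda>x. frechet_derivative f (at x) v"])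
       (use Suc.prems(2) frechet_derivative_apply[OF g] in auto)
  moreover have "g differentiable (at x)" if "x \<in> S" for x
    using g[OF that] by (rule differentiableI)
  ultimately show ?case by simp
qed

text \<open>The introduction rule for the inductive steps below: on an open set the Frechet derivative may be
  replaced by any explicit formula for it.\<close>

lemma Ck_on_SucI:
  assumes "open S" "\<And>x. x \<in> S \<Longrightarrow> (f has_derivative D x) (at x)"
    and "\<And>v. Ck_on k (\<lambda>x. D x v) S"
  shows "Ck_on (Suc k) f S"
proof -
  have "Ck_on k (\<lambda>x. frechet_derivative f (at x) v) S" for v
    by (rule Ck_on_cong_imp[OF assms(1) _ assms(3)[of v]])
       (use frechet_derivative_apply[OF assms(2)] in auto)
  then show ?thesis using assms(2) by (auto intro: differentiableI)
qed

lemma Ck_on_Suc_has_derivative: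
  "Ck_on (Suc k) f S \<Longrightarrow> x \<in> S \<Longrightarrow> (f has_derivative frechet_derivative f (at x)) (at x)"
  by (simp add: frechet_derivative_works)

lemma Ck_on_SucD: "Ck_on (Suc k) f S \<Longrightarrow> Ck_on k f S"
proof (induction k arbitrary: f)
  case 0
  then show ?case
    by (auto intro!: continuous_at_imp_continuous_on differentiable_imp_continuous_within)
next
  case (Suc k)
  then show ?case by simp
qed

lemma Ck_on_const: "open S \<Longrightarrow> Ck_on k (\<lambda>x. c) S"
proof (induction k arbitrary: c)
  case (Suc k)
  show ?case by (rule Ck_on_SucI[where D = "\<lambda>x v. 0"]) (use Suc in auto)
qed simp

lemma Ck_on_linear:
  assumes "bounded_linear f" "open S" shows "Ck_on k f S"
proof (cases k)
  case 0
  then show ?thesis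
    using assms by (simp add: linear_continuous_on)
next
  case (Suc k')
  then show ?thesis
    using Ck_on_SucI[where D = "\<lambda>x. f", OF assms(2) bounded_linear_imp_has_derivative[OF assms(1)]
        Ck_on_const[OF assms(2)]] by blast
qed

lemma Ck_on_add:
  assumes "open S" "Ck_on k f S" "Ck_on k g S"
  shows "Ck_on k (\<lambda>x. f x + g x) S"
  using assms(2,3)
proof (induction k arbitrary: f g)
  case 0
  then show ?case by (auto intro: continuous_on_add)
next
  case (Suc k)
  show ?case
    by (rule Ck_on_SucI[OF assms(1)],
        rule has_derivative_add[OF Ck_on_Suc_has_derivative[OF Suc.prems(1)]
          Ck_on_Suc_has_derivative[OF Suc.prems(2)]])
       (use Suc in auto)
qed

lemma Ck_on_mult:
  fixes f g :: "'v::euclidean_space \<Rightarrow> real"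
  assumes "open S" "Ck_on k f S" "Ck_on k g S"
  shows "Ck_on k (\<lambda>x. f x * g x) S"
  using assms(2,3)
proof (induction k arbitrary: f g)
  case 0
  then show ?case by (auto intro: continuous_on_mult)
next
  case (Suc k)
  show ?case
  proof (rule Ck_on_SucI[OF assms(1)])
    show "((\<lambda>x. f x * g x) has_derivative
        (\<lambda>v. f x * frechet_derivative g (at x) v + frechet_derivative f (at x) v * g x)) (at x)"
      if "x \<in> S" for x
      by (rule has_derivative_mult[OF Ck_on_Suc_has_derivative[OF Suc.prems(1) that]
          Ck_on_Suc_has_derivative[OF Suc.prems(2) that]])
    show "Ck_on k (\<lambda>x. f x * frechet_derivative g (at x) v + frechet_derivative f (at x) v * g x) S" for v
      using Suc.prems Ck_on_SucD[OF Suc.prems(1)] Ck_on_SucD[OF Suc.prems(2)]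
      by (auto intro!: Ck_on_add[OF assms(1)] Suc.IH)
  qed
qed

lemma Ck_on_inverse:
  fixes f :: "'v::euclidean_space \<Rightarrow> real"
  assumes "open S" "Ck_on k f S" "\<And>x. x \<in> S \<Longrightarrow> f x \<noteq> 0"
  shows "Ck_on k (\<lambda>x. inverse (f x)) S"
  using assms(2)
proof (induction k)
  case 0
  then show ?case using assms(3) by (auto intro: continuous_on_inverse)
next
  case (Suc k)
  note inv = Suc.IH[OF Ck_on_SucD[OF Suc.prems]]
  show ?case
  proof (rule Ck_on_SucI[OF assms(1)])
    show "((\<lambda>x. inverse (f x)) has_derivative
        (\<lambda>v. (- 1) * (inverse (f x) * frechet_derivative f (at x) v * inverse (f x)))) (at x)"
      if "x \<in> S" for x
      using Deriv.has_derivative_inverse[OF assms(3)[OF that] Ck_on_Suc_has_derivative[OF Suc.prems that]]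
      by simp
    show "Ck_on k (\<lambda>x. (- 1) * (inverse (f x) * frechet_derivative f (at x) v * inverse (f x))) S" for v
      using Suc.prems inv
      by (intro Ck_on_mult[OF assms(1)] Ck_on_const[OF assms(1)]) auto
  qed
qed

lemma Ck_on_sum:
  assumes "open S" "\<And>i. i \<in> I \<Longrightarrow> Ck_on k (f i) S"
  shows "Ck_on k (\<lambda>x. \<Sum>i\<in>I. f i x) S"
  using assms(2)
  by (induction I rule: infinite_finite_induct) (auto intro: Ck_on_add Ck_on_const assms(1))

lemma Ck_on_inner_const:
  fixes g :: "'v::euclidean_space \<Rightarrow> 'u::euclidean_space"
  assumes "open S" "Ck_on k g S"
  shows "Ck_on k (\<lambda>x. g x \<bullet> b) S"
  using assms(2)
proof (induction k arbitrary: g)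
  case 0
  then show ?case by (auto intro: continuous_on_inner)
next
  case (Suc k)
  show ?case
    by (rule Ck_on_SucI[OF assms(1)],
        rule has_derivative_inner_left[OF Ck_on_Suc_has_derivative[OF Suc.prems]])
       (use Suc in auto)
qed

text \<open>The outer function is scalar and generalized in the induction: the directional derivatives of \<open>f\<close>
  are again scalar functions to be composed with \<open>g\<close>.\<close>

lemma Ck_on_compose:
  fixes f :: "'u::euclidean_space \<Rightarrow> real" and g :: "'v::euclidean_space \<Rightarrow> 'u"
  assumes "open S" "Ck_on k f S'" "Ck_on k g S" "g ` S \<subseteq> S'"
  shows "Ck_on k (\<lambda>x. f (g x)) S"
  using assms(2,3)
proof (induction k arbitrary: f)
  case 0
  then show ?case using continuous_on_compose2[OF _ _ assms(4)] by auto
next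
  case (Suc k)
  show ?case
  proof (rule Ck_on_SucI[OF assms(1)])
    fix x assume x: "x \<in> S"
    let ?f' = "frechet_derivative f (at (g x))" and ?g' = "frechet_derivative g (at x)"
    have f: "(f has_derivative ?f') (at (g x))"
      using Ck_on_Suc_has_derivative[OF Suc.prems(1)] x assms(4) by auto
    have g: "(g has_derivative ?g') (at x)"
      using Ck_on_Suc_has_derivative[OF Suc.prems(2) x] .
    \<comment> \<open>Coordinates turn the composition of linear maps into products of scalar functions.\<close>
    have "?f' (?g' v) = (\<Sum>b\<in>Basis. (?g' v \<bullet> b) * ?f' b)" for v
    proof -
      have "linear ?f'" using f by (rule has_derivative_linear)
      then have "?f' (\<Sum>b\<in>Basis. (?g' v \<bullet> b) *\<^sub>R b) = (\<Sum>b\<in>Basis. (?g' v \<bullet> b) * ?f' b)"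
        by (simp add: linear_sum linear_scale)
      then show ?thesis by (simp add: euclidean_representation)
    qed
    then show "((\<lambda>x. f (g x)) has_derivative (\<lambda>v. \<Sum>b\<in>Basis. (?g' v \<bullet> b) * ?f' b)) (at x)"
      using diff_chain_at[OF g f] by (simp add: o_def fun_eq_iff)
  next
    fix v
    show "Ck_on k (\<lambda>x. \<Sum>b\<in>Basis. (frechet_derivative g (at x) v \<bullet> b) *
        frechet_derivative f (at (g x)) b) S"
      using Suc.prems Ck_on_SucD[OF Suc.prems(2)]
      by (intro Ck_on_sum[OF assms(1)] Ck_on_mult[OF assms(1)] Ck_on_inner_const[OF assms(1)] Suc.IH) auto
  qed
qed

lemma Ck_on_local:
  assumes "\<And>x. x \<in> S \<Longrightarrow> \<exists>S'. x \<in> S' \<and> Ck_on k f S' \<and> open S'"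
  shows "Ck_on k f S"
  using assms
proof (induction k arbitrary: f)
  case 0
  then show ?case
    by (metis Ck_on.simps(1) continuous_at_imp_continuous_on continuous_on_eq_continuous_at)
next
  case (Suc k)
  then show ?case by simp (meson)
qed

section \<open>Smooth functions on open subsets of a manifold\<close>

text \<open>The property of an atlas behind the algebra of smooth functions; for a total space it is read off from
  the bundle charts.\<close>

definition inj_charts :: "('a, 'v) mfd \<Rightarrow> bool" where
  "inj_charts X \<longleftrightarrow> (\<forall>(U, \<phi>)\<in>atlas X. inj_on \<phi> U)"

lemma mopen_Int:
  assumes "inj_charts X" "mopen X W" "mopen X W'"
  shows "mopen X (W \<inter> W')"
  unfolding mopen_def
proof (intro conjI ballI, goal_cases)
  case 1
  then show ?case using assms by (auto simp: mopen_def)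
next
  case (2 c)
  obtain U \<phi> where c: "c = (U, \<phi>)" by force
  have "\<phi> ` (U \<inter> (W \<inter> W')) = \<phi> ` (U \<inter> W) \<inter> \<phi> ` (U \<inter> W')"
    using 2 assms(1) c by (fastforce simp: inj_charts_def inj_on_def)
  then show ?case using 2 assms(2,3) c by (auto simp: mopen_def)
qed

text \<open>Injectivity of the charts makes a function in coordinates depend only on its values on \<open>W\<close>.\<close>

lemma smooth_fun_cong_imp:
  assumes "mopen X W" "\<And>p. p \<in> W \<Longrightarrow> f p = g p" "inj_charts X" "smooth_fun X W f"
  shows "smooth_fun X W g"
  unfolding smooth_fun_def smooth_on_def
proof (intro ballI, clarify)
  fix U \<phi> k assume c: "(U, \<phi>) \<in> atlas X"
  show "Ck_on k (g \<circ> inv_into U \<phi>) (\<phi> ` (U \<inter> W))"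
  proof (rule Ck_on_cong_imp)
    show "open (\<phi> ` (U \<inter> W))" using assms(1) c by (auto simp: mopen_def)
    show "Ck_on k (f \<circ> inv_into U \<phi>) (\<phi> ` (U \<inter> W))"
      using assms(4) c by (auto simp: smooth_fun_def smooth_on_def)
    show "(f \<circ> inv_into U \<phi>) x = (g \<circ> inv_into U \<phi>) x" if "x \<in> \<phi> ` (U \<inter> W)" for x
      using that assms(2,3) c by (auto simp: inj_charts_def inv_into_f_f)
  qed
qed

lemma smooth_fun_subset: "smooth_fun X W f \<Longrightarrow> W' \<subseteq> W \<Longrightarrow> smooth_fun X W' f"
  unfolding smooth_fun_def smooth_on_def
  by (clarsimp, rule Ck_on_subset, force, blast)

lemma smooth_fun_local:
  assumes "inj_charts X" "\<And>p. p \<in> W \<Longrightarrow> \<exists>W'. p \<in> W' \<and> mopen X W' \<and> smooth_fun X W' f"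
  shows "smooth_fun X W f"
  unfolding smooth_fun_def smooth_on_def
proof (intro ballI, clarify)
  fix C \<phi> n assume c: "(C, \<phi>) \<in> atlas X"
  show "Ck_on n (f \<circ> inv_into C \<phi>) (\<phi> ` (C \<inter> W))"
  proof (rule Ck_on_local)
    fix x assume "x \<in> \<phi> ` (C \<inter> W)"
    then obtain q where q: "q \<in> C" "q \<in> W" "x = \<phi> q" by auto
    obtain W' where W': "q \<in> W'" "mopen X W'" "smooth_fun X W' f" using assms(2)[OF q(2)] by blast
    then show "\<exists>S'. x \<in> S' \<and> Ck_on n (f \<circ> inv_into C \<phi>) S' \<and> open S'"
      using q c
      by (intro exI[of _ "\<phi> ` (C \<inter> W')"]) (auto simp: smooth_fun_def smooth_on_def mopen_def)
  qed
qed

lemma smooth_fun_const: "mopen X W \<Longrightarrow> smooth_fun X W (\<lambda>p. c)"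
  unfolding smooth_fun_def smooth_on_def mopen_def
  by (auto simp: o_def intro: Ck_on_const)

lemma smooth_fun_add:
  "mopen X W \<Longrightarrow> smooth_fun X W f \<Longrightarrow> smooth_fun X W g \<Longrightarrow> smooth_fun X W (\<lambda>p. f p + g p)"
  unfolding smooth_fun_def smooth_on_def mopen_def
  by (clarsimp simp: o_def split: prod.splits, rule Ck_on_add) (auto split: prod.splits)

lemma smooth_fun_mult:
  "mopen X W \<Longrightarrow> smooth_fun X W f \<Longrightarrow> smooth_fun X W g \<Longrightarrow> smooth_fun X W (\<lambda>p. f p * g p)"
  unfolding smooth_fun_def smooth_on_def mopen_def
  by (clarsimp simp: o_def split: prod.splits, rule Ck_on_mult) (auto split: prod.splits)

lemma smooth_fun_minus:
  "mopen X W \<Longrightarrow> smooth_fun X W f \<Longrightarrow> smooth_fun X W (\<lambda>p. - f p)"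
  using smooth_fun_mult[OF _ smooth_fun_const[of X W "-1"], of f] by simp

lemma smooth_fun_diff:
  "mopen X W \<Longrightarrow> smooth_fun X W f \<Longrightarrow> smooth_fun X W g \<Longrightarrow> smooth_fun X W (\<lambda>p. f p - g p)"
  using smooth_fun_add[OF _ _ smooth_fun_minus, of X W f g] by simp

lemma smooth_fun_divide:
  assumes "inj_charts X" "mopen X W" "smooth_fun X W f" "smooth_fun X W g" "\<And>p. p \<in> W \<Longrightarrow> g p \<noteq> 0"
  shows "smooth_fun X W (\<lambda>p. f p / g p)"
proof -
  have "smooth_fun X W (\<lambda>p. inverse (g p))"
    using assms unfolding smooth_fun_def smooth_on_def mopen_def inj_charts_def
    by (auto simp: o_def intro!: Ck_on_inverse)
  from smooth_fun_mult[OF assms(2,3) this] show ?thesis by (simp add: field_simps)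
qed

lemma smooth_fun_sum:
  "mopen X W \<Longrightarrow> (\<And>i. i \<in> I \<Longrightarrow> smooth_fun X W (f i)) \<Longrightarrow> smooth_fun X W (\<lambda>p. \<Sum>i\<in>I. f i p)"
  by (induction I rule: infinite_finite_induct) (auto intro: smooth_fun_const smooth_fun_add)

lemma smooth_fun_prod:
  "mopen X W \<Longrightarrow> (\<And>i. i \<in> I \<Longrightarrow> smooth_fun X W (f i)) \<Longrightarrow> smooth_fun X W (\<lambda>p. \<Prod>i\<in>I. f i p)"
  by (induction I rule: infinite_finite_induct) (auto intro: smooth_fun_const smooth_fun_mult)

lemma smooth_fun_det:
  fixes M :: "'a \<Rightarrow> real^'i^'i"
  assumes "mopen X W" "\<And>i j. smooth_fun X W (\<lambda>p. M p $ i $ j)"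
  shows "smooth_fun X W (\<lambda>p. det (M p))"
  unfolding det_def
  by (intro smooth_fun_sum smooth_fun_mult smooth_fun_prod smooth_fun_const assms)

section \<open>Multilinear functions of lists\<close>

lemma linear_overD:
  "linear_over V f \<Longrightarrow> a \<in> V \<Longrightarrow> b \<in> V \<Longrightarrow> f (c *\<^sub>R a + b) = c *\<^sub>R f a + f b"
  by (simp add: linear_over_def)

lemma linear_over_zero: "linear_over V f \<Longrightarrow> 0 \<in> V \<Longrightarrow> f 0 = 0"
  using linear_overD[of V f 0 0 1] by simp

lemma linear_over_add: "linear_over V f \<Longrightarrow> a \<in> V \<Longrightarrow> b \<in> V \<Longrightarrow> f (a + b) = f a + f b"
  using linear_overD[of V f a b 1] by simp

lemma linear_over_scale: "linear_over V f \<Longrightarrow> 0 \<in> V \<Longrightarrow> a \<in> V \<Longrightarrow> f (c *\<^sub>R a) = c *\<^sub>R f a"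
  using linear_overD[of V f a 0 c] linear_over_zero[of V f] by simp

lemma linear_over_mono: "linear_over V f \<Longrightarrow> V' \<subseteq> V \<Longrightarrow> linear_over V' f"
  by (auto simp: linear_over_def)

lemma linear_over_sum:
  assumes "linear_over V f" "subspace V" "\<And>i. i \<in> I \<Longrightarrow> e i \<in> V"
  shows "f (\<Sum>i\<in>I. a i *\<^sub>R e i) = (\<Sum>i\<in>I. a i *\<^sub>R f (e i))"
  using assms(3)
proof (induction I rule: infinite_finite_induct)
  case (insert x I)
  have "(\<Sum>i\<in>I. a i *\<^sub>R e i) \<in> V"
    using insert by (intro subspace_sum[OF assms(2)] subspace_scale[OF assms(2)]) auto
  with insert show ?case by (simp add: linear_overD[OF assms(1)])
qed (use assms in \<open>auto simp: linear_over_zero subspace_0\<close>)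

text \<open>The derivation extension of \<open>\<phi>\<close>: the sum over all entries of a list of the values of \<open>F\<close> with \<open>\<phi>\<close>
  applied to that one entry. Recursion over the list lets splitting a list, for tensor products, and
  inserting an entry, for contractions, be handled by induction instead of index shifts.\<close>

primrec slot_sum :: "('w \<Rightarrow> 'w) \<Rightarrow> ('w list \<Rightarrow> real) \<Rightarrow> 'w list \<Rightarrow> real" where
  "slot_sum \<phi> F [] = 0"
| "slot_sum \<phi> F (x # xs) = F (\<phi> x # xs) + slot_sum \<phi> (\<lambda>ys. F (x # ys)) xs"

definition multilinear_over :: "'w::real_vector set \<Rightarrow> nat \<Rightarrow> ('w list \<Rightarrow> real) \<Rightarrow> bool" where
  "multilinear_over V n F \<longleftrightarrow> (\<forall>xs. length xs = n \<longrightarrow> set xs \<subseteq> V \<longrightarrow>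
     (\<forall>j<n. linear_over V (\<lambda>v. F (xs[j := v]))))"

lemma slot_sum_append:
  "slot_sum \<phi> F (xs @ ys) = slot_sum \<phi> (\<lambda>xs. F (xs @ ys)) xs + slot_sum \<phi> (\<lambda>ys. F (xs @ ys)) ys"
  by (induction xs arbitrary: F) auto

text \<open>The summand of the inserted entry splits off; this is the source of the trace terms under a
  contraction.\<close>

lemma slot_sum_insert:
  "i \<le> length xs \<Longrightarrow> slot_sum \<phi> F (take i xs @ x # drop i xs) =
     slot_sum \<phi> (\<lambda>xs. F (take i xs @ x # drop i xs)) xs + F (take i xs @ \<phi> x # drop i xs)"
proof (induction xs arbitrary: F i)
  case (Cons y ys)
  then show ?case by (cases i) auto
qed auto

lemma slot_sum_cong:
  assumes "\<And>ys. length ys = length xs \<Longrightarrow> set ys \<subseteq> V \<Longrightarrow> F ys = G ys"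
    and "set xs \<subseteq> V" "\<And>x. x \<in> V \<Longrightarrow> \<phi> x \<in> V"
  shows "slot_sum \<phi> F xs = slot_sum \<phi> G xs"
  using assms(1,2)
proof (induction xs arbitrary: F G)
  case (Cons x xs)
  have "slot_sum \<phi> (\<lambda>ys. F (x # ys)) xs = slot_sum \<phi> (\<lambda>ys. G (x # ys)) xs"
    by (rule Cons.IH) (use Cons.prems in auto)
  then show ?case using Cons.prems assms(3) by auto
qed auto

lemma slot_sum_combine:
  "slot_sum \<phi> (\<lambda>ys. c * F ys + G ys) xs = c * slot_sum \<phi> F xs + slot_sum \<phi> G xs"
  by (induction xs arbitrary: F G) (auto simp: algebra_simps)

lemma slot_sum_zero [simp]: "slot_sum \<phi> (\<lambda>ys. 0) xs = 0"
  by (induction xs) auto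

lemma slot_sum_mult_left: "slot_sum \<phi> (\<lambda>ys. c * F ys) xs = c * slot_sum \<phi> F xs"
  using slot_sum_combine[of \<phi> c F "\<lambda>_. 0"] by simp

lemma slot_sum_mult_right: "slot_sum \<phi> (\<lambda>ys. F ys * c) xs = slot_sum \<phi> F xs * c"
  using slot_sum_mult_left[of \<phi> c F] by (simp add: mult.commute)

lemma slot_sum_sum:
  "slot_sum \<phi> (\<lambda>ys. \<Sum>b\<in>S. F b ys) xs = (\<Sum>b\<in>S. slot_sum \<phi> (F b) xs)"
proof (induction S rule: infinite_finite_induct)
  case (insert x S)
  then show ?case using slot_sum_combine[of \<phi> 1 "F x" "\<lambda>ys. \<Sum>b\<in>S. F b ys"] by simp
qed auto

text \<open>Multilinearity unfolds along the list, so that it can be used in inductions over lists. If \<open>V\<close> is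
  empty there is no list to insert a first entry into.\<close>

lemma multilinear_over_Suc:
  "multilinear_over V (Suc n) F \<longleftrightarrow>
     (\<forall>xs. length xs = n \<longrightarrow> set xs \<subseteq> V \<longrightarrow> V \<noteq> {} \<longrightarrow> linear_over V (\<lambda>v. F (v # xs))) \<and>
     (\<forall>x\<in>V. multilinear_over V n (\<lambda>xs. F (x # xs)))" (is "?L \<longleftrightarrow> ?R")
proof
  assume L: ?L
  show ?R
  proof (intro conjI allI impI ballI)
    fix xs :: "'a list" assume "length xs = n" "set xs \<subseteq> V" "V \<noteq> {}"
    then obtain x where "x \<in> V" by auto
    have "linear_over V (\<lambda>v. F ((x # xs)[0 := v]))"
      using L[unfolded multilinear_over_def, rule_format, of "x # xs" 0] \<open>x \<in> V\<close> \<open>length xs = n\<close> \<open>set xs \<subseteq> V\<close>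
      by auto
    then show "linear_over V (\<lambda>v. F (v # xs))" by simp
  next
    fix x assume "x \<in> V"
    show "multilinear_over V n (\<lambda>xs. F (x # xs))"
      unfolding multilinear_over_def
    proof (intro allI impI)
      fix xs :: "'a list" and j assume "length xs = n" "set xs \<subseteq> V" "j < n"
      then show "linear_over V (\<lambda>v. F (x # xs[j := v]))"
        using L[unfolded multilinear_over_def, rule_format, of "x # xs" "Suc j"] \<open>x \<in> V\<close> by auto
    qed
  qed
next
  assume R: ?R
  show ?L
    unfolding multilinear_over_def
  proof (intro allI impI)
    fix xs :: "'a list" and j assume xs: "length xs = Suc n" "set xs \<subseteq> V" "j < Suc n"
    then obtain y ys where [simp]: "xs = y # ys" by (cases xs) auto
    show "linear_over V (\<lambda>v. F (xs[j := v]))"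
    proof (cases j)
      case 0
      then show ?thesis using R xs by auto
    next
      case (Suc j')
      then show ?thesis using R xs by (auto simp: multilinear_over_def)
    qed
  qed
qed

lemma multilinear_over_hd:
  "multilinear_over V (Suc n) F \<Longrightarrow> length xs = n \<Longrightarrow> set xs \<subseteq> V \<Longrightarrow> linear_over V (\<lambda>v. F (v # xs))"
  unfolding multilinear_over_Suc by (cases "V = {}") (auto simp: linear_over_def)

lemma multilinear_over_tl:
  "multilinear_over V (Suc n) F \<Longrightarrow> x \<in> V \<Longrightarrow> multilinear_over V n (\<lambda>xs. F (x # xs))"
  unfolding multilinear_over_Suc by auto

lemma multilinear_over_0 [simp]: "multilinear_over V 0 F"
  by (simp add: multilinear_over_def)

lemma linear_over_combine:
  fixes f g :: "_ \<Rightarrow> real"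
  shows "linear_over V f \<Longrightarrow> linear_over V g \<Longrightarrow> linear_over V (\<lambda>v. c * f v + g v)"
  by (auto simp: linear_over_def algebra_simps)

lemma multilinear_over_combine:
  "multilinear_over V n F \<Longrightarrow> multilinear_over V n G \<Longrightarrow> multilinear_over V n (\<lambda>xs. c * F xs + G xs)"
  by (auto simp: multilinear_over_def intro: linear_over_combine)

lemma multilinear_over_zero: "multilinear_over V n (\<lambda>xs. 0)"
  by (auto simp: multilinear_over_def linear_over_def)

lemma multilinear_over_cong:
  assumes "\<And>xs. length xs = n \<Longrightarrow> set xs \<subseteq> V \<Longrightarrow> F xs = G xs" "multilinear_over V n G" "subspace V"
  shows "multilinear_over V n F"
  unfolding multilinear_over_def
proof (intro allI impI)
  fix xs j assume xs: "length xs = n" "set xs \<subseteq> V" "j < n"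
  have "F (xs[j := v]) = G (xs[j := v])" if "v \<in> V" for v
    using xs that set_update_subset_insert[of xs j v] by (intro assms(1)) auto
  moreover have "linear_over V (\<lambda>v. G (xs[j := v]))"
    using assms(2) xs by (auto simp: multilinear_over_def)
  ultimately show "linear_over V (\<lambda>v. F (xs[j := v]))"
    using assms(3) by (auto simp: linear_over_def subspace_add subspace_scale)
qed

text \<open>A slot is filled either by \<open>v\<close> itself or, in a single summand, by \<open>\<phi> v\<close>; both depend linearly on \<open>v\<close>.\<close>

lemma multilinear_over_slot_sum:
  assumes "subspace V" "multilinear_over V n F" "linear_over V \<phi>" "\<And>x. x \<in> V \<Longrightarrow> \<phi> x \<in> V"
  shows "multilinear_over V n (slot_sum \<phi> F)"
  using assms(2)
proof (induction n arbitrary: F)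
  case (Suc n)
  show ?case
    unfolding multilinear_over_Suc
  proof (intro conjI allI impI ballI)
    fix xs assume xs: "length xs = n" "set xs \<subseteq> V"
    have 1: "linear_over V (\<lambda>v. F (v # ys))" if "length ys = n" "set ys \<subseteq> V" for ys
      using Suc.prems that by (rule multilinear_over_hd)
    have 2: "slot_sum \<phi> (\<lambda>ys. F ((c *\<^sub>R a + b) # ys)) xs =
        c * slot_sum \<phi> (\<lambda>ys. F (a # ys)) xs + slot_sum \<phi> (\<lambda>ys. F (b # ys)) xs"
      if "a \<in> V" "b \<in> V" for a b c
    proof -
      have "slot_sum \<phi> (\<lambda>ys. F ((c *\<^sub>R a + b) # ys)) xs =
          slot_sum \<phi> (\<lambda>ys. c * F (a # ys) + F (b # ys)) xs"
        by (rule slot_sum_cong[OF _ xs(2) assms(4)]) (use 1 that xs in \<open>auto simp: linear_over_def\<close>)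
      then show ?thesis by (simp add: slot_sum_combine)
    qed
    show "linear_over V (\<lambda>v. slot_sum \<phi> F (v # xs))"
      using 1[OF xs] assms(3,4) 2 by (auto simp: linear_over_def algebra_simps)
  next
    fix x assume x: "x \<in> V"
    show "multilinear_over V n (\<lambda>xs. slot_sum \<phi> F (x # xs))"
      using multilinear_over_combine[OF multilinear_over_tl[OF Suc.prems assms(4)[OF x]]
          Suc.IH[OF multilinear_over_tl[OF Suc.prems x]], of 1] by simp
  qed
qed simp

lemma multilinear_over_slot_sum_param:
  assumes "\<And>vs. length vs = l \<Longrightarrow> set vs \<subseteq> V \<Longrightarrow> multilinear_over U k (\<lambda>us. F us vs)"
    and "length vs = l" "set vs \<subseteq> V" "\<And>x. x \<in> V \<Longrightarrow> \<phi> x \<in> V"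
  shows "multilinear_over U k (\<lambda>us. slot_sum \<phi> (F us) vs)"
  using assms(1-3)
proof (induction vs arbitrary: F l)
  case (Cons v vs)
  have "multilinear_over U k (\<lambda>us. slot_sum \<phi> (\<lambda>ys. F us (v # ys)) vs)"
    by (rule Cons.IH[OF Cons.prems(1) refl]) (use Cons.prems in auto)
  moreover have "multilinear_over U k (\<lambda>us. F us (\<phi> v # vs))"
    by (rule Cons.prems(1)) (use Cons.prems assms(4) in auto)
  ultimately show ?case using multilinear_over_combine[of U k _ _ 1] by simp
qed (simp add: multilinear_over_zero)

lemma multilinear_over_prod:
  assumes "multilinear_over V k F" "multilinear_over V k' G"
  shows "multilinear_over V (k + k') (\<lambda>xs. F (take k xs) * G (drop k xs))"
  unfolding multilinear_over_def
proof (intro allI impI)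
  fix xs j assume xs: "length xs = k + k'" "set xs \<subseteq> V" "j < k + k'"
  have s: "set (take k xs) \<subseteq> V" "set (drop k xs) \<subseteq> V"
    using xs by (auto dest: in_set_takeD in_set_dropD)
  show "linear_over V (\<lambda>v. F (take k (xs[j := v])) * G (drop k (xs[j := v])))"
  proof (cases "j < k")
    case True
    then have "linear_over V (\<lambda>v. F ((take k xs)[j := v]))"
      using assms(1) s xs by (auto simp: multilinear_over_def)
    then show ?thesis
      using True by (auto simp: take_update_swap linear_over_def algebra_simps)
  next
    case False
    then have "linear_over V (\<lambda>v. G ((drop k xs)[j - k := v]))"
      using assms(2) s xs by (auto simp: multilinear_over_def)
    then show ?thesis
      using False by (auto simp: drop_update_swap linear_over_def algebra_simps)
  qed
qed

lemma slot_sum_combine_fun: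
  assumes "multilinear_over V (length xs) F" "set xs \<subseteq> V"
    and "\<And>x. x \<in> V \<Longrightarrow> \<phi> x = c *\<^sub>R \<phi>1 x + \<phi>2 x" "\<And>x. x \<in> V \<Longrightarrow> \<phi>1 x \<in> V" "\<And>x. x \<in> V \<Longrightarrow> \<phi>2 x \<in> V"
  shows "slot_sum \<phi> F xs = c * slot_sum \<phi>1 F xs + slot_sum \<phi>2 F xs"
  using assms(1,2)
proof (induction xs arbitrary: F)
  case (Cons x xs)
  have "linear_over V (\<lambda>v. F (v # xs))"
    using Cons.prems by (intro multilinear_over_hd) auto
  then have "F (\<phi> x # xs) = c * F (\<phi>1 x # xs) + F (\<phi>2 x # xs)"
    using assms(3-5) Cons.prems by (simp add: linear_over_def)
  moreover have "multilinear_over V (length xs) (\<lambda>ys. F (x # ys))"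
    using Cons.prems multilinear_over_tl[of V "length xs" F x] by auto
  ultimately show ?case using Cons by (simp add: algebra_simps)
qed auto

text \<open>Expanding \<open>\<phi> (e\<^sub>i)\<close> in the frame \<open>e\<close> and using multilinearity, every summand becomes a combination of
  components of \<open>F\<close> with the matrix entries of \<open>\<phi>\<close> as coefficients.\<close>

lemma smooth_fun_slot_sum:
  fixes e :: "'i::finite \<Rightarrow> 'a \<Rightarrow> 'w::real_vector"
  assumes W: "inj_charts X" "mopen X W" and V: "\<And>p. p \<in> W \<Longrightarrow> subspace (V p)"
    and F: "\<And>p. p \<in> W \<Longrightarrow> multilinear_over (V p) (length I) (F p)"
    and e: "\<And>p i. p \<in> W \<Longrightarrow> e i p \<in> V p"
    and smooth: "\<And>J. length J = length I \<Longrightarrow> smooth_fun X W (\<lambda>p. F p (map (\<lambda>i. e i p) J))"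
    and a: "\<And>i j. smooth_fun X W (a i j)"
    and \<phi>: "\<And>p i. p \<in> W \<Longrightarrow> \<phi> p (e i p) = (\<Sum>j\<in>UNIV. a i j p *\<^sub>R e j p)"
  shows "smooth_fun X W (\<lambda>p. slot_sum (\<phi> p) (F p) (map (\<lambda>i. e i p) I))"
  using F smooth
proof (induction I arbitrary: F)
  case Nil
  then show ?case by (simp add: smooth_fun_const W)
next
  case (Cons i I)
  have 1: "smooth_fun X W (\<lambda>p. F p (\<phi> p (e i p) # map (\<lambda>i. e i p) I))"
  proof (rule smooth_fun_cong_imp[OF W(2) _ W(1)])
    show "smooth_fun X W (\<lambda>p. \<Sum>j\<in>UNIV. a i j p * F p (map (\<lambda>i. e i p) (j # I)))"
      by (intro smooth_fun_sum smooth_fun_mult W a Cons.prems) auto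
    fix p assume p: "p \<in> W"
    have "linear_over (V p) (\<lambda>v. F p (v # map (\<lambda>i. e i p) I))"
      by (rule multilinear_over_hd[of "V p" "length I" "F p"]) (use Cons.prems(1)[OF p] e[OF p] in auto)
    from linear_over_sum[OF this V[OF p], of UNIV "\<lambda>j. e j p" "\<lambda>j. a i j p"]
    show "(\<Sum>j\<in>UNIV. a i j p * F p (map (\<lambda>i. e i p) (j # I))) =
        F p (\<phi> p (e i p) # map (\<lambda>i. e i p) I)"
      using e p by (simp add: \<phi>)
  qed
  have 2: "smooth_fun X W (\<lambda>p. slot_sum (\<phi> p) (\<lambda>ys. F p (e i p # ys)) (map (\<lambda>i. e i p) I))"
  proof (rule Cons.IH)
    show "multilinear_over (V p) (length I) (\<lambda>ys. F p (e i p # ys))" if "p \<in> W" for p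
      using multilinear_over_tl[OF _ e[OF that]] Cons.prems(1)[OF that] by auto
    show "smooth_fun X W (\<lambda>p. F p (e i p # map (\<lambda>i. e i p) J))" if "length J = length I" for J
      using Cons.prems(2)[of "i # J"] that by simp
  qed
  show ?case using smooth_fun_add[OF W(2) 1 2] by simp
qed

section \<open>The action of an endomorphism on tensors\<close>

lemma scaleR_fun_apply: "(c *\<^sub>R f) x = c *\<^sub>R f x"
  by (simp add: scaleR_fun_def)

lemma sum_fun_apply: "(\<Sum>i\<in>I. f i) x = (\<Sum>i\<in>I. f i x)"
  by (induction I rule: infinite_finite_induct) auto

lemma subspace_dual_space: "subspace V \<Longrightarrow> subspace (dual_space V)"
  by (auto simp: subspace_def dual_space_def linear_over_def scaleR_fun_apply algebra_simps)

text \<open>The value \<open>0\<close> off \<open>V\<close> is required so that composing with a covector, which is extended by \<open>0\<close>, gives a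
  covector again.\<close>

definition endomorphism_on :: "'w::real_vector set \<Rightarrow> ('w \<Rightarrow> 'w) \<Rightarrow> bool" where
  "endomorphism_on V \<phi> \<longleftrightarrow> linear_over V \<phi> \<and> (\<forall>v\<in>V. \<phi> v \<in> V) \<and> (\<forall>v. v \<notin> V \<longrightarrow> \<phi> v = 0)"

lemma dual_space_comp:
  assumes "subspace V" "endomorphism_on V \<phi>" "\<omega> \<in> dual_space V"
  shows "\<omega> \<circ> \<phi> \<in> dual_space V"
  using assms linear_over_zero[of V \<omega>]
  by (auto simp: dual_space_def linear_over_def endomorphism_on_def subspace_0)

lemma linear_over_comp_endomorphism: "linear_over U (\<lambda>\<omega>. \<omega> \<circ> \<phi>)" for U :: "('w::real_vector \<Rightarrow> real) set"
  by (auto simp: linear_over_def scaleR_fun_apply fun_eq_iff)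

text \<open>The derivation of the tensor algebra induced by \<open>\<phi>\<close>, acting on a vector \<open>v\<close> as \<open>\<phi> v\<close>. As a
  tensor, \<open>v\<close> is evaluation at \<open>v\<close>, so a covector argument \<open>\<omega>\<close> is replaced by \<open>\<omega> \<circ> \<phi>\<close> with sign plus, and a
  vector argument by its image with sign minus. The case distinction matters: changing an inadmissible
  argument may make it admissible.\<close>

definition endo_act ::
  "'w::real_vector set \<Rightarrow> ('w \<Rightarrow> 'w) \<Rightarrow> nat \<Rightarrow> nat \<Rightarrow> 'w tensor \<Rightarrow> 'w tensor" where
  "endo_act V \<phi> k l T = (\<lambda>\<omega>s vs. if (\<omega>s, vs) \<in> tensor_args V k l
     then slot_sum (\<lambda>\<omega>. \<omega> \<circ> \<phi>) (\<lambda>\<omega>s. T \<omega>s vs) \<omega>s - slot_sum \<phi> (T \<omega>s) vs else 0)"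

lemma tensors_iff:
  "T \<in> tensors V k l \<longleftrightarrow> (\<forall>\<omega>s vs. (\<omega>s, vs) \<notin> tensor_args V k l \<longrightarrow> T \<omega>s vs = 0) \<and>
     (\<forall>vs. length vs = l \<longrightarrow> set vs \<subseteq> V \<longrightarrow> multilinear_over (dual_space V) k (\<lambda>\<omega>s. T \<omega>s vs)) \<and>
     (\<forall>\<omega>s. length \<omega>s = k \<longrightarrow> set \<omega>s \<subseteq> dual_space V \<longrightarrow> multilinear_over V l (T \<omega>s))"
  unfolding tensors_def multilinear_over_def tensor_args_def by auto

lemma tensors_multilinear:
  assumes "T \<in> tensors V k l"
  shows "length vs = l \<Longrightarrow> set vs \<subseteq> V \<Longrightarrow> multilinear_over (dual_space V) k (\<lambda>\<omega>s. T \<omega>s vs)"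
    and "length \<omega>s = k \<Longrightarrow> set \<omega>s \<subseteq> dual_space V \<Longrightarrow> multilinear_over V l (T \<omega>s)"
  using assms by (auto simp: tensors_iff)

lemma tensors_add:
  assumes "T \<in> tensors V k l" "S \<in> tensors V k l"
  shows "T + S \<in> tensors V k l"
  unfolding tensors_iff
proof (intro conjI allI impI)
  fix vs assume vs: "length vs = l" "set vs \<subseteq> V"
  show "multilinear_over (dual_space V) k (\<lambda>\<omega>s. (T + S) \<omega>s vs)"
    using multilinear_over_combine[OF tensors_multilinear(1)[OF assms(1) vs] tensors_multilinear(1)[OF assms(2) vs], of 1]
    by simp
next
  fix \<omega>s assume w: "length \<omega>s = k" "set \<omega>s \<subseteq> dual_space V"
  show "multilinear_over V l ((T + S) \<omega>s)"
    using multilinear_over_combine[OF tensors_multilinear(2)[OF assms(1) w] tensors_multilinear(2)[OF assms(2) w], of 1]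
    by (simp add: plus_fun_def)
qed (use assms in \<open>simp add: tensors_iff\<close>)

lemma endo_act_in_tensors:
  assumes "subspace V" "endomorphism_on V \<phi>" "T \<in> tensors V k l"
  shows "endo_act V \<phi> k l T \<in> tensors V k l"
proof -
  have \<phi>: "linear_over V \<phi>" "\<And>v. v \<in> V \<Longrightarrow> \<phi> v \<in> V"
    using assms(2) by (auto simp: endomorphism_on_def)
  note d = subspace_dual_space[OF assms(1)]
  note dc = dual_space_comp[OF assms(1,2)]
  have T1: "multilinear_over (dual_space V) k (\<lambda>\<omega>s. T \<omega>s vs)" if "length vs = l" "set vs \<subseteq> V" for vs
    using assms(3) that by (simp add: tensors_iff)
  have T2: "multilinear_over V l (T \<omega>s)" if "length \<omega>s = k" "set \<omega>s \<subseteq> dual_space V" for \<omega>s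
    using assms(3) that by (simp add: tensors_iff)
  have 1: "multilinear_over (dual_space V) k (\<lambda>\<omega>s. endo_act V \<phi> k l T \<omega>s vs)"
    if vs: "length vs = l" "set vs \<subseteq> V" for vs
  proof (rule multilinear_over_cong[OF _ _ d])
    show "multilinear_over (dual_space V) k
       (\<lambda>\<omega>s. (- 1) * slot_sum \<phi> (T \<omega>s) vs + slot_sum (\<lambda>\<omega>. \<omega> \<circ> \<phi>) (\<lambda>\<omega>s. T \<omega>s vs) \<omega>s)"
      by (intro multilinear_over_combine multilinear_over_slot_sum_param[OF T1 vs \<phi>(2)]
          multilinear_over_slot_sum[OF d T1[OF vs]] linear_over_comp_endomorphism dc)
  qed (use vs in \<open>auto simp: endo_act_def tensor_args_def\<close>)
  have 2: "multilinear_over V l (endo_act V \<phi> k l T \<omega>s)"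
    if ws: "length \<omega>s = k" "set \<omega>s \<subseteq> dual_space V" for \<omega>s
  proof (rule multilinear_over_cong[OF _ _ assms(1)])
    show "multilinear_over V l
       (\<lambda>vs. (- 1) * slot_sum \<phi> (T \<omega>s) vs + slot_sum (\<lambda>\<omega>. \<omega> \<circ> \<phi>) (\<lambda>\<omega>s. T \<omega>s vs) \<omega>s)"
      by (intro multilinear_over_combine
          multilinear_over_slot_sum_param[where F = "\<lambda>vs \<omega>s. T \<omega>s vs", OF T2 ws dc]
          multilinear_over_slot_sum[OF assms(1) T2[OF ws]] \<phi>)
  qed (use ws in \<open>auto simp: endo_act_def tensor_args_def\<close>)
  show ?thesis
    using 1 2 by (auto simp: tensors_iff endo_act_def)
qed

lemma endo_act_combine:
  "endo_act V \<phi> k l (c *\<^sub>R T + T') = c *\<^sub>R endo_act V \<phi> k l T + endo_act V \<phi> k l T'"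
proof -
  have "slot_sum \<phi> (c *\<^sub>R F + G) xs = c * slot_sum \<phi> F xs + slot_sum \<phi> G xs" for F G xs
    using slot_sum_combine[of \<phi> c F G xs] by (simp add: plus_fun_def scaleR_fun_def)
  then show ?thesis
    by (simp add: endo_act_def fun_eq_iff scaleR_fun_apply slot_sum_combine)
       (simp add: algebra_simps)
qed

lemma endo_act_zero: "endo_act V \<phi> k l 0 = 0"
  using slot_sum_zero[folded zero_fun_def] by (auto simp: endo_act_def fun_eq_iff)

lemma endo_act_combine_endo:
  assumes "subspace V" "T \<in> tensors V k l" "endomorphism_on V \<phi>1" "endomorphism_on V \<phi>2"
    and "\<And>v. \<phi> v = c *\<^sub>R \<phi>1 v + \<phi>2 v"
  shows "endo_act V \<phi> k l T = c *\<^sub>R endo_act V \<phi>1 k l T + endo_act V \<phi>2 k l T"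
proof (intro ext)
  fix \<omega>s vs
  show "endo_act V \<phi> k l T \<omega>s vs = (c *\<^sub>R endo_act V \<phi>1 k l T + endo_act V \<phi>2 k l T) \<omega>s vs"
  proof (cases "(\<omega>s, vs) \<in> tensor_args V k l")
    case True
    then have a: "length \<omega>s = k" "set \<omega>s \<subseteq> dual_space V" "length vs = l" "set vs \<subseteq> V"
      by (auto simp: tensor_args_def)
    have "slot_sum \<phi> (T \<omega>s) vs = c * slot_sum \<phi>1 (T \<omega>s) vs + slot_sum \<phi>2 (T \<omega>s) vs"
      by (rule slot_sum_combine_fun[where V = V])
         (use a assms in \<open>auto simp: tensors_iff endomorphism_on_def\<close>)
    moreover have "slot_sum (\<lambda>\<omega>. \<omega> \<circ> \<phi>) (\<lambda>\<omega>s. T \<omega>s vs) \<omega>s =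
        c * slot_sum (\<lambda>\<omega>. \<omega> \<circ> \<phi>1) (\<lambda>\<omega>s. T \<omega>s vs) \<omega>s + slot_sum (\<lambda>\<omega>. \<omega> \<circ> \<phi>2) (\<lambda>\<omega>s. T \<omega>s vs) \<omega>s"
    proof (rule slot_sum_combine_fun[where V = "dual_space V"])
      show "multilinear_over (dual_space V) (length \<omega>s) (\<lambda>\<omega>s. T \<omega>s vs)"
        using assms(2) a by (auto simp: tensors_iff)
      show "\<omega> \<circ> \<phi> = c *\<^sub>R (\<omega> \<circ> \<phi>1) + (\<omega> \<circ> \<phi>2)" if w: "\<omega> \<in> dual_space V" for \<omega>
      proof (rule ext)
        fix v
        have V: "\<phi>1 v \<in> V" "\<phi>2 v \<in> V"
          using assms(1,3,4) subspace_0[of V]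
          by (cases "v \<in> V"; simp add: endomorphism_on_def)+
        show "(\<omega> \<circ> \<phi>) v = (c *\<^sub>R (\<omega> \<circ> \<phi>1) + (\<omega> \<circ> \<phi>2)) v"
          using w V assms(5)[of v] by (simp add: dual_space_def linear_over_def scaleR_fun_apply)
      qed
    qed (use a dual_space_comp[OF assms(1)] assms(3,4) in auto)
    ultimately show ?thesis using True by (simp add: endo_act_def scaleR_fun_apply algebra_simps)
  qed (simp add: endo_act_def scaleR_fun_apply)
qed

lemma tensor_args_append:
  "(\<omega>s, vs) \<in> tensor_args V (k + k') (l + l') \<longleftrightarrow>
      (take k \<omega>s, take l vs) \<in> tensor_args V k l \<and> (drop k \<omega>s, drop l vs) \<in> tensor_args V k' l'"
proof -
  have "set \<omega>s = set (take k \<omega>s) \<union> set (drop k \<omega>s)" "set vs = set (take l vs) \<union> set (drop l vs)"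
    by (metis append_take_drop_id set_append)+
  then show ?thesis unfolding tensor_args_def by (simp del: set_append) linarith
qed

text \<open>A slot of a tensor product belongs to exactly one of the factors.\<close>

lemma endo_act_prod:
  assumes "T \<in> tensors V k l" "S \<in> tensors V k' l'"
  shows "endo_act V \<phi> (k + k') (l + l') (\<lambda>\<omega>s vs. T (take k \<omega>s) (take l vs) * S (drop k \<omega>s) (drop l vs)) =
    (\<lambda>\<omega>s vs. endo_act V \<phi> k l T (take k \<omega>s) (take l vs) * S (drop k \<omega>s) (drop l vs)
            + T (take k \<omega>s) (take l vs) * endo_act V \<phi> k' l' S (drop k \<omega>s) (drop l vs))"
proof (intro ext, goal_cases)
  case (1 \<omega>s vs)
  note * = tensor_args_append[of \<omega>s vs V k k' l l']
  show ?case
  proof (cases "(\<omega>s, vs) \<in> tensor_args V (k + k') (l + l')")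
    case True
    define a b c d where abcd: "a = take k \<omega>s" "b = drop k \<omega>s" "c = take l vs" "d = drop l vs"
    have len: "length a = k" "length c = l" and eq: "\<omega>s = a @ b" "vs = c @ d"
      using True by (auto simp: abcd tensor_args_def)
    have cong: "slot_sum f F xs = slot_sum f G xs"
      if "\<And>ys. length ys = length xs \<Longrightarrow> F ys = G ys" for f and F G :: "'x list \<Rightarrow> real" and xs
      by (rule slot_sum_cong[of _ UNIV]) (use that in auto)
    have 1: "slot_sum (\<lambda>\<omega>. \<omega> \<circ> \<phi>) (\<lambda>xs. T (take k xs) c * S (drop k xs) d) \<omega>s =
        slot_sum (\<lambda>\<omega>. \<omega> \<circ> \<phi>) (\<lambda>xs. T xs c) a * S b d + T a c * slot_sum (\<lambda>\<omega>. \<omega> \<circ> \<phi>) (\<lambda>xs. S xs d) b"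
      unfolding eq slot_sum_append slot_sum_mult_right[symmetric] slot_sum_mult_left[symmetric]
      by (intro arg_cong2[where f = "(+)"] cong) (use len in simp_all)
    have 2: "slot_sum \<phi> (\<lambda>xs. T a (take l xs) * S b (drop l xs)) vs =
        slot_sum \<phi> (\<lambda>xs. T a xs) c * S b d + T a c * slot_sum \<phi> (\<lambda>xs. S b xs) d"
      unfolding eq slot_sum_append slot_sum_mult_right[symmetric] slot_sum_mult_left[symmetric]
      by (intro arg_cong2[where f = "(+)"] cong) (use len in simp_all)
    show ?thesis using True * 1 2 by (simp add: endo_act_def abcd) (simp add: algebra_simps)
  next
    case False
    then show ?thesis using * assms by (auto simp: endo_act_def tensors_iff)
  qed
qed

lemma tensor_args_insert:
  assumes "(\<omega>s, vs) \<in> tensor_args V k l" "\<omega> \<in> dual_space V" "v \<in> V"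
  shows "(take i \<omega>s @ \<omega> # drop i \<omega>s, take j vs @ v # drop j vs) \<in> tensor_args V (Suc k) (Suc l)"
  using assms set_take_subset[of i \<omega>s] set_drop_subset[of i \<omega>s] set_take_subset[of j vs] set_drop_subset[of j vs]
  by (auto simp: tensor_args_def dest: in_set_takeD in_set_dropD)

lemma tensor_args_insertD:
  assumes "(take i \<omega>s @ \<omega> # drop i \<omega>s, take j vs @ v # drop j vs) \<in> tensor_args V (Suc k) (Suc l)"
  shows "(\<omega>s, vs) \<in> tensor_args V k l"
proof -
  have "set \<omega>s = set (take i \<omega>s) \<union> set (drop i \<omega>s)" "set vs = set (take j vs) \<union> set (drop j vs)"
    by (metis append_take_drop_id set_append)+
  then show ?thesis using assms by (auto simp: tensor_args_def)
qed

lemma representation_in_dual: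
  assumes "independent S" "span S = V"
  shows "(\<lambda>v. representation S v b) \<in> dual_space V"
proof -
  have "representation S v b = 0" if "v \<notin> V" for v
    using that assms(2) by (simp add: representation_def)
  moreover have "representation S (c *\<^sub>R u + v) b = c * representation S u b + representation S v b"
    if "u \<in> V" "v \<in> V" for u v c
    using that assms(1) unfolding assms(2)[symmetric]
    by (simp add: representation_add representation_scale span_scale)
  ultimately show ?thesis by (simp add: dual_space_def linear_over_def)
qed

lemma representation_sum_eq:
  assumes "independent S" "finite S" "v \<in> span S"
  shows "(\<Sum>c\<in>S. representation S v c *\<^sub>R c) = v"
  using assms sum_representation_eq[of S v S] by simp

lemma linear_over_insert_slot:
  assumes "multilinear_over V (Suc n) F" "length xs = n" "set xs \<subseteq> V" "i \<le> n"
  shows "linear_over V (\<lambda>v. F (take i xs @ v # drop i xs))"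
proof (cases "V = {}")
  case False
  then obtain x where x: "x \<in> V" by auto
  let ?ys = "take i xs @ x # drop i xs"
  have "linear_over V (\<lambda>v. F (?ys[i := v]))"
    using assms x set_take_subset[of i xs] set_drop_subset[of i xs]
    by (intro assms(1)[unfolded multilinear_over_def, rule_format]) auto
  then show ?thesis using assms by (simp add: list_update_append)
qed (auto simp: linear_over_def)

text \<open>Among the slots of \<open>T\<close>, the two contracted ones contribute the trace of \<open>T (b\<^sup>* \<circ> \<phi>, b)\<close> minus that of
  \<open>T (b\<^sup>*, \<phi> b)\<close>. Both are \<open>\<Sum> \<phi>\<^sub>b\<^sub>c T (c\<^sup>*, b)\<close>, so they cancel and only the remaining slots are left.\<close>

lemma endo_act_contraction:
  assumes V: "subspace V" "endomorphism_on V \<phi>" and T: "T \<in> tensors V (Suc k) (Suc l)"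
    and S: "independent S" "span S = V" "finite S" and ij: "i \<le> k" "j \<le> l"
  shows "endo_act V \<phi> k l (\<lambda>\<omega>s vs. \<Sum>b\<in>S. T (take i \<omega>s @ (\<lambda>v. representation S v b) # drop i \<omega>s)
      (take j vs @ b # drop j vs)) \<omega>s vs =
    (\<Sum>b\<in>S. endo_act V \<phi> (Suc k) (Suc l) T (take i \<omega>s @ (\<lambda>v. representation S v b) # drop i \<omega>s)
      (take j vs @ b # drop j vs))"
proof (cases "(\<omega>s, vs) \<in> tensor_args V k l")
  case False
  then have "(take i \<omega>s @ \<omega> # drop i \<omega>s, take j vs @ v # drop j vs) \<notin> tensor_args V (Suc k) (Suc l)" for \<omega> v
    using tensor_args_insertD by blast
  with False show ?thesis by (simp add: endo_act_def)
next
  case True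
  define d where "d b = (\<lambda>v. representation S v b)" for b
  define io where "io x \<omega>s = take i \<omega>s @ x # drop i \<omega>s" for x and \<omega>s :: "('a \<Rightarrow> real) list"
  define iv where "iv x vs = take j vs @ x # drop j vs" for x and vs :: "'a list"
  have len: "length \<omega>s = k" "length vs = l" "set \<omega>s \<subseteq> dual_space V" "set vs \<subseteq> V"
    using True by (auto simp: tensor_args_def)
  have SV: "b \<in> V" if "b \<in> S" for b using S that by (auto intro: span_base)
  have d: "d b \<in> dual_space V" for b
    unfolding d_def by (rule representation_in_dual[OF S(1,2)])
  have \<phi>: "\<phi> v \<in> V" if "v \<in> V" for v using V(2) that by (auto simp: endomorphism_on_def)
  have in1: "(io (d b) \<omega>s, iv b vs) \<in> tensor_args V (Suc k) (Suc l)" if "b \<in> S" for b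
    unfolding io_def iv_def by (rule tensor_args_insert[OF True d SV[OF that]])
  have iv: "length (iv v vs) = Suc l" "set (iv v vs) \<subseteq> V" if "v \<in> V" for v
    using that len ij by (auto simp: iv_def dest: in_set_takeD in_set_dropD)
  have io: "length (io \<omega> \<omega>s) = Suc k" "set (io \<omega> \<omega>s) \<subseteq> dual_space V" if "\<omega> \<in> dual_space V" for \<omega>
    using that len ij by (auto simp: io_def dest: in_set_takeD in_set_dropD)
  have lin1: "linear_over (dual_space V) (\<lambda>\<omega>. T (io \<omega> \<omega>s) (iv v vs))" if "v \<in> V" for v
    unfolding io_def
    by (rule linear_over_insert_slot[where n = k and F = "\<lambda>\<omega>s. T \<omega>s (iv v vs)"])
       (use T iv[OF that] len ij in \<open>simp_all add: tensors_iff\<close>)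
  have lin2: "linear_over V (\<lambda>v. T (io \<omega> \<omega>s) (iv v vs))" if "\<omega> \<in> dual_space V" for \<omega>
    unfolding iv_def
    by (rule linear_over_insert_slot[where n = l])
       (use T io[OF that] len ij in \<open>simp_all add: tensors_iff\<close>)
  have comp: "d b \<circ> \<phi> = (\<Sum>c\<in>S. d b (\<phi> c) *\<^sub>R d c)" for b
  proof
    fix v
    show "(d b \<circ> \<phi>) v = (\<Sum>c\<in>S. d b (\<phi> c) *\<^sub>R d c) v"
    proof (cases "v \<in> V")
      case True
      then have v: "v = (\<Sum>c\<in>S. d c v *\<^sub>R c)"
        unfolding d_def using S by (simp add: representation_sum_eq)
      have "linear_over V (d b \<circ> \<phi>)"
        using dual_space_comp[OF V d] by (simp add: dual_space_def)
      from linear_over_sum[OF this V(1), of S "\<lambda>c. c" "\<lambda>c. d c v"] SV v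
      have "(d b \<circ> \<phi>) v = (\<Sum>c\<in>S. d c v *\<^sub>R (d b \<circ> \<phi>) c)" by simp
      then show ?thesis by (simp add: sum_fun_apply scaleR_fun_apply mult.commute)
    next
      case False
      then have "(d b \<circ> \<phi>) v = 0" "\<And>c. d c v = 0"
        using dual_space_comp[OF V d] d by (auto simp: dual_space_def)
      then show ?thesis by (simp add: sum_fun_apply scaleR_fun_apply)
    qed
  qed
  have trace: "(\<Sum>b\<in>S. T (io (d b \<circ> \<phi>) \<omega>s) (iv b vs)) = (\<Sum>b\<in>S. T (io (d b) \<omega>s) (iv (\<phi> b) vs))"
  proof -
    have "(\<Sum>b\<in>S. T (io (d b \<circ> \<phi>) \<omega>s) (iv b vs)) = (\<Sum>b\<in>S. \<Sum>c\<in>S. d b (\<phi> c) * T (io (d c) \<omega>s) (iv b vs))"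
      using linear_over_sum[OF lin1[OF SV] subspace_dual_space[OF V(1)], where I = S and e = d] d
      by (simp add: comp)
    also have "\<dots> = (\<Sum>c\<in>S. \<Sum>b\<in>S. d b (\<phi> c) * T (io (d c) \<omega>s) (iv b vs))"
      by (rule sum.swap)
    also have "\<dots> = (\<Sum>c\<in>S. T (io (d c) \<omega>s) (iv (\<phi> c) vs))"
    proof (rule sum.cong[OF refl])
      fix c assume "c \<in> S"
      have "\<phi> c = (\<Sum>b\<in>S. d b (\<phi> c) *\<^sub>R b)"
        unfolding d_def using S \<phi>[OF SV[OF \<open>c \<in> S\<close>]] by (simp add: representation_sum_eq)
      then have "T (io (d c) \<omega>s) (iv (\<phi> c) vs) = T (io (d c) \<omega>s) (iv (\<Sum>b\<in>S. d b (\<phi> c) *\<^sub>R b) vs)"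
        by simp
      also have "\<dots> = (\<Sum>b\<in>S. d b (\<phi> c) * T (io (d c) \<omega>s) (iv b vs))"
        using linear_over_sum[OF lin2[OF d] V(1), where I = S and e = "\<lambda>b. b"] SV by simp
      finally show "(\<Sum>b\<in>S. d b (\<phi> c) * T (io (d c) \<omega>s) (iv b vs)) = T (io (d c) \<omega>s) (iv (\<phi> c) vs)"
        by simp
    qed
    finally show ?thesis .
  qed
  have "slot_sum (\<lambda>\<omega>. \<omega> \<circ> \<phi>) (\<lambda>\<omega>s. T \<omega>s (iv b vs)) (io (d b) \<omega>s) =
      slot_sum (\<lambda>\<omega>. \<omega> \<circ> \<phi>) (\<lambda>\<omega>s. T (io (d b) \<omega>s) (iv b vs)) \<omega>s + T (io (d b \<circ> \<phi>) \<omega>s) (iv b vs)"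
    "slot_sum \<phi> (T (io (d b) \<omega>s)) (iv b vs) =
      slot_sum \<phi> (\<lambda>vs. T (io (d b) \<omega>s) (iv b vs)) vs + T (io (d b) \<omega>s) (iv (\<phi> b) vs)" for b
    using ij len slot_sum_insert[where F = "\<lambda>\<omega>s. T \<omega>s (iv b vs)" and xs = \<omega>s and i = i]
      slot_sum_insert[where F = "T (io (d b) \<omega>s)" and xs = vs and i = j]
    by (simp_all add: io_def iv_def)
  then have "(\<Sum>b\<in>S. endo_act V \<phi> (Suc k) (Suc l) T (io (d b) \<omega>s) (iv b vs)) =
      endo_act V \<phi> k l (\<lambda>\<omega>s vs. \<Sum>b\<in>S. T (io (d b) \<omega>s) (iv b vs)) \<omega>s vs"
    using True in1 trace by (simp add: endo_act_def slot_sum_sum sum.distrib sum_subtractf)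
  then show ?thesis by (simp add: io_def iv_def d_def)
qed

section \<open>Frames and dual frames\<close>

definition basis_at :: "('i \<Rightarrow> 'a \<Rightarrow> 'w::real_vector) \<Rightarrow> 'a \<Rightarrow> 'w set \<Rightarrow> bool" where
  "basis_at t p V \<longleftrightarrow> inj (\<lambda>i. t i p) \<and> independent (range (\<lambda>i. t i p)) \<and> span (range (\<lambda>i. t i p)) = V"

lemma basis_at_subspace: "basis_at t p V \<Longrightarrow> subspace V"
  by (auto simp: basis_at_def)

lemma basis_at_in: "basis_at t p V \<Longrightarrow> t i p \<in> V"
  by (auto simp: basis_at_def intro: span_base)

lemma basis_at_sum_in: "basis_at t p V \<Longrightarrow> (\<Sum>i\<in>I. a i *\<^sub>R t i p) \<in> V"
  by (intro subspace_sum subspace_scale basis_at_in) (auto dest: basis_at_subspace)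

lemma coframe_expand:
  fixes t :: "'i::finite \<Rightarrow> 'a \<Rightarrow> 'w::real_vector"
  assumes "basis_at t p V" "v \<in> V"
  shows "(\<Sum>i\<in>UNIV. coframe t i p v *\<^sub>R t i p) = v"
proof -
  have "(\<Sum>b\<in>range (\<lambda>i. t i p). representation (range (\<lambda>i. t i p)) v b *\<^sub>R b) = v"
    using assms by (intro representation_sum_eq) (auto simp: basis_at_def)
  then show ?thesis
    using assms by (simp add: sum.reindex basis_at_def coframe_def)
qed

lemma coframe_dual: "basis_at t p V \<Longrightarrow> coframe t i p \<in> dual_space V"
  unfolding coframe_def basis_at_def by (intro representation_in_dual) auto

lemma coframe_frame: "basis_at t p V \<Longrightarrow> coframe t i p (t j p) = (if i = j then 1 else 0)"
  by (auto simp: coframe_def basis_at_def representation_basis inj_def)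

lemma dual_space_sum:
  assumes "\<omega> \<in> dual_space V" "subspace V" "\<And>i. i \<in> I \<Longrightarrow> e i \<in> V"
  shows "\<omega> (\<Sum>i\<in>I. a i *\<^sub>R e i) = (\<Sum>i\<in>I. a i * \<omega> (e i))"
  using linear_over_sum[of V \<omega> I e a] assms by (auto simp: dual_space_def)

lemma coframe_sum:
  fixes t :: "'i::finite \<Rightarrow> 'a \<Rightarrow> 'w::real_vector"
  assumes "basis_at t p V"
  shows "coframe t i p (\<Sum>j\<in>UNIV. a j *\<^sub>R t j p) = a i"
  using assms
  by (simp add: dual_space_sum[OF coframe_dual basis_at_subspace] basis_at_in coframe_frame if_distrib
      cong: if_cong)

lemma dual_0: "\<omega> \<in> dual_space V \<Longrightarrow> \<omega> 0 = 0"
  using linear_over_zero[of V \<omega>] by (cases "0 \<in> V") (auto simp: dual_space_def)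

lemma coframe_zero: "basis_at t p V \<Longrightarrow> coframe t i p 0 = 0"
  using dual_0[OF coframe_dual] .

lemma coframe_add: "basis_at t p V \<Longrightarrow> v \<in> V \<Longrightarrow> w \<in> V \<Longrightarrow> coframe t i p (v + w) = coframe t i p v + coframe t i p w"
  using linear_over_add[of V "coframe t i p" v w] coframe_dual[of t p V i] by (simp add: dual_space_def)

lemma coframe_scale: "basis_at t p V \<Longrightarrow> v \<in> V \<Longrightarrow> coframe t i p (c *\<^sub>R v) = c * coframe t i p v"
  using linear_over_scale[of V "coframe t i p" v c] coframe_dual[of t p V i] basis_at_subspace[of t p V]
  by (simp add: dual_space_def subspace_0)

text \<open>The criterion for a family over a finite index set, where independence of the range alone would not
  exclude repetitions.\<close>

lemma basis_atI:
  fixes t :: "'i::finite \<Rightarrow> 'a \<Rightarrow> 'w::real_vector"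
  assumes "\<And>a. (\<Sum>i\<in>UNIV. a i *\<^sub>R t i p) = 0 \<Longrightarrow> (\<forall>i. a i = 0)"
    and "span (range (\<lambda>i. t i p)) = V"
  shows "basis_at t p V"
proof -
  have inj: "inj (\<lambda>i. t i p)"
  proof (rule injI, rule ccontr)
    fix i j assume eq: "t i p = t j p" and "i \<noteq> j"
    have "(\<Sum>k\<in>UNIV. ((if k = i then 1 else 0) - (if k = j then 1 else 0)) *\<^sub>R t k p) = t i p - t j p"
      by (simp add: scaleR_diff_left sum_subtractf if_distrib[of "\<lambda>c. c *\<^sub>R _"] cong: if_cong)
    from assms(1)[of "\<lambda>k. (if k = i then 1 else 0) - (if k = j then 1 else 0)", unfolded this] eq
    show False using \<open>i \<noteq> j\<close> by (auto dest!: spec[of _ i])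
  qed
  have "independent (range (\<lambda>i. t i p))"
  proof (rule independent_if_scalars_zero)
    fix f v assume "(\<Sum>x\<in>range (\<lambda>i. t i p). f x *\<^sub>R x) = 0" "v \<in> range (\<lambda>i. t i p)"
    then show "f v = 0" using assms(1)[of "\<lambda>i. f (t i p)"] inj by (auto simp: sum.reindex)
  qed simp
  with inj assms(2) show ?thesis by (simp add: basis_at_def)
qed

lemma in_span_range:
  fixes t :: "'i::finite \<Rightarrow> 'w::real_vector"
  shows "v \<in> span (range t) \<longleftrightarrow> (\<exists>a. v = (\<Sum>i\<in>UNIV. a i *\<^sub>R t i))"
proof
  assume "v \<in> span (range t)"
  then show "\<exists>a. v = (\<Sum>i\<in>UNIV. a i *\<^sub>R t i)"
  proof (induction rule: span_induct_alt)
    case base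
    then show ?case by (intro exI[of _ "\<lambda>_. 0"]) simp
  next
    case (step c x y)
    then obtain i a where "x = t i" "y = (\<Sum>i\<in>UNIV. a i *\<^sub>R t i)" by auto
    then show ?case
      by (intro exI[of _ "\<lambda>j. (if j = i then c else 0) + a j"])
         (simp add: scaleR_add_left sum.distrib if_distrib[of "\<lambda>c. c *\<^sub>R _"] cong: if_cong)
  qed
qed (auto intro!: span_sum span_scale intro: span_base)

section \<open>Raising an index with a nondegenerate form\<close>

lemma tensors02_linear:
  assumes "g \<in> tensors V 0 2" "w \<in> V"
  shows "linear_over V (\<lambda>u. g [] [u, w])" "linear_over V (\<lambda>u. g [] [w, u])"
proof -
  have m: "multilinear_over V (Suc (Suc 0)) (g [])"
    using assms(1) by (simp add: tensors_iff numeral_2_eq_2)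
  from multilinear_over_hd[OF m, of "[w]"] show "linear_over V (\<lambda>u. g [] [u, w])"
    using assms(2) by simp
  from multilinear_over_hd[OF multilinear_over_tl[OF m assms(2)], of "[]"]
  show "linear_over V (\<lambda>u. g [] [w, u])" by simp
qed

lemma bilinear_expand:
  fixes t :: "'i::finite \<Rightarrow> 'x \<Rightarrow> 'w::real_vector"
  assumes t: "basis_at t p V" and g: "g \<in> tensors V 0 2" and v: "v \<in> V" and w: "w \<in> V"
  shows "g [] [v, w] = (\<Sum>i\<in>UNIV. \<Sum>j\<in>UNIV. coframe t i p v * coframe t j p w * g [] [t i p, t j p])"
proof -
  note V = basis_at_subspace[OF t] and tV = basis_at_in[OF t]
  have "g [] [v, w] = (\<Sum>i\<in>UNIV. coframe t i p v * g [] [t i p, w])"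
    using linear_over_sum[where e = "\<lambda>i. t i p" and a = "\<lambda>i. coframe t i p v" and I = UNIV,
        OF tensors02_linear(1)[OF g w] V tV]
    unfolding coframe_expand[OF t v] by simp
  also have "\<dots> = (\<Sum>i\<in>UNIV. coframe t i p v * (\<Sum>j\<in>UNIV. coframe t j p w * g [] [t i p, t j p]))"
  proof (intro sum.cong refl arg_cong2[where f = "(*)"])
    fix i
    show "g [] [t i p, w] = (\<Sum>j\<in>UNIV. coframe t j p w * g [] [t i p, t j p])"
      using linear_over_sum[where e = "\<lambda>i. t i p" and a = "\<lambda>i. coframe t i p w" and I = UNIV,
        OF tensors02_linear(2)[OF g tV[of i]] V tV]
      unfolding coframe_expand[OF t w] by simp
  qed
  finally show ?thesis by (simp add: sum_distrib_left mult.assoc)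
qed

definition nondegenerate_on :: "'w::real_vector set \<Rightarrow> 'w tensor \<Rightarrow> bool" where
  "nondegenerate_on V g \<longleftrightarrow> (\<forall>u\<in>V. (\<forall>w\<in>V. g [] [u, w] = 0) \<longrightarrow> u = 0)"

text \<open>Half of the endomorphism obtained from \<open>S\<close> by raising an index with \<open>g\<close>, given without reference to a
  basis so that it is manifestly independent of local frames.\<close>

definition half_raise :: "'w::real_vector set \<Rightarrow> 'w tensor \<Rightarrow> 'w tensor \<Rightarrow> 'w \<Rightarrow> 'w" where
  "half_raise V g S v =
     (if v \<in> V then THE u. u \<in> V \<and> (\<forall>w\<in>V. g [] [u, w] = S [] [v, w] / 2) else 0)"

lemma half_raise_unique:
  assumes "subspace V" "g \<in> tensors V 0 2" "nondegenerate_on V g"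
    and "v \<in> V" "u \<in> V" "\<And>w. w \<in> V \<Longrightarrow> g [] [u, w] = S [] [v, w] / 2"
  shows "half_raise V g S v = u"
proof -
  have "u' = u" if u': "u' \<in> V" "\<forall>w\<in>V. g [] [u', w] = S [] [v, w] / 2" for u'
  proof -
    have "g [] [(- 1) *\<^sub>R u + u', w] = 0" if w: "w \<in> V" for w
    proof -
      have "g [] [(- 1) *\<^sub>R u + u', w] = (- 1) *\<^sub>R g [] [u, w] + g [] [u', w]"
        by (rule linear_overD[OF tensors02_linear(1)[OF assms(2) w] assms(5) u'(1)])
      then show ?thesis unfolding assms(6)[OF w] u'(2)[rule_format, OF w] by simp
    qed
    moreover have "(- 1) *\<^sub>R u + u' \<in> V"
      by (intro subspace_add subspace_scale assms(1,5) u'(1))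
    ultimately have "(- 1) *\<^sub>R u + u' = 0"
      using assms(3) unfolding nondegenerate_on_def by blast
    then show ?thesis by (simp add: add_eq_0_iff)
  qed
  note unique = this
  have "(THE u. u \<in> V \<and> (\<forall>w\<in>V. g [] [u, w] = S [] [v, w] / 2)) = u"
    by (rule the_equality) (use assms(5,6) in blast, use unique in blast)
  then show ?thesis using assms(4) by (simp add: half_raise_def)
qed

text \<open>In a basis the defining equation of \<open>half_raise\<close> is a linear system whose matrix is the Gram matrix of
  \<open>g\<close>, invertible by nondegeneracy. Cramer's rule gives the existence of the solution and at the same time
  its coordinates as quotients of determinants, the form in which their smoothness is evident.\<close>

lemma
  fixes t :: "'i::finite \<Rightarrow> 'a \<Rightarrow> 'w::real_vector"
  assumes t: "basis_at t p V" and g: "g \<in> tensors V 0 2" "nondegenerate_on V g"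
  shows gram_det_nonzero: "det (\<chi> i j. g [] [t j p, t i p]) \<noteq> 0"
    and half_raise_in: "S \<in> tensors V 0 2 \<Longrightarrow> v \<in> V \<Longrightarrow> half_raise V g S v \<in> V"
    and half_raise_eq: "S \<in> tensors V 0 2 \<Longrightarrow> v \<in> V \<Longrightarrow> w \<in> V \<Longrightarrow>
      g [] [half_raise V g S v, w] = S [] [v, w] / 2"
    and coframe_half_raise: "S \<in> tensors V 0 2 \<Longrightarrow> v \<in> V \<Longrightarrow>
      coframe t k p (half_raise V g S v) =
        det (\<chi> i j. if j = k then S [] [v, t i p] / 2 else g [] [t j p, t i p]) /
        det (\<chi> i j. g [] [t j p, t i p])"
proof -
  note V = basis_at_subspace[OF t] and tV = basis_at_in[OF t]
  \<comment> \<open>Rows are indexed by the second slot, so that \<open>M *v c\<close> lists the pairings of \<open>\<Sum> c\<^sub>j t\<^sub>j\<close> with the basis.\<close>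
  define M where "M = (\<chi> i j. g [] [t j p, t i p])"
  have gsum: "g [] [\<Sum>j\<in>UNIV. x j *\<^sub>R t j p, w] = (\<Sum>j\<in>UNIV. x j * g [] [t j p, w])" if "w \<in> V" for x w
    using linear_over_sum[OF tensors02_linear(1)[OF g(1) that] V, of UNIV "\<lambda>j. t j p" x] tV by simp
  have ext: "g [] [u, w] = S [] [v, w] / 2"
    if "u \<in> V" "v \<in> V" "w \<in> V" "S \<in> tensors V 0 2" "\<And>i. g [] [u, t i p] = S [] [v, t i p] / 2" for u v w S
  proof -
    define c where "c i = coframe t i p w" for i
    have w: "w = (\<Sum>i\<in>UNIV. c i *\<^sub>R t i p)"
      unfolding c_def using coframe_expand[OF t that(3)] by simp
    have "g [] [u, w] = (\<Sum>i\<in>UNIV. c i * g [] [u, t i p])"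
      unfolding w using linear_over_sum[OF tensors02_linear(2)[OF g(1) that(1)] V, of UNIV "\<lambda>j. t j p" c] tV by simp
    moreover have "S [] [v, w] = (\<Sum>i\<in>UNIV. c i * S [] [v, t i p])"
      unfolding w using linear_over_sum[OF tensors02_linear(2)[OF that(4,2)] V, of UNIV "\<lambda>j. t j p" c] tV by simp
    ultimately show ?thesis using that(5) by (simp add: sum_divide_distrib)
  qed
  have Mx: "(M *v x) $ i = g [] [\<Sum>j\<in>UNIV. (x $ j) *\<^sub>R t j p, t i p]" for x i
    unfolding gsum[OF tV] by (simp add: M_def matrix_vector_mult_def mult.commute)
  have zero: "(\<lambda>_ _. 0) \<in> tensors V 0 2"
    by (auto simp: tensors_iff multilinear_over_zero)
  have "x = 0" if "M *v x = 0" for x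
  proof -
    define u where "u = (\<Sum>j\<in>UNIV. (x $ j) *\<^sub>R t j p)"
    have u: "u \<in> V" unfolding u_def by (rule basis_at_sum_in[OF t])
    have "g [] [u, t i p] = 0" for i
      using Mx[of x i] that by (simp add: u_def)
    then have "\<forall>w\<in>V. g [] [u, w] = 0"
      using ext[OF u u _ zero] by simp
    then have "u = 0" using g(2) u by (auto simp: nondegenerate_on_def)
    have "x $ i = coframe t i p u" for i
      unfolding u_def by (rule coframe_sum[OF t, symmetric])
    moreover have "coframe t i p 0 = 0" for i
      using coframe_dual[OF t, of i] linear_over_zero[of V "coframe t i p"] subspace_0[OF V]
      by (simp add: dual_space_def)
    ultimately show "x = 0" using \<open>u = 0\<close> by (simp add: vec_eq_iff)
  qed
  then have "invertible M"
    by (simp add: invertible_left_inverse matrix_left_invertible_ker)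
  then have det: "det M \<noteq> 0" by (simp add: invertible_det_nz)
  then show "det (\<chi> i j. g [] [t j p, t i p]) \<noteq> 0" by (simp add: M_def)
  assume S: "S \<in> tensors V 0 2" and v: "v \<in> V"
  define c where "c = (\<chi> k. det (\<chi> i j. if j = k then S [] [v, t i p] / 2 else M $ i $ j) / det M)"
  define u where "u = (\<Sum>j\<in>UNIV. (c $ j) *\<^sub>R t j p)"
  have "M *v c = (\<chi> i. S [] [v, t i p] / 2)"
    unfolding cramer[OF det] by (simp add: c_def cong: if_cong)
  then have ut: "g [] [u, t i p] = S [] [v, t i p] / 2" for i
    using Mx[of c i] by (simp add: u_def)
  have u: "u \<in> V" unfolding u_def by (rule basis_at_sum_in[OF t])
  have eq: "half_raise V g S v = u"
    by (rule half_raise_unique[where S = S, OF V g v u]) (rule ext[OF u v _ S ut])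
  show "half_raise V g S v \<in> V" using eq u by simp
  show "g [] [half_raise V g S v, w] = S [] [v, w] / 2" if "w \<in> V"
    using ext[OF u v that S ut] eq by simp
  show "coframe t k p (half_raise V g S v) =
        det (\<chi> i j. if j = k then S [] [v, t i p] / 2 else g [] [t j p, t i p]) /
        det (\<chi> i j. g [] [t j p, t i p])"
    unfolding eq u_def coframe_sum[OF t] by (simp add: c_def M_def if_distrib cong: if_cong)
qed

lemma half_raise_endomorphism:
  fixes t :: "'i::finite \<Rightarrow> 'a \<Rightarrow> 'w::real_vector"
  assumes t: "basis_at t p V" and g: "g \<in> tensors V 0 2" "nondegenerate_on V g"
    and S: "S \<in> tensors V 0 2"
  shows "endomorphism_on V (half_raise V g S)"
  unfolding endomorphism_on_def
proof (intro conjI ballI allI impI)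
  note V = basis_at_subspace[OF t] note hin = half_raise_in[OF t g S] note heq = half_raise_eq[OF t g S]
  show "half_raise V g S v \<in> V" if "v \<in> V" for v by (rule hin[OF that])
  show "half_raise V g S v = 0" if "v \<notin> V" for v using that by (simp add: half_raise_def)
  show "linear_over V (half_raise V g S)"
    unfolding linear_over_def
  proof (intro ballI allI)
    fix a b c assume ab: "a \<in> V" "b \<in> V"
    show "half_raise V g S (c *\<^sub>R a + b) = c *\<^sub>R half_raise V g S a + half_raise V g S b"
    proof (rule half_raise_unique[OF V g])
      fix w assume w: "w \<in> V"
      show "g [] [c *\<^sub>R half_raise V g S a + half_raise V g S b, w] = S [] [c *\<^sub>R a + b, w] / 2"
        using linear_overD[OF tensors02_linear(1)[OF g(1) w] hin[OF ab(1)] hin[OF ab(2)], of c]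
          linear_overD[OF tensors02_linear(1)[OF S w] ab, of c] heq[OF ab(1) w] heq[OF ab(2) w]
        by (simp add: add_divide_distrib)
    qed (use ab V hin in \<open>auto intro: subspace_add subspace_scale\<close>)
  qed
qed

lemma half_raise_combine:
  fixes t :: "'i::finite \<Rightarrow> 'a \<Rightarrow> 'w::real_vector"
  assumes t: "basis_at t p V" and g: "g \<in> tensors V 0 2" "nondegenerate_on V g"
    and S: "S \<in> tensors V 0 2" "S' \<in> tensors V 0 2"
  shows "half_raise V g (c *\<^sub>R S + S') v = c *\<^sub>R half_raise V g S v + half_raise V g S' v"
proof (cases "v \<in> V")
  case True
  note V = basis_at_subspace[OF t]
  show ?thesis
  proof (rule half_raise_unique[OF V g True])
    note hin = half_raise_in[OF t g S(1) True] half_raise_in[OF t g S(2) True]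
    show "c *\<^sub>R half_raise V g S v + half_raise V g S' v \<in> V"
      using V hin by (intro subspace_add subspace_scale)
    show "g [] [c *\<^sub>R half_raise V g S v + half_raise V g S' v, w] = (c *\<^sub>R S + S') [] [v, w] / 2"
      if w: "w \<in> V" for w
      using linear_overD[OF tensors02_linear(1)[OF g(1) w] hin, of c]
        half_raise_eq[OF t g S(1) True w] half_raise_eq[OF t g S(2) True w]
      by (simp add: scaleR_fun_apply add_divide_distrib)
  qed
qed (simp add: half_raise_def)

section \<open>Bundles with local frames\<close>

text \<open>Sections and tensor fields are tested for smoothness in every frame separately, so their theory rests
  on open frame domains and pointwise bases. For the generalized tangent bundle these can be checked
  without studying the manifold structure of the total space.\<close>

locale framed_bundle =
  fixes B :: "('a, 'v::euclidean_space, 'w::real_vector, 'i::finite) vbundle"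
  assumes charts: "inj_charts (base B)"
    and frame_open: "(U, t) \<in> frames B \<Longrightarrow> mopen (base B) U"
    and frame_basis: "(U, t) \<in> frames B \<Longrightarrow> p \<in> U \<Longrightarrow> basis_at t p (fibre B p)"
    and cover: "p \<in> pts (base B) \<Longrightarrow> \<exists>U t. (U, t) \<in> frames B \<and> p \<in> U"
begin

lemma mopen_sub: "mopen (base B) W \<Longrightarrow> p \<in> W \<Longrightarrow> p \<in> pts (base B)"
  by (auto simp: mopen_def)

lemma basis_ex: "p \<in> pts (base B) \<Longrightarrow> \<exists>t. basis_at (t :: 'i \<Rightarrow> 'a \<Rightarrow> 'w) p (fibre B p)"
  using cover frame_basis by blast

lemma fibre_subspace: "p \<in> pts (base B) \<Longrightarrow> subspace (fibre B p)"
  by (elim basis_ex[THEN exE] basis_at_subspace)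

lemma mopen_frame: "(U, t) \<in> frames B \<Longrightarrow> mopen (base B) W \<Longrightarrow> mopen (base B) (U \<inter> W)"
  by (rule mopen_Int[OF charts frame_open])

lemma fibre_basis:
  assumes "p \<in> pts (base B)" "S = (SOME S. independent S \<and> span S = fibre B p)"
  shows "independent S" "span S = fibre B p" "finite S"
proof -
  obtain t :: "'i \<Rightarrow> 'a \<Rightarrow> 'w" where t: "basis_at t p (fibre B p)" using basis_ex assms(1) by blast
  have "\<exists>S. independent S \<and> span S = fibre B p" using t by (auto simp: basis_at_def)
  from someI_ex[OF this] show S: "independent S" "span S = fibre B p" by (auto simp: assms(2))
  show "finite S"
    using independent_span_bound[of "range (\<lambda>i. t i p)" S] S t span_superset[of S]
    by (auto simp: basis_at_def)
qed

lemma tensor_fieldsD: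
  assumes "T \<in> tensor_fields B W k l"
  shows "p \<in> W \<Longrightarrow> T p \<in> tensors (fibre B p) k l" "p \<notin> W \<Longrightarrow> T p = 0"
    "(U, t) \<in> frames B \<Longrightarrow> length I = k \<Longrightarrow> length J = l \<Longrightarrow>
      smooth_fun (base B) (U \<inter> W) (\<lambda>p. T p (map (\<lambda>i. coframe t i p) I) (map (\<lambda>j. t j p) J))"
  using assms by (auto simp: tensor_fields_def)

lemma tensor_fieldsI:
  assumes "\<And>p. p \<in> W \<Longrightarrow> T p \<in> tensors (fibre B p) k l" "\<And>p. p \<notin> W \<Longrightarrow> T p = 0"
    "\<And>U t I J. (U, t) \<in> frames B \<Longrightarrow> length I = k \<Longrightarrow> length J = l \<Longrightarrow>
      smooth_fun (base B) (U \<inter> W) (\<lambda>p. T p (map (\<lambda>i. coframe t i p) I) (map (\<lambda>j. t j p) J))"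
  shows "T \<in> tensor_fields B W k l"
  using assms by (auto simp: tensor_fields_def)

lemma tensor_fields_restrict:
  assumes "T \<in> tensor_fields B W k l" "W' \<subseteq> W" "mopen (base B) W'"
  shows "restrict0 W' T \<in> tensor_fields B W' k l"
proof (rule tensor_fieldsI)
  show "restrict0 W' T p \<in> tensors (fibre B p) k l" if "p \<in> W'" for p
    using tensor_fieldsD[OF assms(1)] that assms(2) by (auto simp: restrict0_def)
  show "restrict0 W' T p = 0" if "p \<notin> W'" for p using that by (simp add: restrict0_def)
  fix U t and I J :: "'i list" assume f: "(U, t) \<in> frames B" "length I = k" "length J = l"
  show "smooth_fun (base B) (U \<inter> W')
      (\<lambda>p. restrict0 W' T p (map (\<lambda>i. coframe t i p) I) (map (\<lambda>j. t j p) J))"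
    by (rule smooth_fun_cong_imp[OF mopen_frame[OF f(1) assms(3)] _ charts
          smooth_fun_subset[OF tensor_fieldsD(3)[OF assms(1) f]]])
       (use assms(2) in \<open>auto simp: restrict0_def\<close>)
qed

lemma frame_args:
  assumes "(U, t) \<in> frames B" "p \<in> U" "length I = k" "length J = l"
  shows "(map (\<lambda>i. coframe t i p) I, map (\<lambda>j. t j p) J) \<in> tensor_args (fibre B p) k l"
  using assms frame_basis[OF assms(1,2)] by (auto simp: tensor_args_def coframe_dual basis_at_in)

lemma sectionsD:
  assumes "Y \<in> sections B W"
  shows "p \<in> W \<Longrightarrow> Y p \<in> fibre B p" "p \<notin> W \<Longrightarrow> Y p = 0"
    "(U, t) \<in> frames B \<Longrightarrow> smooth_fun (base B) (U \<inter> W) (\<lambda>p. coframe t i p (Y p))"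
  using assms by (auto simp: sections_def)

lemma sections_restrict:
  assumes X: "X \<in> sections B W" and W': "mopen (base B) W'" "W' \<subseteq> W"
  shows "restrict0 W' X \<in> sections B W'"
  unfolding sections_def
proof (clarify, intro conjI allI ballI impI)
  show "restrict0 W' X p \<in> fibre B p" if "p \<in> W'" for p
    using sectionsD(1)[OF X, of p] that subsetD[OF W'(2) that] by (simp add: restrict0_def)
  show "restrict0 W' X p = 0" if "p \<notin> W'" for p using that by (simp add: restrict0_def)
  fix x assume x: "x \<in> frames B"
  obtain U t where [simp]: "x = (U, t)" by force
  have f: "(U, t) \<in> frames B" using x by simp
  have "smooth_fun (base B) (U \<inter> W') (\<lambda>p. coframe t i p (restrict0 W' X p))" for i
    by (rule smooth_fun_cong_imp[OF mopen_frame[OF f] _ charts smooth_fun_subset[OF sectionsD(3)[OF X f]]])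
       (use W' in \<open>auto simp: restrict0_def\<close>)
  then show "case x of (U, t) \<Rightarrow> \<forall>i. smooth_fun (base B) (U \<inter> W') (\<lambda>p. coframe t i p (restrict0 W' X p))"
    by simp
qed

lemma vec_tensor_field:
  assumes W: "mopen (base B) W" and Y: "Y \<in> sections B W"
  shows "vec_tensor B Y \<in> tensor_fields B W 1 0"
proof (rule tensor_fieldsI)
  fix p assume "p \<in> W"
  note V = fibre_subspace[OF mopen_sub[OF W \<open>p \<in> W\<close>]]
  have "multilinear_over (dual_space (fibre B p)) (Suc 0) (\<lambda>\<omega>s. vec_tensor B Y p \<omega>s [])"
    unfolding multilinear_over_Suc
    using subspace_dual_space[OF V]
    by (auto simp: linear_over_def vec_tensor_def tensor_args_def scaleR_fun_apply
        subspace_add subspace_scale)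
  then show "vec_tensor B Y p \<in> tensors (fibre B p) 1 0"
    by (auto simp: tensors_iff vec_tensor_def)
next
  fix p assume "p \<notin> W"
  then show "vec_tensor B Y p = 0"
    using sectionsD(2)[OF Y] by (auto simp: vec_tensor_def fun_eq_iff tensor_args_def length_Suc_conv dual_0)
next
  fix U t and I J :: "'i list" assume f: "(U, t) \<in> frames B" "length I = 1" "length J = 0"
  then obtain i where I: "I = [i]" by (auto simp: length_Suc_conv)
  show "smooth_fun (base B) (U \<inter> W) (\<lambda>p. vec_tensor B Y p (map (\<lambda>i. coframe t i p) I) (map (\<lambda>j. t j p) J))"
  proof (rule smooth_fun_cong_imp[OF mopen_frame[OF f(1) W] _ charts sectionsD(3)[OF Y f(1), of i]])
    fix p assume p: "p \<in> U \<inter> W"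
    show "coframe t i p (Y p) = vec_tensor B Y p (map (\<lambda>i. coframe t i p) I) (map (\<lambda>j. t j p) J)"
      using frame_args[OF f(1) _ f(2,3), of p] p f I by (simp add: vec_tensor_def)
  qed
qed

lemma tensor_prod_field:
  assumes W: "mopen (base B) W" and T: "T \<in> tensor_fields B W k l" and S: "S \<in> tensor_fields B W k' l'"
  shows "tensor_prod k l T S \<in> tensor_fields B W (k + k') (l + l')"
proof (rule tensor_fieldsI)
  fix p assume "p \<in> W"
  note Tp = tensor_fieldsD(1)[OF T \<open>p \<in> W\<close>] and Sp = tensor_fieldsD(1)[OF S \<open>p \<in> W\<close>]
  show "tensor_prod k l T S p \<in> tensors (fibre B p) (k + k') (l + l')"
    unfolding tensors_iff
  proof (intro conjI allI impI)
    fix \<omega>s vs assume "(\<omega>s, vs) \<notin> tensor_args (fibre B p) (k + k') (l + l')"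
    then show "tensor_prod k l T S p \<omega>s vs = 0"
      using Tp Sp unfolding tensor_args_append by (auto simp: tensor_prod_def tensors_iff)
  next
    fix vs :: "'w list" assume vs: "length vs = l + l'" "set vs \<subseteq> fibre B p"
    have "set (take l vs) \<subseteq> fibre B p" "set (drop l vs) \<subseteq> fibre B p"
      using vs by (auto dest: in_set_takeD in_set_dropD)
    then show "multilinear_over (dual_space (fibre B p)) (k + k') (\<lambda>\<omega>s. tensor_prod k l T S p \<omega>s vs)"
      unfolding tensor_prod_def
      by (intro multilinear_over_prod[where F = "\<lambda>\<omega>s. T p \<omega>s _" and G = "\<lambda>\<omega>s. S p \<omega>s _"])
         (use Tp Sp vs in \<open>auto simp: tensors_iff\<close>)
  next
    fix \<omega>s :: "('w \<Rightarrow> real) list" assume ws: "length \<omega>s = k + k'" "set \<omega>s \<subseteq> dual_space (fibre B p)"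
    have "set (take k \<omega>s) \<subseteq> dual_space (fibre B p)" "set (drop k \<omega>s) \<subseteq> dual_space (fibre B p)"
      using ws by (auto dest: in_set_takeD in_set_dropD)
    then show "multilinear_over (fibre B p) (l + l') (tensor_prod k l T S p \<omega>s)"
      unfolding tensor_prod_def
      by (intro multilinear_over_prod) (use Tp Sp ws in \<open>auto simp: tensors_iff\<close>)
  qed
next
  fix p assume "p \<notin> W"
  then show "tensor_prod k l T S p = 0"
    using tensor_fieldsD(2)[OF T] by (simp add: tensor_prod_def fun_eq_iff)
next
  fix U t and I J :: "'i list" assume f: "(U, t) \<in> frames B" "length I = k + k'" "length J = l + l'"
  show "smooth_fun (base B) (U \<inter> W) (\<lambda>p. tensor_prod k l T S p (map (\<lambda>i. coframe t i p) I) (map (\<lambda>j. t j p) J))"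
    unfolding tensor_prod_def take_map drop_map
    by (intro smooth_fun_mult mopen_frame[OF f(1) W] tensor_fieldsD(3)[OF T f(1)]
        tensor_fieldsD(3)[OF S f(1)]) (use f in auto)
qed

section \<open>The Leibniz rule for bilinear forms\<close>

definition insert_field :: "('a \<Rightarrow> 'w) \<Rightarrow> ('a \<Rightarrow> 'w tensor) \<Rightarrow> 'a \<Rightarrow> 'w tensor" where
  "insert_field Y T = (\<lambda>p \<omega>s vs. T p \<omega>s (Y p # vs))"

text \<open>Evaluating at \<open>Y\<close> is contracting with \<open>Y\<close>; hence every covariant derivative obeys a Leibniz rule for
  evaluations.\<close>

lemma contraction_insert:
  assumes W: "mopen (base B) W" and T: "T \<in> tensor_fields B W 0 (Suc l)"
    and Y: "\<And>p. p \<in> W \<Longrightarrow> Y p \<in> fibre B p"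
  shows "contraction B 0 0 (tensor_prod 1 0 (vec_tensor B Y) T) = insert_field Y T"
proof (intro ext)
  fix p \<omega>s vs
  define S where "S = (SOME S. independent S \<and> span S = fibre B p)"
  have lhs: "contraction B 0 0 (tensor_prod 1 0 (vec_tensor B Y) T) p \<omega>s vs =
      (\<Sum>b\<in>S. vec_tensor B Y p [\<lambda>v. representation S v b] [] * T p \<omega>s (b # vs))"
    by (simp add: contraction_def S_def[symmetric] Let_def tensor_prod_def)
  show "contraction B 0 0 (tensor_prod 1 0 (vec_tensor B Y) T) p \<omega>s vs = insert_field Y T p \<omega>s vs"
  proof (cases "p \<in> W")
    case False
    then show ?thesis using tensor_fieldsD(2)[OF T] lhs by (simp add: insert_field_def)
  next
    case True
    note S = fibre_basis[OF mopen_sub[OF W True] S_def]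
    note Tp = tensor_fieldsD(1)[OF T True]
    have SV: "b \<in> fibre B p" if "b \<in> S" for b using that S(2) by (auto intro: span_base)
    have "vec_tensor B Y p [\<lambda>v. representation S v b] [] = representation S (Y p) b" for b
      using representation_in_dual[OF S(1,2), of b] by (simp add: vec_tensor_def tensor_args_def)
    then have lhs': "contraction B 0 0 (tensor_prod 1 0 (vec_tensor B Y) T) p \<omega>s vs =
        (\<Sum>b\<in>S. representation S (Y p) b * T p \<omega>s (b # vs))"
      using lhs by simp
    show ?thesis
    proof (cases "\<omega>s = [] \<and> length vs = l \<and> set vs \<subseteq> fibre B p")
      case True
      then have "linear_over (fibre B p) (\<lambda>v. T p \<omega>s (v # vs))"
        by (intro multilinear_over_hd[of _ l "T p \<omega>s"]) (use Tp in \<open>auto simp: tensors_iff\<close>)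
      from linear_over_sum[OF this fibre_subspace[OF mopen_sub[OF W \<open>p \<in> W\<close>]],
          of S "\<lambda>b. b" "representation S (Y p)"]
      show ?thesis
        using lhs' SV representation_sum_eq[OF S(1,3)] Y[OF \<open>p \<in> W\<close>] S(2) by (simp add: insert_field_def)
    next
      case False
      then have "(\<omega>s, b # vs) \<notin> tensor_args (fibre B p) 0 (Suc l)" for b
        by (auto simp: tensor_args_def)
      then have "T p \<omega>s (b # vs) = 0" for b using Tp by (auto simp: tensors_iff)
      then show ?thesis using lhs' by (simp add: insert_field_def)
    qed
  qed
qed

lemma insert_field_field:
  assumes W: "mopen (base B) W" and T: "T \<in> tensor_fields B W 0 (Suc l)" and Y: "Y \<in> sections B W"
  shows "insert_field Y T \<in> tensor_fields B W 0 l"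
proof (rule tensor_fieldsI)
  fix p assume p: "p \<in> W"
  note Tp = tensor_fieldsD(1)[OF T p] and Yp = sectionsD(1)[OF Y p]
  show "insert_field Y T p \<in> tensors (fibre B p) 0 l"
    unfolding tensors_iff
  proof (intro conjI allI impI)
    fix \<omega>s vs assume "(\<omega>s, vs) \<notin> tensor_args (fibre B p) 0 l"
    then have "(\<omega>s, Y p # vs) \<notin> tensor_args (fibre B p) 0 (Suc l)" by (auto simp: tensor_args_def)
    then show "insert_field Y T p \<omega>s vs = 0" using Tp by (auto simp: tensors_iff insert_field_def)
  next
    fix \<omega>s :: "('w \<Rightarrow> real) list" assume "length \<omega>s = 0" "set \<omega>s \<subseteq> dual_space (fibre B p)"
    then show "multilinear_over (fibre B p) l (insert_field Y T p \<omega>s)"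
      using multilinear_over_tl[OF _ Yp, of l "T p \<omega>s"] Tp by (auto simp: tensors_iff insert_field_def)
  qed simp
next
  fix p assume "p \<notin> W"
  then show "insert_field Y T p = 0" using tensor_fieldsD(2)[OF T] by (simp add: insert_field_def fun_eq_iff)
next
  fix U t and I J :: "'i list" assume f: "(U, t) \<in> frames B" "length I = 0" "length J = l"
  show "smooth_fun (base B) (U \<inter> W) (\<lambda>p. insert_field Y T p (map (\<lambda>i. coframe t i p) I) (map (\<lambda>j. t j p) J))"
  proof (rule smooth_fun_cong_imp[OF mopen_frame[OF f(1) W] _ charts])
    show "smooth_fun (base B) (U \<inter> W) (\<lambda>p. \<Sum>i\<in>UNIV. coframe t i p (Y p) *
        T p (map (\<lambda>i. coframe t i p) I) (map (\<lambda>j. t j p) (i # J)))"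
      by (intro smooth_fun_sum smooth_fun_mult mopen_frame[OF f(1) W] sectionsD(3)[OF Y f(1)]
          tensor_fieldsD(3)[OF T f(1)]) (use f in auto)
    fix p assume p: "p \<in> U \<inter> W"
    then have b: "basis_at t p (fibre B p)" using frame_basis[OF f(1)] by auto
    have "linear_over (fibre B p) (\<lambda>v. T p [] (v # map (\<lambda>j. t j p) J))"
      by (rule multilinear_over_hd[of _ l "T p []"])
         (use tensor_fieldsD(1)[OF T] p f b in \<open>auto simp: tensors_iff basis_at_in\<close>)
    from linear_over_sum[OF this basis_at_subspace[OF b], of UNIV "\<lambda>i. t i p" "\<lambda>i. coframe t i p (Y p)"]
    show "(\<Sum>i\<in>UNIV. coframe t i p (Y p) * T p (map (\<lambda>i. coframe t i p) I) (map (\<lambda>j. t j p) (i # J))) =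
        insert_field Y T p (map (\<lambda>i. coframe t i p) I) (map (\<lambda>j. t j p) J)"
      using coframe_expand[OF b sectionsD(1)[OF Y]] p f by (simp add: basis_at_in[OF b] insert_field_def)
  qed
qed

lemma contraction_add: "contraction B i j (T + S) = contraction B i j T + contraction B i j S"
  by (simp add: contraction_def fun_eq_iff Let_def sum.distrib)

end

locale covariant = framed_bundle B
  for B :: "('a, 'v::euclidean_space, 'w::real_vector, 'i::finite) vbundle" +
  fixes anch :: "'w \<Rightarrow> ('a, 'v) tangent" and D :: "('a, 'w) cov_deriv"
  assumes cov: "covariant_derivative B anch D"
begin

lemma
  assumes "mopen (base B) W" "X \<in> sections B W" "T \<in> tensor_fields B W k l"
  shows D_field: "D W X k l T \<in> tensor_fields B W k l"
    and D_restrict: "mopen (base B) W' \<Longrightarrow> W' \<subseteq> W \<Longrightarrow>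
           D W' (restrict0 W' X) k l (restrict0 W' T) = restrict0 W' (D W X k l T)"
    and D_combine: "T' \<in> tensor_fields B W k l \<Longrightarrow>
           D W X k l (c *\<^sub>R T + T') = c *\<^sub>R D W X k l T + D W X k l T'"
    and D_combine_section: "X' \<in> sections B W \<Longrightarrow> smooth_fun (base B) W f \<Longrightarrow>
           D W (\<lambda>p. f p *\<^sub>R X p + X' p) k l T = (\<lambda>p. f p *\<^sub>R D W X k l T p + D W X' k l T p)"
    and D_prod: "S \<in> tensor_fields B W k' l' \<Longrightarrow>
           D W X (k + k') (l + l') (tensor_prod k l T S) =
             tensor_prod k l (D W X k l T) S + tensor_prod k l T (D W X k' l' S)"
    and D_contraction: "i < k \<Longrightarrow> j < l \<Longrightarrow>
           D W X (k - 1) (l - 1) (contraction B i j T) = contraction B i j (D W X k l T)"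
  using cov[unfolded covariant_derivative_def, THEN conjunct1, rule_format, of W X T k l] assms by auto

lemma D_fun:
  "mopen (base B) W \<Longrightarrow> X \<in> sections B W \<Longrightarrow> smooth_fun (base B) W f \<Longrightarrow>
     D W X 0 0 (fun_tensor W f) = fun_tensor W (\<lambda>p. tderiv (base B) p (anch (X p)) f)"
  using cov by (auto simp: covariant_derivative_def)

text \<open>The product rule and the compatibility with contractions, combined through \<open>contraction_insert\<close>. The
  field \<open>Y'\<close> represents the derivative of \<open>Y\<close> pointwise.\<close>

lemma D_insert:
  assumes W: "mopen (base B) W" and X: "X \<in> sections B W" and T: "T \<in> tensor_fields B W 0 (Suc l)"
    and Y: "Y \<in> sections B W" "\<And>p. p \<in> W \<Longrightarrow> Y' p \<in> fibre B p"
    and DY: "D W X 1 0 (vec_tensor B Y) = vec_tensor B Y'"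
  shows "D W X 0 l (insert_field Y T) = insert_field Y' T + insert_field Y (D W X 0 (Suc l) T)"
proof -
  note vY = vec_tensor_field[OF W Y(1)]
  note P = tensor_prod_field[OF W vY T]
  have "D W X 0 l (insert_field Y T) =
      D W X (1 + 0 - 1) (0 + Suc l - 1) (contraction B 0 0 (tensor_prod 1 0 (vec_tensor B Y) T))"
    by (simp only: contraction_insert[OF W T sectionsD(1)[OF Y(1)]]) simp
  also have "\<dots> = contraction B 0 0 (D W X (1 + 0) (0 + Suc l) (tensor_prod 1 0 (vec_tensor B Y) T))"
    by (rule D_contraction[OF W X P]) auto
  also have "\<dots> = contraction B 0 0 (tensor_prod 1 0 (vec_tensor B Y') T) +
      contraction B 0 0 (tensor_prod 1 0 (vec_tensor B Y) (D W X 0 (Suc l) T))"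
    unfolding D_prod[OF W X vY T] DY contraction_add ..
  also have "\<dots> = insert_field Y' T + insert_field Y (D W X 0 (Suc l) T)"
    by (simp only: contraction_insert[OF W T Y(2)]
        contraction_insert[OF W D_field[OF W X T] sectionsD(1)[OF Y(1)]])
  finally show ?thesis .
qed

text \<open>The Leibniz rule for \<open>T (Y, Z)\<close>, from evaluating twice. The function \<open>f\<close> is prescribed on \<open>W\<close> only, so
  that it may be any convenient extension of \<open>T (Y, Z)\<close>; \<open>tderiv\<close> is applied to \<open>f\<close> itself.\<close>

lemma D_bilinear_form:
  assumes W: "mopen (base B) W" and X: "X \<in> sections B W" and T: "T \<in> tensor_fields B W 0 2"
    and Y: "Y \<in> sections B W" "\<And>p. p \<in> W \<Longrightarrow> Y' p \<in> fibre B p" "D W X 1 0 (vec_tensor B Y) = vec_tensor B Y'"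
    and Z: "Z \<in> sections B W" "\<And>p. p \<in> W \<Longrightarrow> Z' p \<in> fibre B p" "D W X 1 0 (vec_tensor B Z) = vec_tensor B Z'"
    and f: "\<And>p. p \<in> W \<Longrightarrow> f p = T p [] [Y p, Z p]" and p: "p \<in> W"
  shows "tderiv (base B) p (anch (X p)) f =
    D W X 0 2 T p [] [Y p, Z p] + T p [] [Y' p, Z p] + T p [] [Y p, Z' p]"
proof -
  have T': "T \<in> tensor_fields B W 0 (Suc (Suc 0))" using T by (simp add: numeral_2_eq_2)
  note I1 = insert_field_field[OF W T' Y(1)]
  note I2 = insert_field_field[OF W I1 Z(1)]
  have eq: "insert_field Z (insert_field Y T) = fun_tensor W f"
  proof (intro ext)
    fix q \<omega>s vs
    show "insert_field Z (insert_field Y T) q \<omega>s vs = fun_tensor W f q \<omega>s vs"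
      using tensor_fieldsD(1,2)[OF I2, of q] f[of q]
      by (cases "\<omega>s = [] \<and> vs = []"; cases "q \<in> W")
         (auto simp: fun_tensor_def tensors_iff tensor_args_def insert_field_def)
  qed
  have f_smooth: "smooth_fun (base B) W f"
  proof (rule smooth_fun_local[OF charts])
    fix q assume q: "q \<in> W"
    obtain U t where U: "(U, t) \<in> frames B" "q \<in> U" using cover[OF mopen_sub[OF W q]] by blast
    note UW = mopen_frame[OF U(1) W]
    have "smooth_fun (base B) (U \<inter> W) f"
      by (rule smooth_fun_cong_imp[OF UW _ charts tensor_fieldsD(3)[OF I2 U(1), of "[]" "[]"]])
         (auto simp: eq fun_tensor_def)
    then show "\<exists>W'. q \<in> W' \<and> mopen (base B) W' \<and> smooth_fun (base B) W' f"
      using UW U(2) q by blast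
  qed
  have "fun_tensor W (\<lambda>p. tderiv (base B) p (anch (X p)) f) = D W X 0 0 (insert_field Z (insert_field Y T))"
    unfolding eq by (rule D_fun[OF W X f_smooth, symmetric])
  also have "\<dots> = insert_field Z' (insert_field Y T) +
      insert_field Z (insert_field Y' T + insert_field Y (D W X 0 (Suc (Suc 0)) T))"
    using D_insert[OF W X I1 Z] D_insert[OF W X T' Y] by simp
  finally have "(fun_tensor W (\<lambda>p. tderiv (base B) p (anch (X p)) f) :: 'a \<Rightarrow> 'w tensor) p [] [] = \<dots> p [] []"
    by simp
  then show ?thesis
    using p by (simp add: fun_tensor_def insert_field_def numeral_2_eq_2)
qed

end

section \<open>Correcting a covariant derivative by a form\<close>

locale metrized = covariant B anch D
  for B :: "('a, 'v::euclidean_space, 'w::real_vector, 'i::finite) vbundle"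
    and anch :: "'w \<Rightarrow> ('a, 'v) tangent" and D :: "('a, 'w) cov_deriv" +
  fixes G :: "'a \<Rightarrow> 'w tensor"
  assumes metric: "G \<in> tensor_fields B (pts (base B)) 0 2"
    and nondegenerate: "p \<in> pts (base B) \<Longrightarrow> nondegenerate_on (fibre B p) (G p)"
begin

abbreviation "DG W X \<equiv> D W X 0 2 (restrict0 W G)"

definition correction :: "'a set \<Rightarrow> ('a \<Rightarrow> 'w) \<Rightarrow> 'a \<Rightarrow> 'w \<Rightarrow> 'w" where
  "correction W X p = half_raise (fibre B p) (G p) (DG W X p)"

text \<open>Outside \<open>W\<close> the correction term vanishes because \<open>T p = 0\<close> there.\<close>

definition corrected :: "('a, 'w) cov_deriv" where
  "corrected W X k l T = (\<lambda>p. D W X k l T p + endo_act (fibre B p) (correction W X p) k l (T p))"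

context
  fixes W X assumes W: "mopen (base B) W" and X: "X \<in> sections B W"
begin

lemma metric_restrict: "restrict0 W G \<in> tensor_fields B W 0 2"
  using tensor_fields_restrict[OF metric _ W] W by (auto simp: mopen_def)

lemma metric_at: "p \<in> W \<Longrightarrow> G p \<in> tensors (fibre B p) 0 2"
  using tensor_fieldsD(1)[OF metric mopen_sub[OF W]] .

lemma nondegenerate_at: "p \<in> W \<Longrightarrow> nondegenerate_on (fibre B p) (G p)"
  using nondegenerate mopen_sub[OF W] .

lemma D_metric_at: "p \<in> W \<Longrightarrow> DG W X p \<in> tensors (fibre B p) 0 2"
  using tensor_fieldsD(1)[OF D_field[OF W X metric_restrict]] .

lemma correction_endomorphism: "p \<in> W \<Longrightarrow> endomorphism_on (fibre B p) (correction W X p)"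
  unfolding correction_def[abs_def]
  by (rule exE[OF basis_ex[OF mopen_sub[OF W]]], assumption)
     (rule half_raise_endomorphism[OF _ metric_at nondegenerate_at D_metric_at])

lemma correction_in: "p \<in> W \<Longrightarrow> v \<in> fibre B p \<Longrightarrow> correction W X p v \<in> fibre B p"
  using correction_endomorphism by (auto simp: endomorphism_on_def)

lemma correction_eq:
  assumes p: "p \<in> W" "v \<in> fibre B p" "w \<in> fibre B p"
  shows "G p [] [correction W X p v, w] = DG W X p [] [v, w] / 2"
proof -
  obtain t :: "'i \<Rightarrow> 'a \<Rightarrow> 'w" where "basis_at t p (fibre B p)"
    using basis_ex[OF mopen_sub[OF W p(1)]] by blast
  from half_raise_eq[OF this metric_at[OF p(1)] nondegenerate_at[OF p(1)] D_metric_at[OF p(1)] p(2,3)]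
  show ?thesis by (simp add: correction_def)
qed

text \<open>The coordinates of \<open>half_raise\<close> are quotients of determinants in the components of \<open>G\<close> and of its
  covariant derivative, all taken in the one frame \<open>t\<close>; no transition functions enter.\<close>

lemma correction_smooth:
  assumes f: "(U, t) \<in> frames B"
  shows "smooth_fun (base B) (U \<inter> W) (\<lambda>p. coframe t k p (correction W X p (t j p)))"
proof -
  note UW = mopen_frame[OF f W]
  have sub: "U \<inter> W \<subseteq> U \<inter> pts (base B)" using W by (auto simp: mopen_def)
  have G: "smooth_fun (base B) (U \<inter> W) (\<lambda>p. G p [] [t j p, t i p])" for i j
    using smooth_fun_subset[OF tensor_fieldsD(3)[OF metric f, of "[]" "[j, i]"] sub] by simp
  have S: "smooth_fun (base B) (U \<inter> W) (\<lambda>p. DG W X p [] [t j p, t i p])" for i j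
    using tensor_fieldsD(3)[OF D_field[OF W X metric_restrict] f, of "[]" "[j, i]"] by simp
  have basis: "basis_at t p (fibre B p)" if "p \<in> U \<inter> W" for p
    using frame_basis[OF f] that by auto
  show ?thesis
  proof (rule smooth_fun_cong_imp[OF UW _ charts])
    show "smooth_fun (base B) (U \<inter> W) (\<lambda>p. 
        det (\<chi> i l. if l = k then DG W X p [] [t j p, t i p] / 2 else G p [] [t l p, t i p]) /
        det (\<chi> i j. G p [] [t j p, t i p]))"
    proof (rule smooth_fun_divide[OF charts UW])
      show "smooth_fun (base B) (U \<inter> W) (\<lambda>p. det (\<chi> i j. G p [] [t j p, t i p]))"
        by (rule smooth_fun_det[OF UW]) (simp add: G)
      show "smooth_fun (base B) (U \<inter> W) (\<lambda>p. det (\<chi> i l. if l = k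
          then DG W X p [] [t j p, t i p] / 2 else G p [] [t l p, t i p]))"
      proof (rule smooth_fun_det[OF UW])
        fix i l
        show "smooth_fun (base B) (U \<inter> W) (\<lambda>p. (\<chi> i l. if l = k
          then DG W X p [] [t j p, t i p] / 2 else G p [] [t l p, t i p]) $ i $ l)"
          using smooth_fun_mult[OF UW smooth_fun_const[OF UW, of "1/2"] S[of j i]]
          by (cases "l = k") (simp_all add: G)
      qed
      show "det (\<chi> i j. G p [] [t j p, t i p]) \<noteq> 0" if "p \<in> U \<inter> W" for p
        using gram_det_nonzero[OF basis[OF that] metric_at nondegenerate_at] that by auto
    qed
    show "det (\<chi> i l. if l = k then DG W X p [] [t j p, t i p] / 2 else G p [] [t l p, t i p]) /
        det (\<chi> i j. G p [] [t j p, t i p]) = coframe t k p (correction W X p (t j p))"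
      if p: "p \<in> U \<inter> W" for p
      unfolding correction_def
      using coframe_half_raise[OF basis[OF p] metric_at nondegenerate_at D_metric_at basis_at_in[OF basis[OF p]]] p
      by auto
  qed
qed

lemma endo_act_field:
  assumes T: "T \<in> tensor_fields B W k l"
  shows "(\<lambda>p. endo_act (fibre B p) (correction W X p) k l (T p)) \<in> tensor_fields B W k l"
proof (rule tensor_fieldsI)
  show "endo_act (fibre B p) (correction W X p) k l (T p) \<in> tensors (fibre B p) k l" if "p \<in> W" for p
    by (rule endo_act_in_tensors[OF fibre_subspace[OF mopen_sub[OF W that]]
          correction_endomorphism[OF that] tensor_fieldsD(1)[OF T that]])
  show "endo_act (fibre B p) (correction W X p) k l (T p) = 0" if "p \<notin> W" for p
    using tensor_fieldsD(2)[OF T that] by (simp add: endo_act_zero)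
next
  fix U t and I J :: "'i list" assume f: "(U, t) \<in> frames B" "length I = k" "length J = l"
  note UW = mopen_frame[OF f(1) W]
  have p: "p \<in> W" "basis_at t p (fibre B p)" "subspace (fibre B p)" "endomorphism_on (fibre B p) (correction W X p)"
    "T p \<in> tensors (fibre B p) k l"
    if "p \<in> U \<inter> W" for p
    using that frame_basis[OF f(1)] correction_endomorphism fibre_subspace[OF mopen_sub[OF W]]
      tensor_fieldsD(1)[OF T] by auto
  have "smooth_fun (base B) (U \<inter> W) (\<lambda>p. slot_sum (\<lambda>\<omega>. \<omega> \<circ> correction W X p)
      (\<lambda>\<omega>s. T p \<omega>s (map (\<lambda>j. t j p) J)) (map (\<lambda>i. coframe t i p) I))"
  proof (rule smooth_fun_slot_sum[OF charts UW, where V = "\<lambda>p. dual_space (fibre B p)" and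
        a = "\<lambda>i j p. coframe t i p (correction W X p (t j p))"])
    fix q assume q: "q \<in> U \<inter> W"
    note q' = p[OF q]
    show "subspace (dual_space (fibre B q))" by (rule subspace_dual_space[OF q'(3)])
    show "multilinear_over (dual_space (fibre B q)) (length I) (\<lambda>\<omega>s. T q \<omega>s (map (\<lambda>j. t j q) J))"
      using tensors_multilinear(1)[OF q'(5), of "map (\<lambda>j. t j q) J"] f basis_at_in[OF q'(2)] by auto
    show "coframe t i q \<in> dual_space (fibre B q)" for i by (rule coframe_dual[OF q'(2)])
    show "coframe t i q \<circ> correction W X q =
        (\<Sum>j\<in>UNIV. coframe t i q (correction W X q (t j q)) *\<^sub>R coframe t j q)" for i
    proof
      fix v
      note d = dual_space_comp[OF q'(3,4) coframe_dual[OF q'(2), of i]]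
      show "(coframe t i q \<circ> correction W X q) v =
        (\<Sum>j\<in>UNIV. coframe t i q (correction W X q (t j q)) *\<^sub>R coframe t j q) v"
      proof (cases "v \<in> fibre B q")
        case True
        have "(coframe t i q \<circ> correction W X q) (\<Sum>j\<in>UNIV. coframe t j q v *\<^sub>R t j q) =
            (\<Sum>j\<in>UNIV. coframe t j q v * (coframe t i q \<circ> correction W X q) (t j q))"
          by (rule dual_space_sum[OF d q'(3) basis_at_in[OF q'(2)]])
        then show ?thesis
          unfolding coframe_expand[OF q'(2) True]
          by (simp add: sum_fun_apply scaleR_fun_apply mult.commute)
      next
        case False
        then have "(coframe t i q \<circ> correction W X q) v = 0" "\<And>j. coframe t j q v = 0"
          using d coframe_dual[OF q'(2)] by (auto simp: dual_space_def)
        then show ?thesis by (simp add: sum_fun_apply scaleR_fun_apply)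
      qed
    qed
  next
    show "smooth_fun (base B) (U \<inter> W) (\<lambda>p. T p (map (\<lambda>i. coframe t i p) I') (map (\<lambda>j. t j p) J))"
      if "length I' = length I" for I'
      using tensor_fieldsD(3)[OF T f(1)] that f by auto
    show "smooth_fun (base B) (U \<inter> W) (\<lambda>p. coframe t i p (correction W X p (t j p)))" for i j
      by (rule correction_smooth[OF f(1)])
  qed
  moreover have "smooth_fun (base B) (U \<inter> W) (\<lambda>p. slot_sum (correction W X p)
      (T p (map (\<lambda>i. coframe t i p) I)) (map (\<lambda>j. t j p) J))"
  proof (rule smooth_fun_slot_sum[OF charts UW, where V = "\<lambda>p. fibre B p" and
        a = "\<lambda>i j p. coframe t j p (correction W X p (t i p))"])
    fix q assume q: "q \<in> U \<inter> W"
    note q' = p[OF q]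
    show "subspace (fibre B q)" by fact
    show "multilinear_over (fibre B q) (length J) (T q (map (\<lambda>i. coframe t i q) I))"
      using tensors_multilinear(2)[OF q'(5), of "map (\<lambda>i. coframe t i q) I"] f coframe_dual[OF q'(2)] by auto
    show "t i q \<in> fibre B q" for i by (rule basis_at_in[OF q'(2)])
    show "correction W X q (t i q) = (\<Sum>j\<in>UNIV. coframe t j q (correction W X q (t i q)) *\<^sub>R t j q)" for i
      by (rule coframe_expand[OF q'(2) correction_in[OF q'(1) basis_at_in[OF q'(2)]], symmetric])
  next
    show "smooth_fun (base B) (U \<inter> W) (\<lambda>p. T p (map (\<lambda>i. coframe t i p) I) (map (\<lambda>j. t j p) J'))"
      if "length J' = length J" for J'
      using tensor_fieldsD(3)[OF T f(1)] that f by auto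
    show "smooth_fun (base B) (U \<inter> W) (\<lambda>p. coframe t j p (correction W X p (t i p)))" for i j
      by (rule correction_smooth[OF f(1)])
  qed
  ultimately have "smooth_fun (base B) (U \<inter> W) (\<lambda>p.
      slot_sum (\<lambda>\<omega>. \<omega> \<circ> correction W X p) (\<lambda>\<omega>s. T p \<omega>s (map (\<lambda>j. t j p) J)) (map (\<lambda>i. coframe t i p) I) -
      slot_sum (correction W X p) (T p (map (\<lambda>i. coframe t i p) I)) (map (\<lambda>j. t j p) J))"
    by (rule smooth_fun_diff[OF UW])
  then show "smooth_fun (base B) (U \<inter> W) (\<lambda>p. endo_act (fibre B p) (correction W X p) k l (T p)
      (map (\<lambda>i. coframe t i p) I) (map (\<lambda>j. t j p) J))"
    by (rule smooth_fun_cong_imp[OF UW _ charts, rotated])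
       (use frame_args[OF f(1) _ f(2,3)] in \<open>simp add: endo_act_def\<close>)
qed

lemma tensor_field_add:
  assumes T: "T \<in> tensor_fields B W k l" and S: "S \<in> tensor_fields B W k l"
  shows "(\<lambda>p. T p + S p) \<in> tensor_fields B W k l"
proof (rule tensor_fieldsI)
  show "T p + S p \<in> tensors (fibre B p) k l" if "p \<in> W" for p
    by (rule tensors_add[OF tensor_fieldsD(1)[OF T that] tensor_fieldsD(1)[OF S that]])
  show "T p + S p = 0" if "p \<notin> W" for p
    using tensor_fieldsD(2)[OF T that] tensor_fieldsD(2)[OF S that] by simp
  fix U t and I J :: "'i list" assume f: "(U, t) \<in> frames B" "length I = k" "length J = l"
  show "smooth_fun (base B) (U \<inter> W) (\<lambda>p. (T p + S p) (map (\<lambda>i. coframe t i p) I) (map (\<lambda>j. t j p) J))"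
    using smooth_fun_add[OF mopen_frame[OF f(1) W] tensor_fieldsD(3)[OF T f] tensor_fieldsD(3)[OF S f]] by simp
qed

lemma corrected_field:
  assumes T: "T \<in> tensor_fields B W k l"
  shows "corrected W X k l T \<in> tensor_fields B W k l"
  unfolding corrected_def by (rule tensor_field_add[OF D_field[OF W X T] endo_act_field[OF T]])

lemma correction_restrict:
  assumes W': "mopen (base B) W'" "W' \<subseteq> W" and p: "p \<in> W'"
  shows "correction W' (restrict0 W' X) p = correction W X p"
proof -
  have eq: "restrict0 W' (restrict0 W G) = restrict0 W' G"
    using W'(2) by (auto simp: restrict0_def fun_eq_iff)
  have "D W' (restrict0 W' X) 0 2 (restrict0 W' G) = restrict0 W' (DG W X)"
    using D_restrict[OF W X metric_restrict W'] unfolding eq .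
  then have "D W' (restrict0 W' X) 0 2 (restrict0 W' G) p = DG W X p"
    using p by (simp add: restrict0_def)
  then show ?thesis by (simp add: correction_def[abs_def])
qed

lemma corrected_restrict:
  assumes T: "T \<in> tensor_fields B W k l" and W': "mopen (base B) W'" "W' \<subseteq> W"
  shows "corrected W' (restrict0 W' X) k l (restrict0 W' T) = restrict0 W' (corrected W X k l T)"
proof
  fix p
  show "corrected W' (restrict0 W' X) k l (restrict0 W' T) p = restrict0 W' (corrected W X k l T) p"
    unfolding corrected_def D_restrict[OF W X T W']
    using correction_restrict[OF W'] by (cases "p \<in> W'") (simp_all add: restrict0_def endo_act_zero)
qed

lemma corrected_prod:
  assumes T: "T \<in> tensor_fields B W k l" and S: "S \<in> tensor_fields B W k' l'"
  shows "corrected W X (k + k') (l + l') (tensor_prod k l T S) =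
    tensor_prod k l (corrected W X k l T) S + tensor_prod k l T (corrected W X k' l' S)"
proof (intro ext)
  fix p \<omega>s vs
  let ?E = "endo_act (fibre B p) (correction W X p)"
  have "?E (k + k') (l + l') (tensor_prod k l T S p) \<omega>s vs =
      ?E k l (T p) (take k \<omega>s) (take l vs) * S p (drop k \<omega>s) (drop l vs) +
      T p (take k \<omega>s) (take l vs) * ?E k' l' (S p) (drop k \<omega>s) (drop l vs)"
  proof (cases "p \<in> W")
    case True
    from endo_act_prod[OF tensor_fieldsD(1)[OF T True] tensor_fieldsD(1)[OF S True], of "correction W X p"]
    show ?thesis by (simp add: tensor_prod_def)
  next
    case False
    then have "T p = 0" "S p = 0" "tensor_prod k l T S p = 0"
      using tensor_fieldsD(2)[OF T] tensor_fieldsD(2)[OF S] by (auto simp: tensor_prod_def fun_eq_iff)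
    then show ?thesis by (simp add: endo_act_zero)
  qed
  then show "corrected W X (k + k') (l + l') (tensor_prod k l T S) p \<omega>s vs =
      (tensor_prod k l (corrected W X k l T) S + tensor_prod k l T (corrected W X k' l' S)) p \<omega>s vs"
    using D_prod[OF W X T S] by (simp add: corrected_def) (simp add: tensor_prod_def algebra_simps)
qed

lemma corrected_contraction:
  assumes T: "T \<in> tensor_fields B W k l" and ij: "i < k" "j < l"
  shows "corrected W X (k - 1) (l - 1) (contraction B i j T) = contraction B i j (corrected W X k l T)"
proof (intro ext)
  fix p \<omega>s vs
  define S where "S = (SOME S. independent S \<and> span S = fibre B p)"
  have c: "contraction B i j T' p \<omega>s vs = (\<Sum>b\<in>S. T' p (take i \<omega>s @ (\<lambda>v. representation S v b) # drop i \<omega>s)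
      (take j vs @ b # drop j vs))" for T' \<omega>s vs
    by (simp add: contraction_def S_def[symmetric] Let_def)
  have "endo_act (fibre B p) (correction W X p) (k - 1) (l - 1) (contraction B i j T p) \<omega>s vs =
      (\<Sum>b\<in>S. endo_act (fibre B p) (correction W X p) k l (T p)
        (take i \<omega>s @ (\<lambda>v. representation S v b) # drop i \<omega>s) (take j vs @ b # drop j vs))"
  proof (cases "p \<in> W")
    case True
    note pB = mopen_sub[OF W True]
    note Sb = fibre_basis[OF pB S_def]
    have kl: "Suc (k - 1) = k" "Suc (l - 1) = l" using ij by auto
    have "T p \<in> tensors (fibre B p) (Suc (k - 1)) (Suc (l - 1))"
      using tensor_fieldsD(1)[OF T True] unfolding kl .
    from endo_act_contraction[OF fibre_subspace[OF pB] correction_endomorphism[OF True] this Sb, of i j \<omega>s vs]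
    show ?thesis using ij unfolding kl c[abs_def] by simp
  next
    case False
    then have T0: "T p = 0" using tensor_fieldsD(2)[OF T] by simp
    have "contraction B i j T p = 0" by (intro ext) (simp add: c T0)
    then show ?thesis by (simp add: T0 endo_act_zero)
  qed
  then show "corrected W X (k - 1) (l - 1) (contraction B i j T) p \<omega>s vs =
      contraction B i j (corrected W X k l T) p \<omega>s vs"
    using D_contraction[OF W X T ij] by (simp add: corrected_def c sum.distrib)
qed

lemma corrected_combine:
  assumes T: "T \<in> tensor_fields B W k l" "T' \<in> tensor_fields B W k l"
  shows "corrected W X k l (c *\<^sub>R T + T') = c *\<^sub>R corrected W X k l T + corrected W X k l T'"
  by (rule ext)
     (simp add: corrected_def D_combine[OF W X T] scaleR_fun_apply endo_act_combine scaleR_add_right)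

lemma corrected_fun:
  assumes f: "smooth_fun (base B) W f"
  shows "corrected W X 0 0 (fun_tensor W f) = fun_tensor W (\<lambda>p. tderiv (base B) p (anch (X p)) f)"
  by (simp add: corrected_def D_fun[OF W X f] fun_eq_iff endo_act_def tensor_args_def)

text \<open>By uniqueness, \<open>half_raise\<close> is linear in the form, and the form is tensorial in \<open>X\<close>.\<close>

lemma corrected_combine_section:
  assumes T: "T \<in> tensor_fields B W k l" and X': "X' \<in> sections B W" and f: "smooth_fun (base B) W f"
  shows "corrected W (\<lambda>p. f p *\<^sub>R X p + X' p) k l T = (\<lambda>p. f p *\<^sub>R corrected W X k l T p + corrected W X' k l T p)"
proof
  fix p
  let ?X = "\<lambda>p. f p *\<^sub>R X p + X' p"
  have "endo_act (fibre B p) (correction W ?X p) k l (T p) =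
      f p *\<^sub>R endo_act (fibre B p) (correction W X p) k l (T p) + endo_act (fibre B p) (correction W X' p) k l (T p)"
  proof (cases "p \<in> W")
    case True
    note pB = mopen_sub[OF W True]
    obtain t :: "'i \<Rightarrow> 'a \<Rightarrow> 'w" where t: "basis_at t p (fibre B p)" using basis_ex[OF pB] by blast
    have D': "D W X' 0 2 (restrict0 W G) p \<in> tensors (fibre B p) 0 2"
      by (rule tensor_fieldsD(1)[OF D_field[OF W X' metric_restrict] True])
    have "correction W ?X p v = f p *\<^sub>R correction W X p v + correction W X' p v" for v
      unfolding correction_def D_combine_section[OF W X metric_restrict X' f]
      by (rule half_raise_combine[OF t metric_at[OF True] nondegenerate_at[OF True] D_metric_at[OF True] D'])
    moreover have "endomorphism_on (fibre B p) (correction W X' p)"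
      unfolding correction_def[abs_def]
      by (rule half_raise_endomorphism[OF t metric_at[OF True] nondegenerate_at[OF True] D'])
    ultimately show ?thesis
      by (intro endo_act_combine_endo fibre_subspace[OF pB] tensor_fieldsD(1)[OF T True]
          correction_endomorphism[OF True])
  next
    case False
    then show ?thesis using tensor_fieldsD(2)[OF T] by (simp add: endo_act_zero)
  qed
  then show "corrected W ?X k l T p = f p *\<^sub>R corrected W X k l T p + corrected W X' k l T p"
    by (simp add: corrected_def D_combine_section[OF W X T X' f] scaleR_add_right)
qed

text \<open>On a section the corrected derivative is \<open>D\<^sub>X Y + A\<^sub>X Y\<close>. The restriction only fixes the value off \<open>W\<close>, where
  \<open>correction\<close> carries no information.\<close>

lemma corrected_vec:
  assumes Y: "Y \<in> sections B W" and Y': "\<And>p. p \<in> W \<Longrightarrow> Y' p \<in> fibre B p"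
    and DY: "D W X 1 0 (vec_tensor B Y) = vec_tensor B Y'"
  shows "corrected W X 1 0 (vec_tensor B Y) =
    vec_tensor B (restrict0 W (\<lambda>p. Y' p + correction W X p (Y p)))"
proof (intro ext)
  fix p \<omega>s vs
  let ?Z = "restrict0 W (\<lambda>p. Y' p + correction W X p (Y p))"
  note vY = vec_tensor_field[OF W Y]
  have eq: "corrected W X 1 0 (vec_tensor B Y) p =
      vec_tensor B Y' p + endo_act (fibre B p) (correction W X p) 1 0 (vec_tensor B Y p)"
    by (simp only: corrected_def DY)
  show "corrected W X 1 0 (vec_tensor B Y) p \<omega>s vs = vec_tensor B ?Z p \<omega>s vs"
  proof (cases "p \<in> W \<and> (\<omega>s, vs) \<in> tensor_args (fibre B p) 1 0")
    case True
    then obtain \<omega> where w: "\<omega>s = [\<omega>]" "vs = []" "\<omega> \<in> dual_space (fibre B p)"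
      by (auto simp: tensor_args_def length_Suc_conv)
    have p: "p \<in> W" using True by simp
    have "\<omega> (Y' p + correction W X p (Y p)) = \<omega> (Y' p) + \<omega> (correction W X p (Y p))"
      by (rule linear_over_add[OF _ Y'[OF p] correction_in[OF p sectionsD(1)[OF Y p]]])
         (use w in \<open>simp add: dual_space_def\<close>)
    moreover have "\<omega> \<circ> correction W X p \<in> dual_space (fibre B p)"
      by (rule dual_space_comp[OF fibre_subspace[OF mopen_sub[OF W p]] correction_endomorphism[OF p] w(3)])
    ultimately show ?thesis
      using True w unfolding eq by (simp add: endo_act_def vec_tensor_def restrict0_def tensor_args_def)
  next
    case False
    then have "corrected W X 1 0 (vec_tensor B Y) p \<omega>s vs = 0"
      using tensor_fieldsD(1,2)[OF corrected_field[OF vY], of p] by (cases "p \<in> W") (simp_all add: tensors_iff)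
    moreover have "vec_tensor B ?Z p \<omega>s vs = 0"
      using False by (auto simp: vec_tensor_def restrict0_def tensor_args_def length_Suc_conv dual_0)
    ultimately show ?thesis by simp
  qed
qed

lemma correction_section:
  assumes Y: "Y \<in> sections B W" and Y': "Y' \<in> sections B W"
  shows "restrict0 W (\<lambda>p. Y' p + correction W X p (Y p)) \<in> sections B W"
  unfolding sections_def
proof (clarify, intro conjI allI ballI impI)
  let ?Z = "restrict0 W (\<lambda>p. Y' p + correction W X p (Y p))"
  show "?Z p \<in> fibre B p" if "p \<in> W" for p
    using that sectionsD(1)[OF Y'] correction_in[OF that sectionsD(1)[OF Y]] fibre_subspace[OF mopen_sub[OF W that]]
    by (simp add: restrict0_def subspace_add)
  show "?Z p = 0" if "p \<notin> W" for p using that by (simp add: restrict0_def)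
  fix c assume "c \<in> frames B"
  moreover obtain U t where c: "c = (U, t)" by force
  ultimately have f: "(U, t) \<in> frames B" by simp
  note UW = mopen_frame[OF f W]
  have "smooth_fun (base B) (U \<inter> W) (\<lambda>p. coframe t i p (?Z p))" for i
  proof (rule smooth_fun_cong_imp[OF UW _ charts])
    show "smooth_fun (base B) (U \<inter> W) (\<lambda>p. coframe t i p (Y' p) +
        (\<Sum>j\<in>UNIV. coframe t j p (Y p) * coframe t i p (correction W X p (t j p))))"
      by (intro smooth_fun_add smooth_fun_sum smooth_fun_mult UW sectionsD(3)[OF Y f] sectionsD(3)[OF Y' f]
          correction_smooth[OF f])
    fix p assume p: "p \<in> U \<inter> W"
    have b: "basis_at t p (fibre B p)" and pW: "p \<in> W" using p frame_basis[OF f] by auto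
    note V = fibre_subspace[OF mopen_sub[OF W pW]]
    note d = coframe_dual[OF b, of i]
    have "(coframe t i p \<circ> correction W X p) (\<Sum>j\<in>UNIV. coframe t j p (Y p) *\<^sub>R t j p) =
        (\<Sum>j\<in>UNIV. coframe t j p (Y p) * (coframe t i p \<circ> correction W X p) (t j p))"
      by (rule dual_space_sum[OF dual_space_comp[OF V correction_endomorphism[OF pW] d] V basis_at_in[OF b]])
    then have "coframe t i p (correction W X p (Y p)) =
        (\<Sum>j\<in>UNIV. coframe t j p (Y p) * coframe t i p (correction W X p (t j p)))"
      unfolding coframe_expand[OF b sectionsD(1)[OF Y pW]] by simp
    moreover have "coframe t i p (Y' p + correction W X p (Y p)) =
        coframe t i p (Y' p) + coframe t i p (correction W X p (Y p))"
      by (rule linear_over_add[OF _ sectionsD(1)[OF Y' pW] correction_in[OF pW sectionsD(1)[OF Y pW]]])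
         (use d in \<open>simp add: dual_space_def\<close>)
    ultimately show "coframe t i p (Y' p) +
        (\<Sum>j\<in>UNIV. coframe t j p (Y p) * coframe t i p (correction W X p (t j p))) = coframe t i p (?Z p)"
      using pW by (simp add: restrict0_def)
  qed
  then show "case c of (U, t) \<Rightarrow> \<forall>i. smooth_fun (base B) (U \<inter> W) (\<lambda>p. coframe t i p (?Z p))"
    by (simp add: c)
qed

text \<open>Each of the two slots of \<open>G\<close> contributes half of the covariant derivative of \<open>G\<close>, the second one by
  symmetry.\<close>

lemma corrected_metric:
  assumes G: "\<And>p v w. p \<in> W \<Longrightarrow> v \<in> fibre B p \<Longrightarrow> w \<in> fibre B p \<Longrightarrow> G p [] [v, w] = G p [] [w, v]"
    and DG: "\<And>p v w. p \<in> W \<Longrightarrow> v \<in> fibre B p \<Longrightarrow> w \<in> fibre B p \<Longrightarrow>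
      DG W X p [] [v, w] = DG W X p [] [w, v]"
  shows "corrected W X 0 2 (restrict0 W G) = 0"
proof (intro ext)
  fix p \<omega>s vs
  note cf = corrected_field[OF metric_restrict]
  show "corrected W X 0 2 (restrict0 W G) p \<omega>s vs = 0 p \<omega>s vs"
  proof (cases "p \<in> W \<and> (\<omega>s, vs) \<in> tensor_args (fibre B p) 0 2")
    case True
    then obtain v w where a: "\<omega>s = []" "vs = [v, w]" "v \<in> fibre B p" "w \<in> fibre B p"
      by (auto simp: tensor_args_def length_Suc_conv numeral_2_eq_2)
    have p: "p \<in> W" using True by simp
    have "G p [] [v, correction W X p w] = DG W X p [] [v, w] / 2"
      using G[OF p a(3) correction_in[OF p a(4)]] correction_eq[OF p a(4,3)] DG[OF p a(3,4)] by simp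
    then show ?thesis
      using correction_eq[OF p a(3,4)] True p a
      by (simp add: corrected_def endo_act_def restrict0_def)
  next
    case False
    then show ?thesis
      using tensor_fieldsD(1,2)[OF cf, of p] by (cases "p \<in> W") (auto simp: tensors_iff)
  qed
qed

end

lemma corrected_covariant: "covariant_derivative B anch corrected"
  unfolding covariant_derivative_def
  using corrected_field corrected_restrict corrected_combine corrected_combine_section corrected_prod
    corrected_contraction corrected_fun
  by (intro conjI allI impI; (elim conjE)?) blast+

end

section \<open>Smooth maps and total spaces\<close>

lemma smooth_manifold_charts:
  assumes "smooth_manifold X"
  shows "inj_charts X" and "(U, \<phi>) \<in> atlas X \<Longrightarrow> mopen X U" and "p \<in> pts X \<Longrightarrow> \<exists>U \<phi>. (U, \<phi>) \<in> atlas X \<and> p \<in> U"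
proof -
  show "inj_charts X" using assms by (auto simp: smooth_manifold_def inj_charts_def)
  have cov: "(\<Union>(U, \<phi>)\<in>atlas X. U) = pts X" using assms by (simp add: smooth_manifold_def)
  show "\<exists>U \<phi>. (U, \<phi>) \<in> atlas X \<and> p \<in> U" if "p \<in> pts X"
    using that unfolding cov[symmetric] by auto
  show "mopen X U" if "(U, \<phi>) \<in> atlas X"
    unfolding mopen_def
  proof (intro conjI ballI)
    show "U \<subseteq> pts X" using that cov by auto
    fix c assume "c \<in> atlas X"
    then show "case c of (U', \<phi>') \<Rightarrow> open (\<phi>' ` (U' \<inter> U))"
      using assms that unfolding smooth_manifold_def by (cases c) fastforce
  qed
qed

text \<open>Smooth maps are defined by charts only, so continuity has to be recovered: near a point the set is a
  preimage, in coordinates, of an open set under a continuous map.\<close>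

lemma smooth_map_vimage_open:
  assumes X: "smooth_manifold X" and Y: "smooth_manifold Y" and f: "smooth_map X Y f" and V: "mopen Y V"
  shows "mopen X (pts X \<inter> f -` V)"
  unfolding mopen_def
proof (intro conjI ballI)
  fix c assume "c \<in> atlas X"
  moreover obtain U \<phi> where c: "c = (U, \<phi>)" by force
  ultimately have U: "(U, \<phi>) \<in> atlas X" by simp
  have UX: "U \<subseteq> pts X" using smooth_manifold_charts(2)[OF X U] by (simp add: mopen_def)
  have inj: "inj_on \<phi> U" using smooth_manifold_charts(1)[OF X] U by (auto simp: inj_charts_def)
  have "open (\<phi> ` (U \<inter> (pts X \<inter> f -` V)))"
  proof (subst open_subopen, intro ballI)
    fix x assume "x \<in> \<phi> ` (U \<inter> (pts X \<inter> f -` V))"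
    then obtain p where p: "x = \<phi> p" "p \<in> U" "f p \<in> V" by auto
    have "f p \<in> pts Y" using V p by (auto simp: mopen_def)
    then obtain V' \<psi> where V': "(V', \<psi>) \<in> atlas Y" "f p \<in> V'" using smooth_manifold_charts(3)[OF Y] by blast
    have injV: "inj_on \<psi> V'" using smooth_manifold_charts(1)[OF Y] V' by (auto simp: inj_charts_def)
    define Q where "Q = \<phi> ` (U \<inter> f -` V')"
    define g where "g = \<psi> \<circ> f \<circ> inv_into U \<phi>"
    have "open Q" "smooth_on g Q"
      using f U V' unfolding smooth_map_def Q_def g_def by fast+
    then have "continuous_on Q g" by (auto simp: smooth_on_def dest: spec[of _ 0])
    moreover have "open (\<psi> ` (V' \<inter> V))" using V V' by (auto simp: mopen_def)
    ultimately have "open (Q \<inter> g -` (\<psi> ` (V' \<inter> V)))"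
      using continuous_open_preimage[of Q g] \<open>open Q\<close> by blast
    moreover have "x \<in> Q \<inter> g -` (\<psi> ` (V' \<inter> V))"
      using p V' inj by (auto simp: Q_def g_def)
    moreover have "Q \<inter> g -` (\<psi> ` (V' \<inter> V)) \<subseteq> \<phi> ` (U \<inter> (pts X \<inter> f -` V))"
    proof
      fix y assume "y \<in> Q \<inter> g -` (\<psi> ` (V' \<inter> V))"
      then obtain q r where q: "q \<in> U" "f q \<in> V'" "y = \<phi> q" "r \<in> V'" "r \<in> V" "\<psi> (f q) = \<psi> r"
        using inj by (auto simp: Q_def g_def)
      then have "f q = r" by (intro inj_onD[OF injV])
      then show "y \<in> \<phi> ` (U \<inter> (pts X \<inter> f -` V))" using q UX by auto
    qed
    ultimately show "\<exists>T. open T \<and> x \<in> T \<and> T \<subseteq> \<phi> ` (U \<inter> (pts X \<inter> f -` V))" by blast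
  qed
  then show "case c of (U, \<phi>) \<Rightarrow> open (\<phi> ` (U \<inter> (pts X \<inter> f -` V)))" by (simp add: c)
qed auto

lemma smooth_fun_pullback:
  assumes X: "smooth_manifold X" and Y: "smooth_manifold Y" and h: "smooth_map X Y h"
    and V: "mopen Y V" and f: "smooth_fun Y V f"
  shows "smooth_fun X (pts X \<inter> h -` V) (\<lambda>x. f (h x))"
proof (rule smooth_fun_local[OF smooth_manifold_charts(1)[OF X]])
  fix p assume p: "p \<in> pts X \<inter> h -` V"
  then have "h p \<in> pts Y" using V by (auto simp: mopen_def)
  then obtain V' \<psi> where V': "(V', \<psi>) \<in> atlas Y" "h p \<in> V'" using smooth_manifold_charts(3)[OF Y] by blast
  have injV: "inj_on \<psi> V'" using smooth_manifold_charts(1)[OF Y] V' by (auto simp: inj_charts_def)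
  define W' where "W' = pts X \<inter> h -` (V' \<inter> V)"
  have W'open: "mopen X W'"
    unfolding W'_def
    by (rule smooth_map_vimage_open[OF X Y h mopen_Int[OF smooth_manifold_charts(1)[OF Y]
          smooth_manifold_charts(2)[OF Y V'(1)] V]])
  have "smooth_fun X W' (\<lambda>x. f (h x))"
    unfolding smooth_fun_def smooth_on_def
  proof (intro ballI, clarify)
    fix U \<phi> k assume U: "(U, \<phi>) \<in> atlas X"
    have inj: "inj_on \<phi> U" using smooth_manifold_charts(1)[OF X] U by (auto simp: inj_charts_def)
    have op: "open (\<phi> ` (U \<inter> W'))" using W'open U by (auto simp: mopen_def)
    have "smooth_on (\<psi> \<circ> h \<circ> inv_into U \<phi>) (\<phi> ` (U \<inter> h -` V'))"
      using h U V' unfolding smooth_map_def by fast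
    then have g: "Ck_on k (\<psi> \<circ> h \<circ> inv_into U \<phi>) (\<phi> ` (U \<inter> W'))"
      unfolding smooth_on_def by (elim allE[of _ k] Ck_on_subset) (auto simp: W'_def)
    have f': "Ck_on k (f \<circ> inv_into V' \<psi>) (\<psi> ` (V' \<inter> V))"
      using f V' by (auto simp: smooth_fun_def smooth_on_def)
    have "(\<psi> \<circ> h \<circ> inv_into U \<phi>) ` \<phi> ` (U \<inter> W') \<subseteq> \<psi> ` (V' \<inter> V)"
    proof clarify
      fix q assume "q \<in> U" "q \<in> W'"
      then show "(\<psi> \<circ> h \<circ> inv_into U \<phi>) (\<phi> q) \<in> \<psi> ` (V' \<inter> V)"
        by (simp add: inv_into_f_f[OF inj] W'_def)
    qed
    then have c: "Ck_on k (\<lambda>x. (f \<circ> inv_into V' \<psi>) ((\<psi> \<circ> h \<circ> inv_into U \<phi>) x)) (\<phi> ` (U \<inter> W'))"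
      by (rule Ck_on_compose[OF op f' g])
    show "Ck_on k ((\<lambda>x. f (h x)) \<circ> inv_into U \<phi>) (\<phi> ` (U \<inter> W'))"
    proof (rule Ck_on_cong_imp[OF op _ c])
      fix x assume "x \<in> \<phi> ` (U \<inter> W')"
      then obtain q where "q \<in> U" "q \<in> W'" "x = \<phi> q" by blast
      then show "(f \<circ> inv_into V' \<psi>) ((\<psi> \<circ> h \<circ> inv_into U \<phi>) x) = ((\<lambda>x. f (h x)) \<circ> inv_into U \<phi>) x"
        by (simp add: inv_into_f_f[OF inj] inv_into_f_f[OF injV] W'_def)
    qed
  qed
  moreover have "p \<in> W'" using p V' by (simp add: W'_def)
  ultimately show "\<exists>W'. p \<in> W' \<and> mopen X W' \<and> smooth_fun X W' (\<lambda>x. f (h x))"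
    using W'open by blast
qed

lemma vector_bundleD:
  assumes "vector_bundle E"
  shows "smooth_manifold (base E)" "(U, t) \<in> frames E \<Longrightarrow> mopen (base E) U"
    "(U, t) \<in> frames E \<Longrightarrow> p \<in> U \<Longrightarrow> basis_at t p (fibre E p)"
    "(U, t) \<in> frames E \<Longrightarrow> (V, s) \<in> frames E \<Longrightarrow> smooth_fun (base E) (U \<inter> V) (\<lambda>p. coframe s j p (t i p))"
    "p \<in> pts (base E) \<Longrightarrow> \<exists>U t. (U, t) \<in> frames E \<and> p \<in> U"
proof -
  note vb = assms[unfolded vector_bundle_def]
  note A = conjunct1[OF vb]
    and B = conjunct1[OF conjunct2[OF vb]]
    and C = conjunct1[OF conjunct2[OF conjunct2[OF vb]]]
    and D = conjunct2[OF conjunct2[OF conjunct2[OF vb]]]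
  show "smooth_manifold (base E)" by (rule A)
  show "\<exists>U t. (U, t) \<in> frames E \<and> p \<in> U" if "p \<in> pts (base E)"
    using that unfolding B[symmetric] by auto
  show "mopen (base E) U" if "(U, t) \<in> frames E"
    using bspec[OF C that] by simp
  show "basis_at t p (fibre E p)" if "(U, t) \<in> frames E" "p \<in> U"
    using bspec[OF C that(1)] that(2) by (simp add: basis_at_def)
  show "smooth_fun (base E) (U \<inter> V) (\<lambda>p. coframe s j p (t i p))" if "(U, t) \<in> frames E" "(V, s) \<in> frames E"
    using bspec[OF D that(1)] that(2) by auto
qed

text \<open>All domains of charts and of local data have this form.\<close>

definition over :: "('a, 'v, 'e, 'r) vbundle \<Rightarrow> 'a set \<Rightarrow> ('a \<times> 'e) set" where
  "over E A = {(x, v). x \<in> A \<and> v \<in> fibre E x}"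

context
  fixes E :: "('a, real^'d, 'e::real_vector, 'r::finite) vbundle"
  assumes E: "vector_bundle E"
begin

lemma total_space_atlas:
  "k \<in> atlas (total_space E) \<longleftrightarrow>
     (\<exists>U \<phi> V s. (U, \<phi>) \<in> atlas (base E) \<and> (V, s) \<in> frames E \<and> k = vb_chart E (U, \<phi>) (V, s))"
  by (auto simp: total_space_def)

lemma vb_chart_dom: "fst (vb_chart E (U, \<phi>) (V, s)) = over E (U \<inter> V)"
  by (auto simp: vb_chart_def over_def)

lemma vb_chart_apply:
  "snd (vb_chart E (U, \<phi>) (V, s)) e = (\<phi> (fst e), \<chi> a. coframe s a (fst e) (snd e))"
  by (simp add: vb_chart_def split: prod.splits)

lemma vb_chart_inj:
  assumes "(U, \<phi>) \<in> atlas (base E)" "(V, s) \<in> frames E"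
  shows "inj_on (snd (vb_chart E (U, \<phi>) (V, s))) (over E (U \<inter> V))"
proof (rule inj_onI)
  fix e e' assume e: "e \<in> over E (U \<inter> V)" "e' \<in> over E (U \<inter> V)"
    and eq: "snd (vb_chart E (U, \<phi>) (V, s)) e = snd (vb_chart E (U, \<phi>) (V, s)) e'"
  obtain x v x' v' where [simp]: "e = (x, v)" "e' = (x', v')" by (cases e, cases e')
  have inj: "inj_on \<phi> U"
    using smooth_manifold_charts(1)[OF vector_bundleD(1)[OF E]] assms by (auto simp: inj_charts_def)
  have "x = x'"
    by (rule inj_onD[OF inj]) (use eq e in \<open>simp_all add: vb_chart_apply over_def\<close>)
  then have x: "x \<in> V" "v \<in> fibre E x" "v' \<in> fibre E x" "\<And>a. coframe s a x v = coframe s a x v'"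
    using eq e by (simp_all add: vb_chart_apply vec_eq_iff over_def)
  note bs = vector_bundleD(3)[OF E assms(2) x(1)]
  have "v = (\<Sum>a\<in>UNIV. coframe s a x v *\<^sub>R s a x)" by (rule coframe_expand[OF bs x(2), symmetric])
  also have "\<dots> = v'" unfolding x(4) by (rule coframe_expand[OF bs x(3)])
  finally show "e = e'" using \<open>x = x'\<close> by simp
qed

lemma total_space_inj_charts: "inj_charts (total_space E)"
  unfolding inj_charts_def
proof
  fix k assume "k \<in> atlas (total_space E)"
  then obtain U \<phi> V s where k: "(U, \<phi>) \<in> atlas (base E)" "(V, s) \<in> frames E" "k = vb_chart E (U, \<phi>) (V, s)"
    unfolding total_space_atlas by blast
  then show "case k of (U, \<phi>) \<Rightarrow> inj_on \<phi> U"
    using vb_chart_inj[OF k(1,2)] vb_chart_dom[of U \<phi> V s] by (simp add: case_prod_unfold)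
qed

text \<open>Every coordinate vector occurs, because a frame spans the fibre; hence the image is a product and
  openness reduces to the base.\<close>

lemma vb_chart_image:
  assumes "(U, \<phi>) \<in> atlas (base E)" "(V, s) \<in> frames E"
  shows "snd (vb_chart E (U, \<phi>) (V, s)) ` (over E (U \<inter> V) \<inter> over E A) = (\<phi> ` (U \<inter> (V \<inter> A))) \<times> UNIV"
proof (intro equalityI subsetI)
  fix y assume "y \<in> \<phi> ` (U \<inter> (V \<inter> A)) \<times> (UNIV :: (real^'r) set)"
  then obtain x w where x: "x \<in> U" "x \<in> V" "x \<in> A" and [simp]: "y = (\<phi> x, w)" by auto
  have b: "basis_at s x (fibre E x)" by (rule vector_bundleD(3)[OF E assms(2) x(2)])
  let ?v = "\<Sum>a\<in>UNIV. (w $ a) *\<^sub>R s a x"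
  have "snd (vb_chart E (U, \<phi>) (V, s)) (x, ?v) = y"
    by (simp add: vb_chart_apply coframe_sum[OF b])
  then show "y \<in> snd (vb_chart E (U, \<phi>) (V, s)) ` (over E (U \<inter> V) \<inter> over E A)"
    using x basis_at_sum_in[OF b] by (intro image_eqI[of _ _ "(x, ?v)"]) (auto simp: over_def)
qed (auto simp: over_def vb_chart_apply)

lemma mopen_over:
  assumes "mopen (base E) A" shows "mopen (total_space E) (over E A)"
  unfolding mopen_def
proof (intro conjI ballI)
  show "over E A \<subseteq> pts (total_space E)"
    using assms by (auto simp: over_def total_space_def mopen_def)
  fix k assume "k \<in> atlas (total_space E)"
  then obtain U \<phi> V s where k: "(U, \<phi>) \<in> atlas (base E)" "(V, s) \<in> frames E" "k = vb_chart E (U, \<phi>) (V, s)"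
    unfolding total_space_atlas by blast
  have "mopen (base E) (V \<inter> A)"
    by (rule mopen_Int[OF smooth_manifold_charts(1)[OF vector_bundleD(1)[OF E]] vector_bundleD(2)[OF E k(2)] assms])
  then have "open (\<phi> ` (U \<inter> (V \<inter> A)))" using k by (auto simp: mopen_def)
  then show "case k of (U, \<phi>) \<Rightarrow> open (\<phi> ` (U \<inter> over E A))"
    unfolding case_prod_unfold k(3) vb_chart_dom vb_chart_image[OF k(1,2)] by (intro open_Times open_UNIV)
qed

lemma smooth_fun_over:
  assumes A: "mopen (base E) A" and f: "smooth_fun (base E) A f"
  shows "smooth_fun (total_space E) (over E A) (\<lambda>e. f (fst e))"
  unfolding smooth_fun_def smooth_on_def
proof (intro ballI)
  fix k assume "k \<in> atlas (total_space E)"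
  then obtain U \<phi> V s where k: "(U, \<phi>) \<in> atlas (base E)" "(V, s) \<in> frames E" "k = vb_chart E (U, \<phi>) (V, s)"
    unfolding total_space_atlas by blast
  let ?\<psi> = "snd (vb_chart E (U, \<phi>) (V, s))"
  have inj: "inj_on \<phi> U"
    using smooth_manifold_charts(1)[OF vector_bundleD(1)[OF E]] k by (auto simp: inj_charts_def)
  have op: "open (?\<psi> ` (over E (U \<inter> V) \<inter> over E A))"
    using mopen_over[OF A] \<open>k \<in> atlas (total_space E)\<close>
    by (auto simp: mopen_def case_prod_unfold k(3) vb_chart_dom)
  have "Ck_on n ((\<lambda>e. f (fst e)) \<circ> inv_into (over E (U \<inter> V)) ?\<psi>) (?\<psi> ` (over E (U \<inter> V) \<inter> over E A))" for n
  proof (rule Ck_on_cong_imp[OF op])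
    have f': "Ck_on n (f \<circ> inv_into U \<phi>) (\<phi> ` (U \<inter> A))"
      using f k by (auto simp: smooth_fun_def smooth_on_def)
    show "Ck_on n (\<lambda>y. (f \<circ> inv_into U \<phi>) (fst y)) (?\<psi> ` (over E (U \<inter> V) \<inter> over E A))"
      by (rule Ck_on_compose[OF op f' Ck_on_linear[OF bounded_linear_fst op]])
         (auto simp: vb_chart_apply over_def)
    fix y assume "y \<in> ?\<psi> ` (over E (U \<inter> V) \<inter> over E A)"
    then obtain e where e: "e \<in> over E (U \<inter> V)" "y = ?\<psi> e" by auto
    then show "(f \<circ> inv_into U \<phi>) (fst y) = ((\<lambda>e. f (fst e)) \<circ> inv_into (over E (U \<inter> V)) ?\<psi>) y"
      using inj inv_into_f_f[OF vb_chart_inj[OF k(1,2)] e(1)]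
      by (auto simp: vb_chart_apply over_def)
  qed
  then show "case k of (U, \<phi>) \<Rightarrow> \<forall>n. Ck_on n ((\<lambda>e. f (fst e)) \<circ> inv_into U \<phi>) (\<phi> ` (U \<inter> over E A))"
    by (simp add: case_prod_unfold k(3) vb_chart_dom)
qed

end

section \<open>Frames of the generalized tangent bundle\<close>

lemma sum_sum_type:
  "(\<Sum>k\<in>(UNIV :: ('p::finite + 'r::finite) set). f k) = (\<Sum>\<alpha>\<in>UNIV. f (Inl \<alpha>)) + (\<Sum>a\<in>UNIV. f (Inr a))"
  unfolding UNIV_Plus_UNIV[symmetric] by (subst sum.Plus) auto

lemma invertible_kernel:
  fixes g :: "'i::finite \<Rightarrow> 'i \<Rightarrow> 'a \<Rightarrow> real"
  assumes "invertible (metric_matrix g e)" "\<And>j. (\<Sum>i\<in>UNIV. c i * g i j e) = 0"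
  shows "c i = 0"
proof -
  let ?A = "transpose (metric_matrix g e)"
  have "?A *v (\<chi> i. c i) = 0"
    using assms(2) by (simp add: vec_eq_iff matrix_vector_mult_def transpose_def metric_matrix_def mult.commute)
  moreover have "invertible ?A" using assms(1) by (rule transpose_invertible)
  ultimately have "(\<chi> i. c i) = 0"
    unfolding invertible_left_inverse matrix_left_invertible_ker by blast
  then show ?thesis by (simp add: vec_eq_iff)
qed

text \<open>The data of the theorem except for the given connection on the generalized tangent bundle.\<close>

locale generalized_tangent =
  fixes L :: "('m, 'n, 'f::real_vector, 'd::finite, 'p::finite) gla"
    and E :: "('m, real^'d, 'e::real_vector, 'r::finite) vbundle"
    and C :: "'m \<times> 'e \<Rightarrow> ('m, 'e, 'f, 'd, 'r) gvec \<Rightarrow> ('m, 'e, 'f, 'd, 'r) gvec"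
    and G :: "'m \<times> 'e \<Rightarrow> ('m, 'e, 'f, 'd, 'r) gvec tensor"
  assumes gla: "generalized_lie_algebroid L"
    and E: "vector_bundle E" and base: "base E = src L"
    and conn: "rho_eta_connection L E C"
    and metr: "pseudometrical_structure L E C G"
begin

abbreviation "TE \<equiv> total_space E"
abbreviation "B \<equiv> gtb L E"
abbreviation "nf \<equiv> nat_frame L E"
abbreviation "af \<equiv> adapted_frame L E C"
abbreviation "ld \<equiv> loc_dom L E"
abbreviation "gh \<equiv> metric_h L E C G"
abbreviation "gv \<equiv> metric_v L E C G"
abbreviation "vert \<equiv> fibre (vertical_bundle L E)"
abbreviation "vf b \<equiv> \<lambda>a. nat_frame L E b (Inr a)"

lemma gtb_simps [simp]: "base B = TE" "frames B = (\<lambda>b. (ld b, nf b)) ` locs L E"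
  by (simp_all add: gtb_def)

lemma bun_bundle: "vector_bundle (bun L)" and hmap_smooth: "smooth_map (src L) (base (bun L)) (hmap L)"
  using gla by (auto simp: generalized_lie_algebroid_def Let_def diffeomorphism_def)

lemma src_manifold: "smooth_manifold (src L)" using vector_bundleD(1)[OF E] by (simp add: base)

lemma TE_charts: "inj_charts TE" by (rule total_space_inj_charts[OF E])

lemma loc_dom_over:
  assumes "(c, s, t) \<in> locs L E"
  shows "ld (c, s, t) = over E (fst c \<inter> (fst s \<inter> (pts (src L) \<inter> hmap L -` fst t)))"
proof -
  have "fst s \<subseteq> pts (src L)"
    using vector_bundleD(2)[OF E, of "fst s" "snd s"] assms by (auto simp: locs_def mopen_def base)
  then show ?thesis by (auto simp: loc_dom_def over_def)
qed

lemma dom_open: assumes "b \<in> locs L E" shows "mopen TE (ld b)"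
proof -
  obtain c s t where [simp]: "b = (c, s, t)" by (cases b)
  have b: "(fst c, snd c) \<in> atlas (src L)" "(fst s, snd s) \<in> frames E" "(fst t, snd t) \<in> frames (bun L)"
    using assms by (auto simp: locs_def)
  note inj = smooth_manifold_charts(1)[OF src_manifold]
  have "mopen (src L) (fst c \<inter> (fst s \<inter> (pts (src L) \<inter> hmap L -` fst t)))"
    using vector_bundleD(2)[OF E b(2)] unfolding base
    by (intro mopen_Int inj smooth_manifold_charts(2)[OF src_manifold b(1)]
        smooth_map_vimage_open[OF src_manifold vector_bundleD(1)[OF bun_bundle] hmap_smooth] vector_bundleD(2)[OF bun_bundle b(3)])
  then show ?thesis
    using loc_dom_over[of c s t] assms mopen_over[OF E] by (simp add: base)
qed

lemma dom_cover: assumes "e \<in> pts TE" shows "\<exists>b\<in>locs L E. e \<in> ld b"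
proof -
  obtain x v where e: "e = (x, v)" "x \<in> pts (src L)" "v \<in> fibre E x"
    using assms by (auto simp: total_space_def base)
  obtain U \<phi> where 1: "(U, \<phi>) \<in> atlas (src L)" "x \<in> U" using smooth_manifold_charts(3)[OF src_manifold e(2)] by blast
  obtain V s where 2: "(V, s) \<in> frames E" "x \<in> V" using vector_bundleD(5)[OF E] e(2) base by metis
  have "hmap L x \<in> pts (base (bun L))" using hmap_smooth e(2) by (auto simp: smooth_map_def)
  then obtain W t where 3: "(W, t) \<in> frames (bun L)" "hmap L x \<in> W" using vector_bundleD(5)[OF bun_bundle] by metis
  show ?thesis
    using 1 2 3 e by (intro bexI[of _ "((U, \<phi>), (V, s), (W, t))"]) (auto simp: locs_def loc_dom_def)
qed

lemma fst_nf [simp]: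
  "fst (nf b (Inl \<alpha>) e) = snd (snd (snd b)) \<alpha> (hmap L (fst e))" "fst (nf b (Inr a) e) = 0"
  by (cases b; cases e; simp add: nat_frame_def Let_def)+

lemma F_basis:
  assumes "b \<in> locs L E" "e \<in> ld b"
  shows "basis_at (snd (snd (snd b))) (hmap L (fst e)) (fibre (bun L) (hmap L (fst e)))"
proof -
  have "(fst (snd (snd b)), snd (snd (snd b))) \<in> frames (bun L)" "hmap L (fst e) \<in> fst (snd (snd b))"
    using assms by (auto simp: locs_def loc_dom_def)
  then show ?thesis by (rule vector_bundleD(3)[OF bun_bundle])
qed

lemma af_simps [simp]:
  "af b (Inr a) e = nf b (Inr a) e"
  "af b (Inl \<alpha>) e = nf b (Inl \<alpha>) e - (\<Sum>a\<in>UNIV. conn_coeff L E C b a \<alpha> e *\<^sub>R nf b (Inr a) e)"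
  by (simp_all add: adapted_frame_def)

lemma fst_af: "fst (af b (Inl \<alpha>) e) = snd (snd (snd b)) \<alpha> (hmap L (fst e))"
  by (simp add: fst_sum)

lemma nat_span_sub: "b \<in> locs L E \<Longrightarrow> e \<in> ld b \<Longrightarrow> span (range (\<lambda>k. nf b k e)) \<subseteq> fibre B e"
  by (auto simp: gtb_def)

lemma af_in_nat_span: "af b k e \<in> span (range (\<lambda>k. nf b k e))"
  by (cases k) (auto intro!: span_diff span_sum span_scale intro: span_base)

lemma nf_in_af_span: "nf b k e \<in> span (range (\<lambda>k. af b k e))"
proof (cases k)
  case (Inl \<alpha>)
  have "nf b k e = af b (Inl \<alpha>) e + (\<Sum>a\<in>UNIV. conn_coeff L E C b a \<alpha> e *\<^sub>R af b (Inr a) e)"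
    by (simp add: Inl)
  also have "\<dots> \<in> span (range (\<lambda>k. af b k e))"
    by (intro span_add span_sum span_scale) (auto intro: span_base simp del: af_simps)
  finally show ?thesis .
next
  case (Inr a)
  then have "nf b k e = af b (Inr a) e" by simp
  then show ?thesis by (auto intro: span_base simp del: af_simps)
qed

lemma af_span: "span (range (\<lambda>k. af b k e)) = span (range (\<lambda>k. nf b k e))"
  by (intro span_eq[THEN iffD2] conjI) (use af_in_nat_span nf_in_af_span in blast)+

context
  fixes b e assumes b: "b \<in> locs L E" and e: "e \<in> ld b"
begin

lemma e_pts: "e \<in> pts TE"
  using dom_open[OF b] e by (auto simp: mopen_def)

lemma G_tensor: "G e \<in> tensors (fibre B e) 0 2"
  using metr e_pts by (auto simp: pseudometrical_structure_def tensor_fields_def)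

lemma metr_at:
  shows "v \<in> fibre B e \<Longrightarrow> w \<in> fibre B e \<Longrightarrow> G e [] [v, w] =
      (\<Sum>\<alpha>\<in>UNIV. \<Sum>\<beta>\<in>UNIV. gh b \<alpha> \<beta> e * coframe (af b) (Inl \<alpha>) e v * coframe (af b) (Inl \<beta>) e w) +
      (\<Sum>a\<in>UNIV. \<Sum>a'\<in>UNIV. gv b a a' e * coframe (af b) (Inr a) e v * coframe (af b) (Inr a') e w)"
    and "gh b \<alpha> \<beta> e = gh b \<beta> \<alpha> e" "gv b a a' e = gv b a' a e"
    and "invertible (metric_matrix (gh b) e)" "invertible (metric_matrix (gv b) e)"
  using metr b e unfolding pseudometrical_structure_def Let_def by blast+

text \<open>The nondegenerate vertical block of \<open>G\<close> forces linear independence: a vanishing combination of the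
  vertical vectors pairs to \<open>0\<close> with each of them, so its coefficients lie in the kernel of the Gram matrix.\<close>

lemma vertical_independent:
  assumes "(\<Sum>a\<in>UNIV. c a *\<^sub>R nf b (Inr a) e) = 0" shows "c a = 0"
proof (rule invertible_kernel[OF metr_at(5)])
  fix a'
  let ?S = "span (range (\<lambda>k. nf b k e))"
  have "linear_over ?S (\<lambda>u. G e [] [u, nf b (Inr a') e])"
    using nat_span_sub[OF b e] G_tensor
    by (intro linear_over_mono[OF tensors02_linear(1)[OF G_tensor]]) (auto intro: span_base)
  from linear_over_sum[OF this subspace_span, of UNIV "\<lambda>a. nf b (Inr a) e" c]
    linear_over_zero[OF this span_0] assms
  show "(\<Sum>a\<in>UNIV. c a * gv b a a' e) = 0"
    by (simp add: metric_v_def span_base)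
qed

text \<open>For both the natural and the adapted frame. The components in \<open>F\<close> of the nonvertical vectors form a
  frame of \<open>F\<close>, which eliminates their coefficients; the vertical vectors are independent.\<close>

lemma frame_independent:
  assumes "(\<Sum>k\<in>UNIV. c k *\<^sub>R u k) = 0"
    and "\<And>\<alpha>. fst (u (Inl \<alpha>)) = snd (snd (snd b)) \<alpha> (hmap L (fst e))" "\<And>a. u (Inr a) = nf b (Inr a) e"
  shows "c k = 0"
proof -
  note Fb = F_basis[OF b e]
  have s: "(\<Sum>\<alpha>\<in>UNIV. c (Inl \<alpha>) *\<^sub>R u (Inl \<alpha>)) + (\<Sum>a\<in>UNIV. c (Inr a) *\<^sub>R nf b (Inr a) e) = 0"
    using assms(1,3) by (simp add: sum_sum_type)
  \<comment> \<open>Projecting to \<open>F\<close> removes the vertical part.\<close>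
  from arg_cong[OF this, of fst] have
    z: "(\<Sum>\<alpha>\<in>UNIV. c (Inl \<alpha>) *\<^sub>R snd (snd (snd b)) \<alpha> (hmap L (fst e))) = 0"
    by (simp add: fst_sum assms(2))
  have "c (Inl \<alpha>) = 0" for \<alpha>
  proof -
    have "c (Inl \<alpha>) = coframe (snd (snd (snd b))) \<alpha> (hmap L (fst e)) 0"
      unfolding z[symmetric] by (rule coframe_sum[OF Fb, symmetric])
    also have "\<dots> = coframe (snd (snd (snd b))) \<alpha> (hmap L (fst e)) (\<Sum>j\<in>UNIV. 0 *\<^sub>R snd (snd (snd b)) j (hmap L (fst e)))"
      by simp
    also have "\<dots> = 0" by (rule coframe_sum[OF Fb])
    finally show ?thesis .
  qed
  then show ?thesis
    using vertical_independent[of "\<lambda>a. c (Inr a)"] s by (cases k) auto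
qed

lemma nf_basis_span: "basis_at (nf b) e (span (range (\<lambda>k. nf b k e)))"
  by (rule basis_atI[OF _ refl]) (auto intro: frame_independent)

lemma af_basis_span: "basis_at (af b) e (span (range (\<lambda>k. nf b k e)))"
  by (rule basis_atI[where t = "af b" and p = e, OF _ af_span]) (auto intro!: frame_independent simp: fst_af simp del: af_simps(2))

text \<open>The coordinates of \<open>v\<close> lie in the kernels of the two invertible blocks of \<open>G\<close>.\<close>

lemma metr_kernel:
  assumes v: "v \<in> span (range (\<lambda>k. nf b k e))" and z: "\<And>w. w \<in> fibre B e \<Longrightarrow> G e [] [v, w] = 0"
  shows "v = 0"
proof -
  note bs = af_basis_span
  have V: "u \<in> span (range (\<lambda>k. nf b k e)) \<Longrightarrow> u \<in> fibre B e" for u using nat_span_sub[OF b e] by blast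
  have afV: "af b k e \<in> fibre B e" for k by (rule V[OF af_in_nat_span])
  have 1: "coframe (af b) (Inl \<alpha>) e v = 0" for \<alpha>
  proof (rule invertible_kernel[OF metr_at(4)])
    show "(\<Sum>\<alpha>\<in>UNIV. coframe (af b) (Inl \<alpha>) e v * gh b \<alpha> \<beta> e) = 0" for \<beta>
      using z[OF afV[of "Inl \<beta>"]] unfolding metr_at(1)[OF V[OF v] afV] coframe_frame[OF bs]
      by (simp add: if_distrib mult.commute cong: if_cong)
  qed
  have 2: "coframe (af b) (Inr a) e v = 0" for a
  proof (rule invertible_kernel[OF metr_at(5)])
    show "(\<Sum>a\<in>UNIV. coframe (af b) (Inr a) e v * gv b a a' e) = 0" for a'
      using z[OF afV[of "Inr a'"]] unfolding metr_at(1)[OF V[OF v] afV] coframe_frame[OF bs]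
      by (simp add: if_distrib mult.commute cong: if_cong)
  qed
  have "coframe (af b) k e v = 0" for k using 1 2 by (cases k) auto
  then show "v = 0" using coframe_expand[OF bs v] by simp
qed

end

text \<open>The fibre is defined as the union of the spans of all natural frames at \<open>e\<close>; the form shows that these
  spans coincide.\<close>

lemma fibre_span:
  assumes b: "b \<in> locs L E" and e: "e \<in> ld b"
  shows "fibre B e = span (range (\<lambda>k. nf b k e))"
proof
  show "span (range (\<lambda>k. nf b k e)) \<subseteq> fibre B e" by (rule nat_span_sub[OF b e])
  show "fibre B e \<subseteq> span (range (\<lambda>k. nf b k e))"
  proof
    fix v assume v: "v \<in> fibre B e"
    then obtain b' where b': "b' \<in> locs L E" "e \<in> ld b'" "v \<in> span (range (\<lambda>k. nf b' k e))"
      by (auto simp: gtb_def)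
    show "v \<in> span (range (\<lambda>k. nf b k e))"
    proof (rule ccontr)
      \<comment> \<open>Off the span the dual frame has the default value \<open>0\<close>, so the coordinate formula pairs \<open>v\<close> to \<open>0\<close>.\<close>
      assume n: "v \<notin> span (range (\<lambda>k. nf b k e))"
      then have "coframe (af b) k e v = 0" for k
        using coframe_dual[OF af_basis_span[OF b e], of k] unfolding dual_space_def by blast
      then have "G e [] [v, w] = 0" if "w \<in> fibre B e" for w
        using metr_at(1)[OF b e v that] by simp
      then have "v = 0" using metr_kernel[OF b'] by blast
      then show False using n span_0 by blast
    qed
  qed
qed

lemma nf_basis: "b \<in> locs L E \<Longrightarrow> e \<in> ld b \<Longrightarrow> basis_at (nf b) e (fibre B e)"
  using nf_basis_span fibre_span by metis

lemma af_basis: "b \<in> locs L E \<Longrightarrow> e \<in> ld b \<Longrightarrow> basis_at (af b) e (fibre B e)"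
  using af_basis_span fibre_span by metis

sublocale framed_bundle B
proof
  show "inj_charts (base B)" by (simp add: TE_charts)
  show "mopen (base B) U" if "(U, t) \<in> frames B" for U t using that dom_open by auto
  show "basis_at t p (fibre B p)" if asm: "(U, t) \<in> frames B" "p \<in> U" for U t p
  proof -
    obtain b where "b \<in> locs L E" "(U, t) = (ld b, nf b)"
      using asm(1) unfolding gtb_simps by blast
    then show ?thesis using nf_basis[of b p] asm(2) by simp
  qed
  show "\<exists>U t. (U, t) \<in> frames B \<and> p \<in> U" if "p \<in> pts (base B)" for p
    using dom_cover[of p] that by auto
qed

lemma G_field: "G \<in> tensor_fields B (pts TE) 0 2"
  using metr by (simp add: pseudometrical_structure_def)

lemma G_nondegenerate: "e \<in> pts TE \<Longrightarrow> nondegenerate_on (fibre B e) (G e)"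
  using dom_cover[of e] metr_kernel fibre_span unfolding nondegenerate_on_def by metis

lemma G_af:
  assumes "b \<in> locs L E" "e \<in> ld b"
  shows "G e [] [af b (Inl \<alpha>) e, af b (Inr a) e] = 0" "G e [] [af b (Inr a) e, af b (Inl \<alpha>) e] = 0"
proof -
  note bs = af_basis[OF assms] and V = basis_at_in[OF af_basis[OF assms]]
  show "G e [] [af b (Inl \<alpha>) e, af b (Inr a) e] = 0" "G e [] [af b (Inr a) e, af b (Inl \<alpha>) e] = 0"
    unfolding metr_at(1)[OF assms V V] coframe_frame[OF bs] by simp_all
qed

lemma G_symmetric:
  assumes "e \<in> pts TE" "v \<in> fibre B e" "w \<in> fibre B e"
  shows "G e [] [v, w] = G e [] [w, v]"
proof -
  obtain b where b: "b \<in> locs L E" "e \<in> ld b" using dom_cover[OF assms(1)] by blast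
  have 1: "(\<Sum>\<alpha>\<in>UNIV. \<Sum>\<beta>\<in>UNIV. gh b \<alpha> \<beta> e * x \<alpha> * y \<beta>) = (\<Sum>\<alpha>\<in>UNIV. \<Sum>\<beta>\<in>UNIV. gh b \<alpha> \<beta> e * y \<alpha> * x \<beta>)" for x y
    by (subst sum.swap) (intro sum.cong refl, subst metr_at(2)[OF b], simp)
  have 2: "(\<Sum>\<alpha>\<in>UNIV. \<Sum>\<beta>\<in>UNIV. gv b \<alpha> \<beta> e * x \<alpha> * y \<beta>) = (\<Sum>\<alpha>\<in>UNIV. \<Sum>\<beta>\<in>UNIV. gv b \<alpha> \<beta> e * y \<alpha> * x \<beta>)" for x y
    by (subst sum.swap) (intro sum.cong refl, subst metr_at(3)[OF b], simp)
  show ?thesis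
    unfolding metr_at(1)[OF b assms(2,3)] metr_at(1)[OF b assms(3,2)] by (intro arg_cong2[where f = "(+)"] 1 2)
qed

section \<open>Vertical and horizontal vectors\<close>

lemma nf_expand:
  assumes "b \<in> locs L E" "e \<in> ld b" "w \<in> fibre B e"
  shows "w = (\<Sum>\<alpha>\<in>UNIV. coframe (nf b) (Inl \<alpha>) e w *\<^sub>R nf b (Inl \<alpha>) e) +
    (\<Sum>a\<in>UNIV. coframe (nf b) (Inr a) e w *\<^sub>R nf b (Inr a) e)"
  using coframe_expand[OF nf_basis[OF assms(1,2)] assms(3)] by (simp add: sum_sum_type)

lemma af_expand:
  assumes "b \<in> locs L E" "e \<in> ld b" "w \<in> fibre B e"
  shows "w = (\<Sum>\<alpha>\<in>UNIV. coframe (af b) (Inl \<alpha>) e w *\<^sub>R af b (Inl \<alpha>) e) +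
    (\<Sum>a\<in>UNIV. coframe (af b) (Inr a) e w *\<^sub>R nf b (Inr a) e)"
  using coframe_expand[OF af_basis[OF assms(1,2)] assms(3)] by (simp add: sum_sum_type del: af_simps(2))

lemma coframe_nf_Inl:
  assumes "b \<in> locs L E" "e \<in> ld b" "w \<in> fibre B e"
  shows "coframe (nf b) (Inl \<alpha>) e w = coframe (snd (snd (snd b))) \<alpha> (hmap L (fst e)) (fst w)"
proof -
  have eq: "fst w = (\<Sum>\<alpha>\<in>UNIV. coframe (nf b) (Inl \<alpha>) e w *\<^sub>R snd (snd (snd b)) \<alpha> (hmap L (fst e)))"
    using arg_cong[OF nf_expand[OF assms], of fst] by (simp add: fst_sum)
  show ?thesis by (subst eq) (rule coframe_sum[OF F_basis[OF assms(1,2)], symmetric])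
qed

lemma coframe_af_Inl:
  assumes "b \<in> locs L E" "e \<in> ld b" "w \<in> fibre B e"
  shows "coframe (af b) (Inl \<alpha>) e w = coframe (snd (snd (snd b))) \<alpha> (hmap L (fst e)) (fst w)"
proof -
  have eq: "fst w = (\<Sum>\<alpha>\<in>UNIV. coframe (af b) (Inl \<alpha>) e w *\<^sub>R snd (snd (snd b)) \<alpha> (hmap L (fst e)))"
    using arg_cong[OF af_expand[OF assms], of fst] by (simp add: fst_sum fst_af del: af_simps(2))
  show ?thesis by (subst eq) (rule coframe_sum[OF F_basis[OF assms(1,2)], symmetric])
qed

lemma in_vf_span:
  assumes b: "b \<in> locs L E" "e \<in> ld b" and w: "w \<in> fibre B e" "fst w = 0"
  shows "w \<in> span (range (\<lambda>a. nf b (Inr a) e))"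
proof -
  have z: "coframe (nf b) (Inl \<alpha>) e w = 0" for \<alpha>
    using coframe_nf_Inl[OF b w(1)] w(2) coframe_zero[OF F_basis[OF b]] by simp
  have eq: "w = (\<Sum>a\<in>UNIV. coframe (nf b) (Inr a) e w *\<^sub>R nf b (Inr a) e)"
    by (rule trans[OF nf_expand[OF b w(1)]]) (simp add: z)
  show ?thesis by (subst eq) (intro span_sum span_scale span_base rangeI)
qed

text \<open>This description does not refer to local data, so the vertical spaces of all natural frames agree.\<close>

lemma vert_iff: "e \<in> pts TE \<Longrightarrow> w \<in> vert e \<longleftrightarrow> w \<in> fibre B e \<and> fst w = 0"
proof
  assume "w \<in> vert e"
  then obtain b where b: "b \<in> locs L E" "e \<in> ld b" "w \<in> span (range (\<lambda>a. nf b (Inr a) e))"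
    by (auto simp: vertical_bundle_def)
  then obtain a where w: "w = (\<Sum>i\<in>UNIV. a i *\<^sub>R nf b (Inr i) e)"
    using in_span_range[of w "\<lambda>a. nf b (Inr a) e"] by blast
  have "w \<in> fibre B e"
    unfolding w by (intro subspace_sum subspace_scale basis_at_in[OF nf_basis[OF b(1,2)]]
        basis_at_subspace[OF nf_basis[OF b(1,2)]])
  then show "w \<in> fibre B e \<and> fst w = 0" by (simp add: w fst_sum)
next
  assume e: "e \<in> pts TE" and w: "w \<in> fibre B e \<and> fst w = 0"
  obtain b where b: "b \<in> locs L E" "e \<in> ld b" using dom_cover[OF e] by blast
  then show "w \<in> vert e"
    using in_vf_span[OF b] w unfolding vertical_bundle_def vbundle.simps by blast
qed

lemma vf_basis:
  assumes b: "b \<in> locs L E" "e \<in> ld b"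
  shows "basis_at (vf b) e (vert e)"
proof (rule basis_atI)
  show "\<forall>i. a i = 0" if "(\<Sum>i\<in>UNIV. a i *\<^sub>R nf b (Inr i) e) = 0" for a
    using vertical_independent[OF b that] by blast
  show "span (range (\<lambda>a. nf b (Inr a) e)) = vert e"
  proof
    show "span (range (\<lambda>a. nf b (Inr a) e)) \<subseteq> vert e"
      using b by (auto simp: vertical_bundle_def)
    show "vert e \<subseteq> span (range (\<lambda>a. nf b (Inr a) e))"
      using vert_iff[OF e_pts[OF b]] in_vf_span[OF b] by blast
  qed
qed

lemma C_linear: "e \<in> pts TE \<Longrightarrow> linear_over (fibre B e) (C e)"
  and C_vert: "e \<in> pts TE \<Longrightarrow> w \<in> fibre B e \<Longrightarrow> C e w \<in> vert e"
  and C_id: "e \<in> pts TE \<Longrightarrow> w \<in> vert e \<Longrightarrow> C e w = w"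
  using conn by (auto simp: rho_eta_connection_def bundle_morphism_def)

lemma C_smooth:
  assumes "b \<in> locs L E" "b' \<in> locs L E"
  shows "smooth_fun TE (ld b \<inter> ld b') (\<lambda>e. coframe (vf b') j e (C e (nf b i e)))"
proof -
  have "\<forall>x\<in>frames B. \<forall>y\<in>frames (vertical_bundle L E). \<forall>i j.
      smooth_fun TE (fst x \<inter> id -` fst y) (\<lambda>p. coframe (snd y) j (id p) (C p (snd x i p)))"
    using conn by (simp add: rho_eta_connection_def bundle_morphism_def case_prod_unfold)
  from this[rule_format, of "(ld b, nf b)" "(ld b', vf b')" j i] assms show ?thesis
    by (simp add: vertical_bundle_def)
qed

lemma C_nf_Inl:
  assumes b: "b \<in> locs L E" "e \<in> ld b"
  shows "C e (nf b (Inl \<alpha>) e) = (\<Sum>a\<in>UNIV. conn_coeff L E C b a \<alpha> e *\<^sub>R nf b (Inr a) e)"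
  unfolding conn_coeff_def
  by (rule coframe_expand[OF vf_basis[OF b] C_vert[OF e_pts[OF b] basis_at_in[OF nf_basis[OF b]]], symmetric])

lemma vf_sum_vert: 
  assumes b: "b \<in> locs L E" "e \<in> ld b"
  shows "(\<Sum>a\<in>UNIV. c a *\<^sub>R nf b (Inr a) e) \<in> vert e"
  using basis_at_sum_in[OF vf_basis[OF b]] .

lemma C_af_Inl:
  assumes b: "b \<in> locs L E" "e \<in> ld b"
  shows "C e (af b (Inl \<alpha>) e) = 0"
proof -
  note p = e_pts[OF b]
  let ?S = "\<Sum>a\<in>UNIV. conn_coeff L E C b a \<alpha> e *\<^sub>R nf b (Inr a) e"
  have S: "?S \<in> vert e" by (rule vf_sum_vert[OF b])
  then have "?S \<in> fibre B e" using vert_iff[OF p] by blast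
  then have "C e ((- 1) *\<^sub>R ?S + nf b (Inl \<alpha>) e) = (- 1) *\<^sub>R C e ?S + C e (nf b (Inl \<alpha>) e)"
    by (intro linear_overD[OF C_linear[OF p]] basis_at_in[OF nf_basis[OF b]])
  then show ?thesis by (simp add: C_id[OF p S] C_nf_Inl[OF b])
qed

lemma C_expand:
  assumes b: "b \<in> locs L E" "e \<in> ld b" and u: "\<And>k. u k \<in> fibre B e"
  shows "C e (\<Sum>k\<in>(UNIV :: ('p + 'r) set). c k *\<^sub>R u k) = (\<Sum>k\<in>UNIV. c k *\<^sub>R C e (u k))"
  by (rule linear_over_sum[OF C_linear[OF e_pts[OF b]] fibre_subspace])
     (use u e_pts[OF b] in auto)

text \<open>The map \<open>C\<close> kills the vectors \<open>\<delta>\<^sub>\<alpha>\<close> and fixes the vertical ones, so it is the projection onto the vertical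
  coordinates in the adapted frame.\<close>

lemma hor_iff:
  assumes b: "b \<in> locs L E" "e \<in> ld b"
  shows "w \<in> horizontal_space L E C e \<longleftrightarrow> w \<in> fibre B e \<and> (\<forall>a. coframe (af b) (Inr a) e w = 0)"
proof -
  have "C e w = (\<Sum>a\<in>UNIV. coframe (af b) (Inr a) e w *\<^sub>R nf b (Inr a) e)" if w: "w \<in> fibre B e"
  proof -
    have "C e (nf b (Inr a) e) = nf b (Inr a) e" for a
      using C_id[OF e_pts[OF b] basis_at_in[OF vf_basis[OF b]]] .
    then show ?thesis
      using C_expand[where u = "\<lambda>k. af b k e" and c = "\<lambda>k. coframe (af b) k e w",
          OF b basis_at_in[OF af_basis[OF b]]]
      unfolding coframe_expand[OF af_basis[OF b] w] by (simp add: sum_sum_type C_af_Inl[OF b] del: af_simps(2))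
  qed
  then show ?thesis
    using vertical_independent[OF b, of "\<lambda>a. coframe (af b) (Inr a) e w"] by (auto simp: horizontal_space_def)
qed

lemma vert_iff':
  assumes b: "b \<in> locs L E" "e \<in> ld b"
  shows "w \<in> vert e \<longleftrightarrow> w \<in> fibre B e \<and> (\<forall>\<alpha>. coframe (af b) (Inl \<alpha>) e w = 0)"
proof -
  have "fst w = 0 \<longleftrightarrow> (\<forall>\<alpha>. coframe (af b) (Inl \<alpha>) e w = 0)" if w: "w \<in> fibre B e"
  proof
    assume "fst w = 0"
    then show "\<forall>\<alpha>. coframe (af b) (Inl \<alpha>) e w = 0"
      using coframe_af_Inl[OF b w] coframe_zero[OF F_basis[OF b]] by simp
  next
    assume "\<forall>\<alpha>. coframe (af b) (Inl \<alpha>) e w = 0"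
    then have "w = (\<Sum>a\<in>UNIV. coframe (af b) (Inr a) e w *\<^sub>R nf b (Inr a) e)"
      using af_expand[OF b w] by simp
    then have "fst w = fst (\<Sum>a\<in>UNIV. coframe (af b) (Inr a) e w *\<^sub>R nf b (Inr a) e)" by (rule arg_cong)
    then show "fst w = 0" by (simp add: fst_sum)
  qed
  then show ?thesis using vert_iff[OF e_pts[OF b]] by blast
qed

section \<open>Smoothness of the adapted frames\<close>

text \<open>Applying \<open>C\<close> to the expansion of \<open>w\<close> in the natural frame and solving for the vertical coordinates
  expresses them by quantities whose smoothness is part of the hypotheses.\<close>

lemma coframe_nf_Inr:
  assumes b: "b \<in> locs L E" "e \<in> ld b" and w: "w \<in> fibre B e"
  shows "coframe (nf b) (Inr a) e w = coframe (vf b) a e (C e w) -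
    (\<Sum>\<delta>\<in>UNIV. coframe (nf b) (Inl \<delta>) e w * conn_coeff L E C b a \<delta> e)"
proof -
  note p = e_pts[OF b] and vb = vf_basis[OF b]
  have Cr: "C e (nf b (Inr a) e) = nf b (Inr a) e" for a
    using C_id[OF p basis_at_in[OF vb]] .
  let ?x = "\<Sum>\<alpha>\<in>UNIV. coframe (nf b) (Inl \<alpha>) e w *\<^sub>R C e (nf b (Inl \<alpha>) e)"
  let ?y = "\<Sum>a\<in>UNIV. coframe (nf b) (Inr a) e w *\<^sub>R nf b (Inr a) e"
  have "C e w = ?x + ?y"
    using C_expand[where u = "\<lambda>k. nf b k e" and c = "\<lambda>k. coframe (nf b) k e w",
        OF b basis_at_in[OF nf_basis[OF b]]]
    unfolding coframe_expand[OF nf_basis[OF b] w] by (simp add: sum_sum_type Cr)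
  moreover have Cv: "C e (nf b (Inl \<alpha>) e) \<in> vert e" for \<alpha>
    by (rule C_vert[OF p basis_at_in[OF nf_basis[OF b]]])
  have "coframe (vf b) a e (?x + ?y) = coframe (vf b) a e ?x + coframe (vf b) a e ?y"
    by (rule coframe_add[OF vb _ vf_sum_vert[OF b]])
       (intro subspace_sum subspace_scale Cv basis_at_subspace[OF vb])
  moreover have "coframe (vf b) a e ?x = (\<Sum>\<delta>\<in>UNIV. coframe (nf b) (Inl \<delta>) e w * conn_coeff L E C b a \<delta> e)"
    unfolding conn_coeff_def by (rule dual_space_sum[OF coframe_dual[OF vb] basis_at_subspace[OF vb] Cv])
  moreover have "coframe (vf b) a e ?y = coframe (nf b) (Inr a) e w"
    by (rule coframe_sum[OF vb])
  ultimately show ?thesis by simp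
qed

text \<open>The coordinates in the direction of \<open>F\<close> are the transition functions of \<open>F\<close>, pulled back along
  \<open>h\<close> and the bundle projection. For the vertical coordinates, \<open>coframe_nf_Inr\<close> leaves only the components of
  \<open>C\<close> between the frames of two different local data, which are smooth because \<open>C\<close> is a bundle morphism.\<close>

lemma nf_transition_smooth:
  assumes b: "b \<in> locs L E" and b': "b' \<in> locs L E"
  shows "smooth_fun TE (ld b \<inter> ld b') (\<lambda>e. coframe (nf b') j e (nf b i e))"
proof -
  let ?W = "ld b \<inter> ld b'"
  have W: "mopen TE ?W" by (rule mopen_Int[OF TE_charts dom_open[OF b] dom_open[OF b']])
  have in': "nf b i e \<in> fibre B e" if "e \<in> ?W" for e i
    using that basis_at_in[OF nf_basis[OF b]] by blast
  have first: "smooth_fun TE ?W (\<lambda>e. coframe (nf b') (Inl \<delta>) e (nf b i e))" for \<delta> i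
  proof (cases i)
    case (Inr a)
    show ?thesis
      by (rule smooth_fun_cong_imp[OF W _ TE_charts smooth_fun_const[OF W, of 0]])
         (use coframe_nf_Inl[OF b'] coframe_zero[OF F_basis[OF b']] in' Inr in auto)
  next
    case (Inl \<gamma>)
    obtain c s t c' s' t' where [simp]: "b = (c, s, t)" "b' = (c', s', t')" by (cases b, cases b')
    have t: "(fst t, snd t) \<in> frames (bun L)" "(fst t', snd t') \<in> frames (bun L)"
      using b b' by (auto simp: locs_def)
    let ?V = "fst t \<inter> fst t'"
    note N = vector_bundleD(1)[OF bun_bundle]
    have V: "mopen (base (bun L)) ?V"
      by (rule mopen_Int[OF smooth_manifold_charts(1)[OF N] vector_bundleD(2)[OF bun_bundle t(1)] vector_bundleD(2)[OF bun_bundle t(2)]])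
    have "smooth_fun (src L) (pts (src L) \<inter> hmap L -` ?V) (\<lambda>x. coframe (snd t') \<delta> (hmap L x) (snd t \<gamma> (hmap L x)))"
      by (rule smooth_fun_pullback[OF src_manifold N hmap_smooth V vector_bundleD(4)[OF bun_bundle t]])
    then have "smooth_fun TE (over E (pts (src L) \<inter> hmap L -` ?V))
        (\<lambda>e. coframe (snd t') \<delta> (hmap L (fst e)) (snd t \<gamma> (hmap L (fst e))))"
      using smooth_fun_over[OF E] smooth_map_vimage_open[OF src_manifold N hmap_smooth V] by (simp add: base)
    moreover have "?W \<subseteq> over E (pts (src L) \<inter> hmap L -` ?V)"
      using loc_dom_over[of c s t] loc_dom_over[of c' s' t'] b b' by (auto simp: over_def)
    ultimately have s: "smooth_fun TE ?W (\<lambda>e. coframe (snd t') \<delta> (hmap L (fst e)) (snd t \<gamma> (hmap L (fst e))))"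
      by (rule smooth_fun_subset)
    show ?thesis
      by (rule smooth_fun_cong_imp[OF W _ TE_charts s])
         (use coframe_nf_Inl[OF b'] in' Inl in auto)
  qed
  show ?thesis
  proof (cases j)
    case (Inl \<delta>)
    then show ?thesis using first[of \<delta> i] by simp
  next
    case (Inr a)
    have cc: "smooth_fun TE ?W (\<lambda>e. conn_coeff L E C b' a \<delta> e)" for \<delta>
      unfolding conn_coeff_def using smooth_fun_subset[OF C_smooth[OF b' b'], of ?W] by blast
    have "smooth_fun TE ?W (\<lambda>e. coframe (vf b') a e (C e (nf b i e)) -
        (\<Sum>\<delta>\<in>UNIV. coframe (nf b') (Inl \<delta>) e (nf b i e) * conn_coeff L E C b' a \<delta> e))"
      by (intro smooth_fun_diff smooth_fun_sum smooth_fun_mult W first cc C_smooth[OF b b'])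
    then show ?thesis
      by (rule smooth_fun_cong_imp[OF W _ TE_charts, rotated])
         (use coframe_nf_Inr[OF b'] in' Inr in auto)
  qed
qed

lemma af_transition_smooth:
  assumes b: "b \<in> locs L E" and b': "b' \<in> locs L E"
  shows "smooth_fun TE (ld b \<inter> ld b') (\<lambda>e. coframe (nf b') j e (af b k e))"
proof (cases k)
  case (Inr a)
  then show ?thesis using nf_transition_smooth[OF assms] by simp
next
  case (Inl \<alpha>)
  let ?W = "ld b \<inter> ld b'"
  have W: "mopen TE ?W" by (rule mopen_Int[OF TE_charts dom_open[OF b] dom_open[OF b']])
  have cc: "smooth_fun TE ?W (\<lambda>e. conn_coeff L E C b a \<alpha> e)" for a
    unfolding conn_coeff_def using smooth_fun_subset[OF C_smooth[OF b b], of ?W] by blast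
  have "smooth_fun TE ?W (\<lambda>e. coframe (nf b') j e (nf b (Inl \<alpha>) e) -
      (\<Sum>a\<in>UNIV. conn_coeff L E C b a \<alpha> e * coframe (nf b') j e (nf b (Inr a) e)))"
    by (intro smooth_fun_diff smooth_fun_sum smooth_fun_mult W cc nf_transition_smooth b b')
  then show ?thesis
  proof (rule smooth_fun_cong_imp[OF W _ TE_charts, rotated])
    fix e assume "e \<in> ?W"
    then have e: "e \<in> ld b" "e \<in> ld b'" by auto
    note nb = nf_basis[OF b e(1)] and nb' = nf_basis[OF b' e(2)]
    let ?S = "\<Sum>a\<in>UNIV. conn_coeff L E C b a \<alpha> e *\<^sub>R nf b (Inr a) e"
    have S: "?S \<in> fibre B e"
      by (intro subspace_sum subspace_scale basis_at_in[OF nb] basis_at_subspace[OF nb])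
    have "coframe (nf b') j e ((- 1) *\<^sub>R ?S + nf b (Inl \<alpha>) e) =
        coframe (nf b') j e ((- 1) *\<^sub>R ?S) + coframe (nf b') j e (nf b (Inl \<alpha>) e)"
      by (intro coframe_add[OF nb'] subspace_scale[OF basis_at_subspace[OF nb]] S basis_at_in[OF nb])
    also have "coframe (nf b') j e ((- 1) *\<^sub>R ?S) = (- 1) * coframe (nf b') j e ?S"
      by (rule coframe_scale[OF nb' S])
    also have "coframe (nf b') j e ?S = (\<Sum>a\<in>UNIV. conn_coeff L E C b a \<alpha> e * coframe (nf b') j e (nf b (Inr a) e))"
      by (rule dual_space_sum[OF coframe_dual[OF nb'] basis_at_subspace[OF nb'] basis_at_in[OF nb]])
    finally show "coframe (nf b') j e (nf b (Inl \<alpha>) e) -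
      (\<Sum>a\<in>UNIV. conn_coeff L E C b a \<alpha> e * coframe (nf b') j e (nf b (Inr a) e)) = coframe (nf b') j e (af b k e)"
      by (simp add: Inl)
  qed
qed

lemma af_section:
  assumes b: "b \<in> locs L E" and W: "mopen TE W" "W \<subseteq> ld b"
  shows "restrict0 W (af b k) \<in> sections B W"
  unfolding sections_def
proof (clarify, intro conjI allI ballI impI)
  show "restrict0 W (af b k) p \<in> fibre B p" if "p \<in> W" for p
    using basis_at_in[OF af_basis[OF b, of p], of k] that subsetD[OF W(2) that]
    by (simp add: restrict0_def del: af_simps)
  show "restrict0 W (af b k) p = 0" if "p \<notin> W" for p using that by (simp add: restrict0_def)
  fix x assume "x \<in> frames B"
  then obtain b' where b': "b' \<in> locs L E" "x = (ld b', nf b')" by (auto simp del: split_paired_All)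
  have W': "mopen TE (ld b' \<inter> W)" by (rule mopen_Int[OF TE_charts dom_open[OF b'(1)] W(1)])
  have "smooth_fun TE (ld b' \<inter> W) (\<lambda>p. coframe (nf b') i p (restrict0 W (af b k) p))" for i
    by (rule smooth_fun_cong_imp[OF W' _ TE_charts
          smooth_fun_subset[OF af_transition_smooth[OF b b'(1)]]])
       (use W(2) in \<open>auto simp: restrict0_def simp del: af_simps\<close>)
  then show "case x of (U, t) \<Rightarrow> \<forall>i. smooth_fun (base B) (U \<inter> W) (\<lambda>p. coframe t i p (restrict0 W (af b k) p))"
    by (simp add: b'(2))
qed

lemma hor_vert_orthogonal:
  assumes e: "e \<in> pts TE" and v: "v \<in> horizontal_space L E C e" and w: "w \<in> vert e"
  shows "G e [] [v, w] = 0" "G e [] [w, v] = 0"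
proof -
  obtain b where b: "b \<in> locs L E" "e \<in> ld b" using dom_cover[OF e] by blast
  have "v \<in> fibre B e" "w \<in> fibre B e" "\<And>a. coframe (af b) (Inr a) e v = 0" "\<And>\<alpha>. coframe (af b) (Inl \<alpha>) e w = 0"
    using v w hor_iff[OF b] vert_iff'[OF b] by blast+
  then show "G e [] [v, w] = 0" "G e [] [w, v] = 0" by (simp_all add: metr_at(1)[OF b])
qed

lemma G_coframe:
  assumes b: "b \<in> locs L E" "e \<in> ld b" and v: "v \<in> fibre B e"
  shows "G e [] [v, af b (Inl \<beta>) e] = (\<Sum>\<alpha>\<in>UNIV. coframe (af b) (Inl \<alpha>) e v * gh b \<alpha> \<beta> e)"
    and "G e [] [v, af b (Inr a') e] = (\<Sum>a\<in>UNIV. coframe (af b) (Inr a) e v * gv b a a' e)"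
  unfolding metr_at(1)[OF b v basis_at_in[OF af_basis[OF b]]] coframe_frame[OF af_basis[OF b]]
  by (simp_all add: if_distrib mult.commute cong: if_cong)

lemma af_hor: "b \<in> locs L E \<Longrightarrow> e \<in> ld b \<Longrightarrow> af b (Inl \<alpha>) e \<in> horizontal_space L E C e"
  using hor_iff basis_at_in[OF af_basis] coframe_frame[OF af_basis] by (metis sum.distinct(1))

lemma af_vert: "b \<in> locs L E \<Longrightarrow> e \<in> ld b \<Longrightarrow> af b (Inr a) e \<in> vert e"
  using vert_iff' basis_at_in[OF af_basis] coframe_frame[OF af_basis] by (metis sum.distinct(2))

end

section \<open>Correcting a distinguished connection\<close>

locale distinguished = generalized_tangent L E C G
  for L :: "('m, 'n, 'f::real_vector, 'd::finite, 'p::finite) gla"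
    and E :: "('m, real^'d, 'e::real_vector, 'r::finite) vbundle"
    and C :: "'m \<times> 'e \<Rightarrow> ('m, 'e, 'f, 'd, 'r) gvec \<Rightarrow> ('m, 'e, 'f, 'd, 'r) gvec"
    and G :: "'m \<times> 'e \<Rightarrow> ('m, 'e, 'f, 'd, 'r) gvec tensor" +
  fixes D0 :: "('m \<times> 'e, ('m, 'e, 'f, 'd, 'r) gvec) cov_deriv"
  assumes dist: "distinguished_connection L E C D0"
begin

abbreviation "hor \<equiv> horizontal_space L E C"

sublocale metrized B ganchor D0 G
  by standard (use dist G_field G_nondegenerate in \<open>auto simp: distinguished_connection_def\<close>)

lemma D0_af:
  assumes b: "b \<in> locs L E" and W: "mopen TE W" "W \<subseteq> ld b" and X: "X \<in> sections B W"
  obtains Z where "Z \<in> sections B W"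
    "D0 W X 1 0 (vec_tensor B (restrict0 W (af b k))) = vec_tensor B Z"
    "\<And>p. p \<in> W \<Longrightarrow> Z p \<in> (case k of Inl _ \<Rightarrow> hor p | Inr _ \<Rightarrow> vert p)"
proof -
  note s = af_section[OF b W, of k]
  show thesis
  proof (cases k)
    case (Inl \<alpha>)
    have "\<forall>p\<in>W. restrict0 W (af b k) p \<in> hor p"
    proof
      fix p assume "p \<in> W"
      then show "restrict0 W (af b k) p \<in> hor p"
        using af_hor[OF b subsetD[OF W(2)]] by (simp add: Inl restrict0_def del: af_simps)
    qed
    then obtain Z where "Z \<in> sections B W" "\<forall>p\<in>W. Z p \<in> hor p"
      "D0 W X 1 0 (vec_tensor B (restrict0 W (af b k))) = vec_tensor B Z"
      using dist W(1) X s unfolding distinguished_connection_def preserves_subbundle_def gtb_simps by blast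
    then show thesis by (intro that) (auto simp: Inl)
  next
    case (Inr a)
    have "\<forall>p\<in>W. restrict0 W (af b k) p \<in> vert p"
    proof
      fix p assume "p \<in> W"
      then show "restrict0 W (af b k) p \<in> vert p"
        using af_vert[OF b subsetD[OF W(2)]] by (simp add: Inr restrict0_def del: af_simps)
    qed
    then obtain Z where "Z \<in> sections B W" "\<forall>p\<in>W. Z p \<in> vert p"
      "D0 W X 1 0 (vec_tensor B (restrict0 W (af b k))) = vec_tensor B Z"
      using dist W(1) X s unfolding distinguished_connection_def preserves_subbundle_def gtb_simps by blast
    then show thesis by (intro that) (auto simp: Inr)
  qed
qed

lemma restrict_tensor:
  assumes "mopen TE W" shows "restrict0 W G \<in> tensor_fields B W 0 2"
  using tensor_fields_restrict[OF metric, of W] assms by (simp add: mopen_def)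

text \<open>Both claims follow by comparing instances of \<open>D_bilinear_form\<close> for adapted frames: exchanging the
  arguments leaves \<open>G (Y, Z)\<close> unchanged, and for a horizontal \<open>Y\<close> and a vertical \<open>Z\<close> it vanishes together with
  the terms with derivatives of \<open>Y\<close> and \<open>Z\<close>, since \<open>D0\<close> preserves the two subbundles.\<close>

lemma DG_af_local:
  assumes b: "b \<in> locs L E" and W: "mopen TE W" "W \<subseteq> ld b" and X: "X \<in> sections B W" and p: "p \<in> W"
  shows "DG W X p [] [af b k p, af b k' p] = DG W X p [] [af b k' p, af b k p]"
    and "DG W X p [] [af b (Inl \<alpha>) p, af b (Inr a) p] = 0"
proof -
  have W': "mopen (base B) W" using W(1) by simp
  note T = restrict_tensor[OF W(1)]
  have pT: "p \<in> pts TE" using W p by (auto simp: mopen_def)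
  have pb: "p \<in> ld b" using W p by auto
  have sub: "hor q \<subseteq> fibre B q" "vert q \<subseteq> fibre B q" if "q \<in> W" for q
    using hor_iff[OF b] vert_iff'[OF b] that W(2) by blast+
  have Zin: "Z q \<in> fibre B q" if "\<And>p. p \<in> W \<Longrightarrow> Z p \<in> (case k of Inl _ \<Rightarrow> hor p | Inr _ \<Rightarrow> vert p)" "q \<in> W" for Z q and k :: "'p + 'r"
    using that(1)[OF that(2)] sub[OF that(2)] by (cases k) auto
  have val: "restrict0 W (af b k) p = af b k p" "restrict0 W G p = G p" for k
    using p by (simp_all add: restrict0_def)
  have afp: "af b k p \<in> fibre B p" for k by (rule basis_at_in[OF af_basis[OF b pb]])
  have afW: "af b k q \<in> fibre B q" if "q \<in> W" for k q using basis_at_in[OF af_basis[OF b]] that W(2) by blast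
  show "DG W X p [] [af b k p, af b k' p] = DG W X p [] [af b k' p, af b k p]"
  proof -
    obtain Y where Y: "Y \<in> sections B W" "D0 W X 1 0 (vec_tensor B (restrict0 W (af b k))) = vec_tensor B Y"
      "\<And>p. p \<in> W \<Longrightarrow> Y p \<in> (case k of Inl _ \<Rightarrow> hor p | Inr _ \<Rightarrow> vert p)"
      using D0_af[OF b W X] by blast
    obtain Z where Z: "Z \<in> sections B W" "D0 W X 1 0 (vec_tensor B (restrict0 W (af b k'))) = vec_tensor B Z"
      "\<And>p. p \<in> W \<Longrightarrow> Z p \<in> (case k' of Inl _ \<Rightarrow> hor p | Inr _ \<Rightarrow> vert p)"
      using D0_af[OF b W X] by blast
    \<comment> \<open>One function serves for both orders of the arguments, since \<open>G\<close> is symmetric on \<open>W\<close>.\<close>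
    define f where "f q = G q [] [af b k q, af b k' q]" for q
    have f1: "f q = restrict0 W G q [] [restrict0 W (af b k) q, restrict0 W (af b k') q]" if "q \<in> W" for q
      using that by (simp add: f_def restrict0_def)
    have f2: "f q = restrict0 W G q [] [restrict0 W (af b k') q, restrict0 W (af b k) q]" if "q \<in> W" for q
      using that G_symmetric[OF _ afW[OF that] afW[OF that]] W(1)
      by (auto simp: f_def restrict0_def mopen_def simp del: af_simps)
    note y = af_section[OF b W, of k] Zin[OF Y(3)] Y(2) and z = af_section[OF b W, of k'] Zin[OF Z(3)] Z(2)
    have "tderiv TE p (ganchor (X p)) f = DG W X p [] [af b k p, af b k' p] +
        G p [] [Y p, af b k' p] + G p [] [af b k p, Z p]"
      using D_bilinear_form[OF W' X T y z f1 p] unfolding val gtb_simps by simp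
    moreover have "tderiv TE p (ganchor (X p)) f = DG W X p [] [af b k' p, af b k p] +
        G p [] [Z p, af b k p] + G p [] [af b k' p, Y p]"
      using D_bilinear_form[OF W' X T z y f2 p] unfolding val gtb_simps by simp
    ultimately show ?thesis
      using G_symmetric[OF pT Zin[OF Y(3) p] afp] G_symmetric[OF pT afp Zin[OF Z(3) p]] by simp
  qed
  show "DG W X p [] [af b (Inl \<alpha>) p, af b (Inr a) p] = 0"
  proof -
    obtain Y where Y: "Y \<in> sections B W" "D0 W X 1 0 (vec_tensor B (restrict0 W (af b (Inl \<alpha>)))) = vec_tensor B Y"
      "\<And>p. p \<in> W \<Longrightarrow> Y p \<in> (case Inl \<alpha> :: 'p + 'r of Inl _ \<Rightarrow> hor p | Inr _ \<Rightarrow> vert p)"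
      using D0_af[OF b W X] by blast
    obtain Z where Z: "Z \<in> sections B W" "D0 W X 1 0 (vec_tensor B (restrict0 W (af b (Inr a)))) = vec_tensor B Z"
      "\<And>p. p \<in> W \<Longrightarrow> Z p \<in> (case Inr a :: 'p + 'r of Inl _ \<Rightarrow> hor p | Inr _ \<Rightarrow> vert p)"
      using D0_af[OF b W X] by blast
    have f: "0 = restrict0 W G q [] [restrict0 W (af b (Inl \<alpha>)) q, restrict0 W (af b (Inr a)) q]" if "q \<in> W" for q
      using that G_af(1)[OF b, of q \<alpha> a] W(2) by (auto simp: restrict0_def simp del: af_simps)
    note y = af_section[OF b W, of "Inl \<alpha>"] Zin[OF Y(3)] Y(2) and z = af_section[OF b W, of "Inr a"] Zin[OF Z(3)] Z(2)
    have "tderiv TE p (ganchor (X p)) (\<lambda>_. 0 :: real) = DG W X p [] [af b (Inl \<alpha>) p, af b (Inr a) p] +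
        G p [] [Y p, af b (Inr a) p] + G p [] [af b (Inl \<alpha>) p, Z p]"
      using D_bilinear_form[OF W' X T y z f p] unfolding val gtb_simps .
    moreover have "tderiv TE p (ganchor (X p)) (\<lambda>_. 0 :: real) = 0"
      by (simp add: tderiv_def Let_def o_def)
    moreover have "G p [] [Y p, af b (Inr a) p] = 0" "G p [] [af b (Inl \<alpha>) p, Z p] = 0"
      using hor_vert_orthogonal(1)[OF pT] Y(3)[OF p] Z(3)[OF p] af_hor[OF b pb] af_vert[OF b pb]
      by (simp_all del: af_simps)
    ultimately show ?thesis by simp
  qed
qed

text \<open>Locality of the covariant derivative makes it possible to shrink an arbitrary \<open>W\<close> to the domain of an adapted frame.\<close>

lemma DG_at:
  assumes W: "mopen TE W" and X: "X \<in> sections B W" and p: "p \<in> W" and b: "b \<in> locs L E" "p \<in> ld b"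
  shows "DG W X p [] [af b k p, af b k' p] = DG W X p [] [af b k' p, af b k p]"
    and "DG W X p [] [af b (Inl \<alpha>) p, af b (Inr a) p] = 0"
proof -
  define W' where "W' = W \<inter> ld b"
  have W': "mopen TE W'" "W' \<subseteq> ld b" "W' \<subseteq> W" "p \<in> W'"
    using mopen_Int[OF TE_charts W dom_open[OF b(1)]] p b(2) by (auto simp: W'_def)
  note X' = sections_restrict[unfolded gtb_simps, OF X W'(1,3)]
  have rr: "restrict0 W' (restrict0 W G) = restrict0 W' G"
    using W'(3) by (auto simp: restrict0_def fun_eq_iff)
  have "D0 W' (restrict0 W' X) 0 2 (restrict0 W' G) = restrict0 W' (DG W X)"
    using D_restrict[OF _ X restrict_tensor[OF W], of W'] W W'(1,3) unfolding rr gtb_simps by blast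
  then have eq: "DG W X p = D0 W' (restrict0 W' X) 0 2 (restrict0 W' G) p"
    using W'(4) by (simp add: restrict0_def)
  show "DG W X p [] [af b k p, af b k' p] = DG W X p [] [af b k' p, af b k p]"
    and "DG W X p [] [af b (Inl \<alpha>) p, af b (Inr a) p] = 0"
    unfolding eq by (rule DG_af_local[OF b(1) W'(1,2) X' W'(4)])+
qed

lemma DG_tensor:
  assumes W: "mopen TE W" and X: "X \<in> sections B W" and p: "p \<in> W"
  shows "DG W X p \<in> tensors (fibre B p) 0 2"
  using D_metric_at[of W X p] assms by simp

lemma DG_symmetric:
  assumes W: "mopen TE W" and X: "X \<in> sections B W" and p: "p \<in> W" and vw: "v \<in> fibre B p" "w \<in> fibre B p"
  shows "DG W X p [] [v, w] = DG W X p [] [w, v]"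
proof -
  obtain b where b: "b \<in> locs L E" "p \<in> ld b" using dom_cover[OF mopen_sub[unfolded gtb_simps, OF W p]] by blast
  note t = af_basis[OF b] and g = DG_tensor[OF W X p]
  show ?thesis
    unfolding bilinear_expand[OF t g vw] bilinear_expand[OF t g vw(2,1)]
    by (subst sum.swap) (intro sum.cong refl, subst DG_at(1)[OF W X p b], simp)
qed

lemma DG_block:
  assumes W: "mopen TE W" and X: "X \<in> sections B W" and p: "p \<in> W" and v: "v \<in> hor p" and w: "w \<in> vert p"
  shows "DG W X p [] [v, w] = 0"
proof -
  obtain b where b: "b \<in> locs L E" "p \<in> ld b" using dom_cover[OF mopen_sub[unfolded gtb_simps, OF W p]] by blast
  note t = af_basis[OF b] and g = DG_tensor[OF W X p]
  have vw: "v \<in> fibre B p" "w \<in> fibre B p" and z: "\<And>a. coframe (af b) (Inr a) p v = 0"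
    "\<And>\<alpha>. coframe (af b) (Inl \<alpha>) p w = 0"
    using v w hor_iff[OF b] vert_iff'[OF b] by blast+
  show ?thesis
    unfolding bilinear_expand[OF t g vw] by (simp add: sum_sum_type z DG_at(2)[OF W X p b] del: af_simps)
qed

text \<open>Testing \<open>A v\<close> against vertical vectors gives a mixed value of the covariant derivative of \<open>G\<close>, that is \<open>0\<close>;
  as the vertical block of \<open>G\<close> is invertible, \<open>A v\<close> has no vertical coordinates.\<close>

lemma correction_hor:
  assumes W: "mopen TE W" and X: "X \<in> sections B W" and p: "p \<in> W" and v: "v \<in> hor p"
  shows "correction W X p v \<in> hor p"
proof -
  obtain b where b: "b \<in> locs L E" "p \<in> ld b" using dom_cover[OF mopen_sub[unfolded gtb_simps, OF W p]] by blast
  have W': "mopen (base B) W" using W by simp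
  have vV: "v \<in> fibre B p" using v hor_iff[OF b] by blast
  note c = correction_in[OF W' X p vV]
  have "coframe (af b) (Inr a) p (correction W X p v) = 0" for a
  proof (rule invertible_kernel[OF metr_at(5)[OF b]])
    fix a'
    have u: "af b (Inr a') p \<in> vert p" "af b (Inr a') p \<in> fibre B p"
      using af_vert[OF b] basis_at_in[OF af_basis[OF b]] by blast+
    show "(\<Sum>a\<in>UNIV. coframe (af b) (Inr a) p (correction W X p v) * gv b a a' p) = 0"
      using G_coframe(2)[OF b c, of a'] correction_eq[OF W' X p vV u(2)] DG_block[OF W X p v u(1)] by simp
  qed
  then show ?thesis using hor_iff[OF b] c by blast
qed

lemma correction_vert:
  assumes W: "mopen TE W" and X: "X \<in> sections B W" and p: "p \<in> W" and v: "v \<in> vert p"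
  shows "correction W X p v \<in> vert p"
proof -
  obtain b where b: "b \<in> locs L E" "p \<in> ld b" using dom_cover[OF mopen_sub[unfolded gtb_simps, OF W p]] by blast
  have W': "mopen (base B) W" using W by simp
  have vV: "v \<in> fibre B p" using v vert_iff'[OF b] by blast
  note c = correction_in[OF W' X p vV]
  have "coframe (af b) (Inl \<alpha>) p (correction W X p v) = 0" for \<alpha>
  proof (rule invertible_kernel[OF metr_at(4)[OF b]])
    fix \<beta>
    have u: "af b (Inl \<beta>) p \<in> hor p" "af b (Inl \<beta>) p \<in> fibre B p"
      using af_hor[OF b] basis_at_in[OF af_basis[OF b]] by blast+
    show "(\<Sum>\<alpha>\<in>UNIV. coframe (af b) (Inl \<alpha>) p (correction W X p v) * gh b \<alpha> \<beta> p) = 0"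
      using G_coframe(1)[OF b c, of \<beta>] correction_eq[OF W' X p vV u(2)] DG_block[OF W X p u(1) v]
        DG_symmetric[OF W X p vV u(2)] by simp
  qed
  then show ?thesis using vert_iff'[OF b] c by blast
qed

lemma corrected_preserves:
  assumes pres: "preserves_subbundle B S D0"
    and S: "\<And>p. p \<in> pts TE \<Longrightarrow> S p \<subseteq> fibre B p"
      "\<And>p v w. p \<in> pts TE \<Longrightarrow> v \<in> S p \<Longrightarrow> w \<in> S p \<Longrightarrow> v + w \<in> S p"
    and corr: "\<And>W X p v. mopen TE W \<Longrightarrow> X \<in> sections B W \<Longrightarrow> p \<in> W \<Longrightarrow> v \<in> S p \<Longrightarrow> correction W X p v \<in> S p"
  shows "preserves_subbundle B S corrected"
  unfolding preserves_subbundle_def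
proof (intro allI impI, elim conjE)
  fix W X Y assume W: "mopen (base B) W" and X: "X \<in> sections B W" and Y: "Y \<in> sections B W" "\<forall>p\<in>W. Y p \<in> S p"
  obtain Z where Z: "Z \<in> sections B W" "\<forall>p\<in>W. Z p \<in> S p" "D0 W X 1 0 (vec_tensor B Y) = vec_tensor B Z"
    using pres W X Y unfolding preserves_subbundle_def by blast
  let ?Z = "restrict0 W (\<lambda>p. Z p + correction W X p (Y p))"
  have "corrected W X 1 0 (vec_tensor B Y) = vec_tensor B ?Z"
    by (rule corrected_vec[OF W X Y(1) sectionsD(1)[OF Z(1)] Z(3)])
  moreover have "?Z \<in> sections B W" by (rule correction_section[OF W X Y(1) Z(1)])
  moreover have "\<forall>p\<in>W. ?Z p \<in> S p"
  proof
    fix p assume p: "p \<in> W"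
    have W': "mopen TE W" using W by simp
    have "Z p + correction W X p (Y p) \<in> S p"
      by (rule S(2)[OF mopen_sub[unfolded gtb_simps, OF W' p] bspec[OF Z(2) p] corr[OF W' X p bspec[OF Y(2) p]]])
    then show "?Z p \<in> S p" using p by (simp add: restrict0_def)
  qed
  ultimately show "\<exists>Z\<in>sections B W. (\<forall>p\<in>W. Z p \<in> S p) \<and> corrected W X 1 0 (vec_tensor B Y) = vec_tensor B Z"
    by blast
qed

lemma corrected_distinguished: "distinguished_connection L E C corrected"
  unfolding distinguished_connection_def
proof (intro conjI corrected_covariant corrected_preserves)
  show "preserves_subbundle B hor D0" "preserves_subbundle B vert D0"
    using dist by (auto simp: distinguished_connection_def)
  fix p assume p: "p \<in> pts TE"
  obtain b where b: "b \<in> locs L E" "p \<in> ld b" using dom_cover[OF p] by blast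
  show "hor p \<subseteq> fibre B p" "vert p \<subseteq> fibre B p" using hor_iff[OF b] vert_iff[OF p] by blast+
  have V: "subspace (fibre B p)" by (rule basis_at_subspace[OF af_basis[OF b]])
  show "v + w \<in> hor p" if "v \<in> hor p" "w \<in> hor p" for v w
    using that V unfolding hor_iff[OF b] by (simp add: coframe_add[OF af_basis[OF b]] subspace_add)
  show "v + w \<in> vert p" if "v \<in> vert p" "w \<in> vert p" for v w
    using that V unfolding vert_iff[OF p] by (simp add: subspace_add)
qed (auto intro: correction_hor correction_vert)

lemma corrected_metric_zero:
  assumes "mopen TE W" "X \<in> sections B W"
  shows "corrected W X 0 2 (restrict0 W G) = 0"
  by (rule corrected_metric)
     (use assms DG_symmetric[OF assms] G_symmetric in \<open>auto simp: mopen_def\<close>)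

section \<open>Components of the corrected connection\<close>

text \<open>The map \<open>\<iota>\<close> selects the horizontal or the vertical half of the adapted frame and \<open>x\<close> the direction of
  differentiation, so that four instances give the four families of components. Pairing the expansion
  \<open>A (e\<^sub>\<beta>) = c\<^sup>i e\<^sub>i\<close> with \<open>e\<^sub>\<epsilon>\<close> yields \<open>c\<^sup>i g\<^sub>i\<^sub>\<epsilon> = 1/2 g\<^sub>\<epsilon>\<^sub>\<beta>\<^sub>|\<^sub>x\<close>, and multiplying by the inverse matrix
  isolates \<open>c\<^sup>i\<close>.\<close>

lemma corrected_components:
  fixes \<iota> :: "'i::finite \<Rightarrow> 'p + 'r" and K :: "'i \<Rightarrow> 'i \<Rightarrow> 'm \<times> 'e \<Rightarrow> real" and x :: "'p + 'r"
  assumes b: "b \<in> locs L E"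
    and inv: "\<And>e. e \<in> ld b \<Longrightarrow> invertible (metric_matrix g e)"
    and g: "g = (\<lambda>i j e. G e [] [af b (\<iota> i) e, af b (\<iota> j) e])"
    and pres: "\<And>e \<beta>. e \<in> ld b \<Longrightarrow>
      \<exists>c. correction (ld b) (restrict0 (ld b) (af b x)) e (af b (\<iota> \<beta>) e) = (\<Sum>i\<in>UNIV. c i *\<^sub>R af b (\<iota> i) e)"
    and K: "\<And>\<beta>. D0 (ld b) (restrict0 (ld b) (af b x)) 1 0 (vec_tensor B (restrict0 (ld b) (af b (\<iota> \<beta>)))) =
      vec_tensor B (restrict0 (ld b) (\<lambda>e. \<Sum>i\<in>UNIV. K i \<beta> e *\<^sub>R af b (\<iota> i) e))"
  shows "corrected (ld b) (restrict0 (ld b) (af b x)) 1 0 (vec_tensor B (restrict0 (ld b) (af b (\<iota> \<beta>)))) =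
      vec_tensor B (restrict0 (ld b) (\<lambda>e. \<Sum>i\<in>UNIV. (K i \<beta> e + 1/2 * (\<Sum>\<epsilon>\<in>UNIV.
        matrix_inv (metric_matrix g e) $ i $ \<epsilon> * metric_deriv E (af b x e) g (\<lambda>\<theta> \<epsilon>. K \<theta> \<epsilon> e) \<epsilon> \<beta> e)) *\<^sub>R af b (\<iota> i) e))"
proof -
  let ?U = "ld b"
  define X where "X = restrict0 ?U (af b x)"
  define Y where "Y \<beta> = restrict0 ?U (af b (\<iota> \<beta>))" for \<beta>
  define Y' where "Y' \<beta> = restrict0 ?U (\<lambda>e. \<Sum>i\<in>UNIV. K i \<beta> e *\<^sub>R af b (\<iota> i) e)" for \<beta>
  have U: "mopen TE ?U" and U': "mopen (base B) ?U" using dom_open[OF b] by simp_all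
  note K' = K[folded X_def Y_def Y'_def]
  have X: "X \<in> sections B ?U" unfolding X_def by (rule af_section[OF b U]) simp
  have Y: "Y \<beta> \<in> sections B ?U" for \<beta> unfolding Y_def by (rule af_section[OF b U]) simp
  have Y'in: "Y' \<beta> e \<in> fibre B e" if "e \<in> ?U" for \<beta> e
    using that af_basis[OF b that] unfolding Y'_def
    by (simp add: restrict0_def del: af_simps)
       (intro subspace_sum subspace_scale basis_at_in[OF af_basis[OF b that]] basis_at_subspace[OF af_basis[OF b that]])
  have corr: "correction ?U X e (af b (\<iota> \<beta>) e) = (\<Sum>i\<in>UNIV. (1/2 * (\<Sum>\<epsilon>\<in>UNIV.
        matrix_inv (metric_matrix g e) $ i $ \<epsilon> * metric_deriv E (af b x e) g (\<lambda>\<theta> \<epsilon>. K \<theta> \<epsilon> e) \<epsilon> \<beta> e)) *\<^sub>R af b (\<iota> i) e)"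
    if e: "e \<in> ?U" for e
  proof -
    note bs = af_basis[OF b e] and afV = basis_at_in[OF af_basis[OF b e]]
    note pT = e_pts[OF b e]
    obtain c where c: "correction ?U X e (af b (\<iota> \<beta>) e) = (\<Sum>i\<in>UNIV. c i *\<^sub>R af b (\<iota> i) e)"
      using pres[OF e] unfolding X_def by blast
    have val: "Y i e = af b (\<iota> i) e" "Y' i e = (\<Sum>\<theta>\<in>UNIV. K \<theta> i e *\<^sub>R af b (\<iota> \<theta>) e)" "X e = af b x e" for i
      using e by (simp_all add: X_def Y_def Y'_def restrict0_def)
    have lin1: "G e [] [\<Sum>\<theta>\<in>UNIV. a \<theta> *\<^sub>R af b (\<iota> \<theta>) e, af b (\<iota> j) e] = (\<Sum>\<theta>\<in>UNIV. a \<theta> * g \<theta> j e)" for a j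
      using linear_over_sum[where e = "\<lambda>\<theta>. af b (\<iota> \<theta>) e" and a = a and I = UNIV,
          OF tensors02_linear(1)[OF G_tensor[OF b e] afV[of "\<iota> j"]] basis_at_subspace[OF bs] afV] by (simp add: g del: af_simps)
    have lin2: "G e [] [af b (\<iota> j) e, \<Sum>\<theta>\<in>UNIV. a \<theta> *\<^sub>R af b (\<iota> \<theta>) e] = (\<Sum>\<theta>\<in>UNIV. a \<theta> * g j \<theta> e)" for a j
      using linear_over_sum[where e = "\<lambda>\<theta>. af b (\<iota> \<theta>) e" and a = a and I = UNIV,
          OF tensors02_linear(2)[OF G_tensor[OF b e] afV[of "\<iota> j"]] basis_at_subspace[OF bs] afV] by (simp add: g del: af_simps)
    have md: "metric_deriv E (af b x e) g (\<lambda>\<theta> \<epsilon>. K \<theta> \<epsilon> e) \<epsilon> \<beta> e = 2 * (\<Sum>i\<in>UNIV. c i * g i \<epsilon> e)" for \<epsilon>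
    proof -
      have f: "g \<epsilon> \<beta> q = restrict0 ?U G q [] [Y \<epsilon> q, Y \<beta> q]" if "q \<in> ?U" for q
        using that by (simp add: g Y_def restrict0_def)
      have "tderiv TE e (ganchor (af b x e)) (g \<epsilon> \<beta>) =
          DG ?U X e [] [af b (\<iota> \<epsilon>) e, af b (\<iota> \<beta>) e] +
          restrict0 ?U G e [] [Y' \<epsilon> e, Y \<beta> e] + restrict0 ?U G e [] [Y \<epsilon> e, Y' \<beta> e]"
        using D_bilinear_form[OF U' X restrict_tensor[OF U] Y Y'in K' Y Y'in K' f e] unfolding val gtb_simps .
      also have "restrict0 ?U G e [] [Y' \<epsilon> e, Y \<beta> e] = (\<Sum>\<theta>\<in>UNIV. K \<theta> \<epsilon> e * g \<theta> \<beta> e)"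
        using lin1[of "\<lambda>\<theta>. K \<theta> \<epsilon> e" \<beta>] e unfolding val by (simp add: restrict0_def)
      also have "restrict0 ?U G e [] [Y \<epsilon> e, Y' \<beta> e] = (\<Sum>\<theta>\<in>UNIV. K \<theta> \<beta> e * g \<epsilon> \<theta> e)"
        using lin2[of \<epsilon> "\<lambda>\<theta>. K \<theta> \<beta> e"] e unfolding val by (simp add: restrict0_def)
      finally have "metric_deriv E (af b x e) g (\<lambda>\<theta> \<epsilon>. K \<theta> \<epsilon> e) \<epsilon> \<beta> e =
          DG ?U X e [] [af b (\<iota> \<epsilon>) e, af b (\<iota> \<beta>) e]"
        by (simp add: metric_deriv_def)
      also have "\<dots> = DG ?U X e [] [af b (\<iota> \<beta>) e, af b (\<iota> \<epsilon>) e]"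
        by (rule DG_symmetric[OF U X e afV afV])
      also have "\<dots> = 2 * G e [] [correction ?U X e (af b (\<iota> \<beta>) e), af b (\<iota> \<epsilon>) e]"
        using correction_eq[OF U' X e afV[of "\<iota> \<beta>"] afV[of "\<iota> \<epsilon>"]] by simp
      finally show ?thesis unfolding c lin1 .
    qed
    have "1/2 * (\<Sum>\<epsilon>\<in>UNIV. matrix_inv (metric_matrix g e) $ i $ \<epsilon> *
        metric_deriv E (af b x e) g (\<lambda>\<theta> \<epsilon>. K \<theta> \<epsilon> e) \<epsilon> \<beta> e) = c i" for i
    proof -
      let ?N = "matrix_inv (metric_matrix g e)"
      have sym: "g i \<epsilon> e = g \<epsilon> i e" for i \<epsilon> unfolding g by (rule G_symmetric[OF pT afV afV])
      have "?N ** metric_matrix g e = mat 1" using inv[OF e] unfolding invertible_def matrix_inv_def by (rule someI2_ex) blast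
      then have N: "(\<Sum>\<epsilon>\<in>UNIV. ?N $ i $ \<epsilon> * g \<epsilon> j e) = (if i = j then 1 else 0)" for j
        by (simp add: vec_eq_iff matrix_matrix_mult_def metric_matrix_def mat_def)
      have "1/2 * (\<Sum>\<epsilon>\<in>UNIV. ?N $ i $ \<epsilon> * metric_deriv E (af b x e) g (\<lambda>\<theta> \<epsilon>. K \<theta> \<epsilon> e) \<epsilon> \<beta> e) =
          (\<Sum>\<epsilon>\<in>UNIV. ?N $ i $ \<epsilon> * (\<Sum>j\<in>UNIV. c j * g j \<epsilon> e))"
        unfolding md by (simp add: sum_distrib_left algebra_simps)
      also have "\<dots> = (\<Sum>\<epsilon>\<in>UNIV. \<Sum>j\<in>UNIV. c j * (?N $ i $ \<epsilon> * g \<epsilon> j e))"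
        by (simp add: sum_distrib_left sym[of _ _] mult_ac)
      also have "\<dots> = (\<Sum>j\<in>UNIV. c j * (\<Sum>\<epsilon>\<in>UNIV. ?N $ i $ \<epsilon> * g \<epsilon> j e))"
        by (subst sum.swap) (simp add: sum_distrib_left)
      also have "\<dots> = c i" unfolding N by (simp add: if_distrib cong: if_cong)
      finally show ?thesis .
    qed
    then show ?thesis unfolding c by simp
  qed
  have "corrected ?U X 1 0 (vec_tensor B (Y \<beta>)) =
      vec_tensor B (restrict0 ?U (\<lambda>p. Y' \<beta> p + correction ?U X p (Y \<beta> p)))"
    by (rule corrected_vec[OF U' X Y Y'in K'])
  also have "restrict0 ?U (\<lambda>p. Y' \<beta> p + correction ?U X p (Y \<beta> p)) =
      restrict0 ?U (\<lambda>e. \<Sum>i\<in>UNIV. (K i \<beta> e + 1/2 * (\<Sum>\<epsilon>\<in>UNIV.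
        matrix_inv (metric_matrix g e) $ i $ \<epsilon> * metric_deriv E (af b x e) g (\<lambda>\<theta> \<epsilon>. K \<theta> \<epsilon> e) \<epsilon> \<beta> e)) *\<^sub>R af b (\<iota> i) e)"
  proof
    fix e
    show "restrict0 ?U (\<lambda>p. Y' \<beta> p + correction ?U X p (Y \<beta> p)) e = restrict0 ?U (\<lambda>e. \<Sum>i\<in>UNIV. (K i \<beta> e + 1/2 * (\<Sum>\<epsilon>\<in>UNIV.
        matrix_inv (metric_matrix g e) $ i $ \<epsilon> * metric_deriv E (af b x e) g (\<lambda>\<theta> \<epsilon>. K \<theta> \<epsilon> e) \<epsilon> \<beta> e)) *\<^sub>R af b (\<iota> i) e) e"
      using corr[of e] by (cases "e \<in> ?U") (simp_all add: restrict0_def Y_def Y'_def scaleR_add_left sum.distrib del: af_simps)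
  qed
  finally show ?thesis unfolding X_def Y_def .
qed

lemma correction_af_Inl:
  assumes b: "b \<in> locs L E" and e: "e \<in> ld b"
  shows "\<exists>c. correction (ld b) (restrict0 (ld b) (af b x)) e (af b (Inl \<beta>) e) = (\<Sum>i\<in>UNIV. c i *\<^sub>R af b (Inl i) e)"
proof -
  define v where "v = correction (ld b) (restrict0 (ld b) (af b x)) e (af b (Inl \<beta>) e)"
  have "v \<in> hor e"
    unfolding v_def
    by (rule correction_hor[OF dom_open[OF b] af_section[OF b dom_open[OF b] order_refl] e af_hor[OF b e]])
  then have v: "v \<in> fibre B e" and z: "\<And>a. coframe (af b) (Inr a) e v = 0" using hor_iff[OF b e] by blast+
  have "v = (\<Sum>i\<in>UNIV. coframe (af b) (Inl i) e v *\<^sub>R af b (Inl i) e)"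
    by (rule trans[OF af_expand[OF b e v]]) (simp add: z del: af_simps(2))
  then show ?thesis unfolding v_def[symmetric] by - (rule exI)
qed

lemma correction_af_Inr:
  assumes b: "b \<in> locs L E" and e: "e \<in> ld b"
  shows "\<exists>c. correction (ld b) (restrict0 (ld b) (af b x)) e (af b (Inr \<beta>) e) = (\<Sum>i\<in>UNIV. c i *\<^sub>R af b (Inr i) e)"
proof -
  define v where "v = correction (ld b) (restrict0 (ld b) (af b x)) e (af b (Inr \<beta>) e)"
  have "v \<in> vert e"
    unfolding v_def
    by (rule correction_vert[OF dom_open[OF b] af_section[OF b dom_open[OF b] order_refl] e af_vert[OF b e]])
  then have v: "v \<in> fibre B e" and z: "\<And>a. coframe (af b) (Inl a) e v = 0" using vert_iff'[OF b e] by blast+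
  have "v = (\<Sum>i\<in>UNIV. coframe (af b) (Inr i) e v *\<^sub>R af b (Inr i) e)"
    by (rule trans[OF af_expand[OF b e v]]) (simp add: z del: af_simps(2))
  then show ?thesis unfolding v_def[symmetric] by - (rule exI)
qed

end

section \<open>Existence of the metrical connection\<close>

theorem theorem5p4:
  fixes L :: "('m, 'n, 'f::real_vector, 'd::finite, 'p::finite) gla"
    and E :: "('m, real^'d, 'e::real_vector, 'r::finite) vbundle"
    and C :: "'m \<times> 'e \<Rightarrow> ('m, 'e, 'f, 'd, 'r) gvec \<Rightarrow> ('m, 'e, 'f, 'd, 'r) gvec"
    and D0 :: "('m \<times> 'e, ('m, 'e, 'f, 'd, 'r) gvec) cov_deriv"
    and G :: "'m \<times> 'e \<Rightarrow> ('m, 'e, 'f, 'd, 'r) gvec tensor"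
    and Hh0 :: "('m, 'n, 'e, 'f, 'd, 'r, 'p) loc \<Rightarrow> 'p \<Rightarrow> 'p \<Rightarrow> 'p \<Rightarrow> 'm \<times> 'e \<Rightarrow> real"
    and Hv0 :: "('m, 'n, 'e, 'f, 'd, 'r, 'p) loc \<Rightarrow> 'r \<Rightarrow> 'r \<Rightarrow> 'p \<Rightarrow> 'm \<times> 'e \<Rightarrow> real"
    and Vh0 :: "('m, 'n, 'e, 'f, 'd, 'r, 'p) loc \<Rightarrow> 'p \<Rightarrow> 'p \<Rightarrow> 'r \<Rightarrow> 'm \<times> 'e \<Rightarrow> real"
    and Vv0 :: "('m, 'n, 'e, 'f, 'd, 'r, 'p) loc \<Rightarrow> 'r \<Rightarrow> 'r \<Rightarrow> 'r \<Rightarrow> 'm \<times> 'e \<Rightarrow> real"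
  assumes "generalized_lie_algebroid L"
    and "vector_bundle E" and "base E = src L"
    and "rho_eta_connection L E C"
    and "distinguished_connection L E C D0"
    and "\<forall>b\<in>locs L E. connection_components L E C D0 b (Hh0 b) (Hv0 b) (Vh0 b) (Vv0 b)"
    and "pseudometrical_structure L E C G"
  shows "\<exists>D. distinguished_connection L E C D \<and>
    (\<forall>b\<in>locs L E.
       let \<delta> = (\<lambda>\<gamma>. adapted_frame L E C b (Inl \<gamma>)); vd = (\<lambda>c. adapted_frame L E C b (Inr c));
           gh = metric_h L E C G b; gv = metric_v L E C G b;
           ih = (\<lambda>e. matrix_inv (metric_matrix gh e)); iv = (\<lambda>e. matrix_inv (metric_matrix gv e))
       in connection_components L E C D b
         (\<lambda>\<alpha> \<beta> \<gamma> e. Hh0 b \<alpha> \<beta> \<gamma> e + 1/2 * (\<Sum>\<epsilon>\<in>UNIV. ih e $ \<alpha> $ \<epsilon> *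
            metric_deriv E (\<delta> \<gamma> e) gh (\<lambda>\<theta> \<epsilon>. Hh0 b \<theta> \<epsilon> \<gamma> e) \<epsilon> \<beta> e))
         (\<lambda>a a' \<gamma> e. Hv0 b a a' \<gamma> e + 1/2 * (\<Sum>\<epsilon>\<in>UNIV. iv e $ a $ \<epsilon> *
            metric_deriv E (\<delta> \<gamma> e) gv (\<lambda>\<theta> \<epsilon>. Hv0 b \<theta> \<epsilon> \<gamma> e) \<epsilon> a' e))
         (\<lambda>\<alpha> \<beta> c e. Vh0 b \<alpha> \<beta> c e + 1/2 * (\<Sum>\<epsilon>\<in>UNIV. ih e $ \<alpha> $ \<epsilon> *
            metric_deriv E (vd c e) gh (\<lambda>\<theta> \<epsilon>. Vh0 b \<theta> \<epsilon> c e) \<epsilon> \<beta> e))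
         (\<lambda>a a' c e. Vv0 b a a' c e + 1/2 * (\<Sum>\<epsilon>\<in>UNIV. iv e $ a $ \<epsilon> *
            metric_deriv E (vd c e) gv (\<lambda>\<theta> \<epsilon>. Vv0 b \<theta> \<epsilon> c e) \<epsilon> a' e))) \<and>
    (\<forall>W X. mopen (total_space E) W \<and> X \<in> sections (gtb L E) W \<longrightarrow>
       D W X 0 2 (restrict0 W G) = 0)"
proof -
  interpret distinguished L E C G D0
    using assms by unfold_locales
  have comps: "connection_components L E C D0 b (Hh0 b) (Hv0 b) (Vh0 b) (Vv0 b)" if "b \<in> locs L E" for b
    using assms(6) that by blast
  have gh: "gh b = (\<lambda>i j e. G e [] [af b (Inl i) e, af b (Inl j) e])"
    and gv: "gv b = (\<lambda>i j e. G e [] [af b (Inr i) e, af b (Inr j) e])" for b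
    by (simp_all add: fun_eq_iff metric_h_def metric_v_def)
  show ?thesis
    unfolding Let_def
  proof (intro exI[of _ corrected] conjI ballI allI impI)
    show "distinguished_connection L E C corrected" by (rule corrected_distinguished)
    show "corrected W X 0 2 (restrict0 W G) = 0" if "mopen TE W \<and> X \<in> sections B W" for W X
      using corrected_metric_zero that by blast
    fix b assume b: "b \<in> locs L E"
    note K = comps[OF b, unfolded connection_components_def Let_def]
    note h = corrected_components[where \<iota> = Inl, OF b metr_at(4)[OF b] gh correction_af_Inl[OF b]]
      and v = corrected_components[where \<iota> = Inr, OF b metr_at(5)[OF b] gv correction_af_Inr[OF b]]
    show "connection_components L E C corrected b
         (\<lambda>\<alpha> \<beta> \<gamma> e. Hh0 b \<alpha> \<beta> \<gamma> e + 1/2 * (\<Sum>\<epsilon>\<in>UNIV. matrix_inv (metric_matrix (gh b) e) $ \<alpha> $ \<epsilon> *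
            metric_deriv E (af b (Inl \<gamma>) e) (gh b) (\<lambda>\<theta> \<epsilon>. Hh0 b \<theta> \<epsilon> \<gamma> e) \<epsilon> \<beta> e))
         (\<lambda>a a' \<gamma> e. Hv0 b a a' \<gamma> e + 1/2 * (\<Sum>\<epsilon>\<in>UNIV. matrix_inv (metric_matrix (gv b) e) $ a $ \<epsilon> *
            metric_deriv E (af b (Inl \<gamma>) e) (gv b) (\<lambda>\<theta> \<epsilon>. Hv0 b \<theta> \<epsilon> \<gamma> e) \<epsilon> a' e))
         (\<lambda>\<alpha> \<beta> c e. Vh0 b \<alpha> \<beta> c e + 1/2 * (\<Sum>\<epsilon>\<in>UNIV. matrix_inv (metric_matrix (gh b) e) $ \<alpha> $ \<epsilon> *
            metric_deriv E (af b (Inr c) e) (gh b) (\<lambda>\<theta> \<epsilon>. Vh0 b \<theta> \<epsilon> c e) \<epsilon> \<beta> e))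
         (\<lambda>a a' c e. Vv0 b a a' c e + 1/2 * (\<Sum>\<epsilon>\<in>UNIV. matrix_inv (metric_matrix (gv b) e) $ a $ \<epsilon> *
            metric_deriv E (af b (Inr c) e) (gv b) (\<lambda>\<theta> \<epsilon>. Vv0 b \<theta> \<epsilon> c e) \<epsilon> a' e))"
      unfolding connection_components_def Let_def
    proof (intro conjI allI, goal_cases)
      case (1 \<beta> \<gamma>)
      show ?case by (rule h) (use K in blast)+
    next
      case (2 a' \<gamma>)
      show ?case by (rule v) (use K in blast)+
    next
      case (3 \<beta> c)
      show ?case by (rule h) (use K in blast)+
    next
      case (4 a' c)
      show ?case by (rule v) (use K in blast)+
    qed
  qed
qed

end
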